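(* Let $s\in\mathbb{R}$ and let $\Omega\subset\mathbb{R}^n$ be an open set with $\Omega_e:=\mathbb{R}^n\setminus\overline{\Omega}\ne\emptyset$. Let $L\colon H^s(\mathbb{R}^n)\times H^s(\mathbb{R}^n)\to\mathbb{R}$ be a bounded bilinear form, and let $W_1,W_2\subset\Omega_e$ be nonempty disjoint open sets such that $L$ has the right UCP on $W_1$ and the left UCP on $W_2$. Let $q_1,q_2\colon H^s(\mathbb{R}^n)\times H^s(\mathbb{R}^n)\to\mathbb{R}$ be local and bounded bilinear forms such that $L+q_1$ and $L+q_2$ are (strongly) coercive in $\widetilde{H}^s(\Omega)$. Suppose that $\Lambda_{L,q_1}[f][g]=\Lambda_{L,q_2}[f][g]$ for all $f\in C_c^\infty(W_1)$ and $g\in C_c^\infty(W_2)$. If additionally $\Lambda_{L,q_1}[f][g]=\Lambda_{L,q_2}[f][g]$ for all $f,g\in C_c^\infty(W)$, where $W\subset\Omega_e$ is open, then $q_1=q_2$ in $\widetilde{H}^s(W)\times\widetilde{H}^s(W)$. In particular, the following full data uniqueness result holds: if $W=\Omega_e$ and $q_1,q_2\in C(\mathbb{R}^n)$, then $q_1=q_2$ in $\mathbb{R}^n$; and if $W=\Omega_e$, $q_1,q_2\in L^1_{loc}(\mathbb{R}^n)$ and $\partial\Omega$ has measure zero, then $q_1=q_2$ a.e. in $\mathbb{R}^n$.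
   Context: $H^s(\mathbb{R}^n)$ is the $L^2$-based (real) Bessel potential space and, for an open set $U$, $\widetilde{H}^s(U)$ is the closure of $C_c^\infty(U)$ in $H^s(\mathbb{R}^n)$. Let $B\colon H^s(\mathbb{R}^n)\times H^s(\mathbb{R}^n)\to\mathbb{R}$ be a bounded bilinear form and $V\subset\mathbb{R}^n$ open and nonempty. - $B$ has the left UCP on $V$ if: $u\in H^s(\mathbb{R}^n)$, $u|_V=0$ and $B(u,\phi)=0$ for all $\phi\in C_c^\infty(V)$ imply $u\equiv0$. - $B$ has the right UCP on $V$ if: $u\in H^s(\mathbb{R}^n)$, $u|_V=0$ and $B(\phi,u)=0$ for all $\phi\in C_c^\infty(V)$ imply $u\equiv0$. - $B$ is local if $B(u,v)=0$ whenever $u,v\in H^s(\mathbb{R}^n)$ and $\operatorname{supp}(u)\cap\operatorname{supp}(v)=\emptyset$. - $B$ is (strongly) coercive in $\widetilde{H}^s(\Omega)$ if there is $c>0$ with $B(u,u)\ge c\|u\|_{H^s(\mathbb{R}^n)}^2$ for all $u\in\widetilde{H}^s(\Omega)$. If $B$ is bounded and coercive in $\widetilde{H}^s(\Omega)$, then for each $f\in H^s(\mathbb{R}^n)$ there is a unique $u_f\in H^s(\mathbb{R}^n)$ with $u_f-f\in\widetilde{H}^s(\Omega)$ and $B(u_f,\phi)=0$ for all $\phi\in\widetilde{H}^s(\Omega)$. With $X:=H^s(\mathbb{R}^n)/\widetilde{H}^s(\Omega)$, the exterior DN map $\Lambda_B\colon X\to X^*$ is $\Lambda_B[f][g]:=B(u_f,g)$.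 One writes $\Lambda_{L,q}:=\Lambda_{L+q}$. A function $q\in L^1_{loc}(\mathbb{R}^n)$ is identified with the bilinear form $q(u,v)=\int_{\mathbb{R}^n}quv\,dx$, $u,v\in C_c^\infty(\mathbb{R}^n)$; when $q_1,q_2$ are functions, it is part of the assumptions that these forms are bounded with respect to the $H^s(\mathbb{R}^n)$ norm (and hence extend to $H^s(\mathbb{R}^n)\times H^s(\mathbb{R}^n)$). *)

theory Defs
  imports "HOL-Analysis.Analysis"
begin

section \<open>Smooth, test and Schwartz functions\<close>

fun partials :: "'a::euclidean_space list \<Rightarrow> ('a \<Rightarrow> 'b::real_normed_vector) \<Rightarrow> 'a \<Rightarrow> 'b" where
  "partials [] f = f"
| "partials (v # vs) f = (\<lambda>x. frechet_derivative (partials vs f) (at x) v)"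

text \<open>All iterated partial derivatives exist and are (totally) differentiable.\<close>

definition smooth :: "('a::euclidean_space \<Rightarrow> 'b::real_normed_vector) \<Rightarrow> bool" where
  "smooth f \<longleftrightarrow> (\<forall>vs. set vs \<subseteq> Basis \<longrightarrow> (\<forall>x. partials vs f differentiable (at x)))"

definition test_functions :: "'a::euclidean_space set \<Rightarrow> ('a \<Rightarrow> real) set" where
  "test_functions U =
     {\<phi>. smooth \<phi> \<and> compact (closure {x. \<phi> x \<noteq> 0}) \<and> closure {x. \<phi> x \<noteq> 0} \<subseteq> U}"

definition schwartz :: "('a::euclidean_space \<Rightarrow> 'b::real_normed_vector) set" where
  "schwartz = {\<phi>. smooth \<phi> \<and>
     (\<forall>N vs. set vs \<subseteq> Basis \<longrightarrow> bounded (range (\<lambda>x. (1 + norm x) ^ N *\<^sub>R partials vs \<phi> x)))}"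

definition schwartz_seminorm :: "nat \<Rightarrow> ('a::euclidean_space \<Rightarrow> 'b::real_normed_vector) \<Rightarrow> real" where
  "schwartz_seminorm N \<phi> =
     (SUP (vs, x) \<in> {vs. set vs \<subseteq> Basis \<and> length vs \<le> N} \<times> UNIV.
        (1 + norm x) ^ N * norm (partials vs \<phi> x))"

section \<open>Real tempered distributions\<close>

text \<open>Continuous linear functionals on the real-valued Schwartz functions. The value \<open>0\<close> off the
  Schwartz functions makes equality of functionals equality of distributions.\<close>

definition is_tempered :: "(('a::euclidean_space \<Rightarrow> real) \<Rightarrow> real) \<Rightarrow> bool" where
  "is_tempered u \<longleftrightarrow>
     (\<forall>\<phi>\<in>schwartz. \<forall>\<psi>\<in>schwartz. u (\<lambda>x. \<phi> x + \<psi> x) = u \<phi> + u \<psi>) \<and>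
     (\<forall>c. \<forall>\<phi>\<in>schwartz. u (\<lambda>x. c * \<phi> x) = c * u \<phi>) \<and>
     (\<exists>C N. \<forall>\<phi>\<in>schwartz. \<bar>u \<phi>\<bar> \<le> C * schwartz_seminorm N \<phi>) \<and>
     (\<forall>\<phi>. \<phi> \<notin> schwartz \<longrightarrow> u \<phi> = 0)"

lemma partials_bdd_above:
  fixes \<phi> :: "'a::euclidean_space \<Rightarrow> 'b::real_normed_vector"
  assumes "\<phi> \<in> schwartz"
  shows "bdd_above ((\<lambda>(vs, x). (1 + norm x) ^ N * norm (partials vs \<phi> x)) `
           ({vs. set vs \<subseteq> Basis \<and> length vs \<le> M} \<times> UNIV))"
proof -
  let ?V = "{vs :: 'a list. set vs \<subseteq> Basis \<and> length vs \<le> M}"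
  let ?f = "\<lambda>(vs, x). (1 + norm x) ^ N * norm (partials vs \<phi> x)"
  have fin: "finite ?V" by (rule finite_lists_length_le) simp
  have b: "bdd_above (?f ` ({vs} \<times> UNIV))" if "vs \<in> ?V" for vs
  proof -
    have "bounded (range (\<lambda>x. (1 + norm x) ^ N *\<^sub>R partials vs \<phi> x))"
      using assms that by (auto simp: schwartz_def)
    then obtain B where "\<And>x. norm ((1 + norm x) ^ N *\<^sub>R partials vs \<phi> x) \<le> B"
      by (auto simp: bounded_iff)
    then show ?thesis by (auto intro!: bdd_aboveI[of _ B] simp: power_abs)
  qed
  have "?f ` (?V \<times> UNIV) = (\<Union>vs\<in>?V. ?f ` ({vs} \<times> UNIV))" by auto
  then show ?thesis using fin b by simp
qed

lemma schwartz_seminorm_upper: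
  assumes "\<phi> \<in> schwartz" "set vs \<subseteq> Basis" "length vs \<le> N"
  shows "(1 + norm x) ^ N * norm (partials vs \<phi> x) \<le> schwartz_seminorm N \<phi>"
  unfolding schwartz_seminorm_def
  using cSUP_upper[OF _ partials_bdd_above[OF assms(1), of N N], of "(vs, x)"] assms by auto

lemma schwartz_seminorm_mono:
  assumes \<phi>: "\<phi> \<in> schwartz" and "M \<le> N"
  shows "schwartz_seminorm M \<phi> \<le> schwartz_seminorm N \<phi>"
proof -
  let ?V = "{vs :: 'a list. set vs \<subseteq> Basis \<and> length vs \<le> M} \<times> (UNIV :: 'a set)"
  have ne: "?V \<noteq> {}" by (auto intro!: exI[of _ "[]"])
  have "(case p of (vs, x) \<Rightarrow> (1 + norm x) ^ M * norm (partials vs \<phi> x)) \<le> schwartz_seminorm N \<phi>"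
    if "p \<in> ?V" for p
  proof -
    obtain vs x where p: "p = (vs, x)" by (cases p)
    have "(1 + norm x) ^ M * norm (partials vs \<phi> x) \<le> (1 + norm x) ^ N * norm (partials vs \<phi> x)"
      using \<open>M \<le> N\<close> by (intro mult_right_mono power_increasing) auto
    also have "\<dots> \<le> schwartz_seminorm N \<phi>"
      using that p \<open>M \<le> N\<close> by (intro schwartz_seminorm_upper[OF \<phi>]) auto
    finally show ?thesis by (simp add: p)
  qed
  then show ?thesis
    unfolding schwartz_seminorm_def[of M] by (intro cSUP_least[OF ne]) auto
qed

lemma schwartz_seminorm_nonneg:
  assumes "\<phi> \<in> schwartz" shows "0 \<le> schwartz_seminorm N \<phi>"
  using schwartz_seminorm_upper[OF assms, of "[]" N 0] by simp (meson norm_ge_zero order_trans)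

typedef (overloaded) 'a tempered = "{u :: ('a::euclidean_space \<Rightarrow> real) \<Rightarrow> real. is_tempered u}"
  morphisms pairing Abs_tempered
  by (rule exI[of _ "\<lambda>_. 0"]) (auto simp: is_tempered_def intro!: exI[of _ 0])

setup_lifting type_definition_tempered

lemma is_tempered_add:
  assumes u: "is_tempered u" and v: "is_tempered v"
  shows "is_tempered (\<lambda>\<phi>. u \<phi> + v \<phi>)"
proof -
  from u obtain C N where C: "\<And>\<phi>. \<phi> \<in> schwartz \<Longrightarrow> \<bar>u \<phi>\<bar> \<le> C * schwartz_seminorm N \<phi>"
    unfolding is_tempered_def by blast
  from v obtain D M where D: "\<And>\<phi>. \<phi> \<in> schwartz \<Longrightarrow> \<bar>v \<phi>\<bar> \<le> D * schwartz_seminorm M \<phi>"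
    unfolding is_tempered_def by blast
  have "\<bar>u \<phi> + v \<phi>\<bar> \<le> (\<bar>C\<bar> + \<bar>D\<bar>) * schwartz_seminorm (max N M) \<phi>" if \<phi>: "\<phi> \<in> schwartz" for \<phi>
  proof -
    have "\<bar>u \<phi>\<bar> \<le> \<bar>C\<bar> * schwartz_seminorm N \<phi>"
      by (rule order_trans[OF C[OF \<phi>]]) (simp add: mult_right_mono schwartz_seminorm_nonneg[OF \<phi>])
    also have "\<dots> \<le> \<bar>C\<bar> * schwartz_seminorm (max N M) \<phi>"
      by (intro mult_left_mono schwartz_seminorm_mono[OF \<phi>]) auto
    finally have 1: "\<bar>u \<phi>\<bar> \<le> \<bar>C\<bar> * schwartz_seminorm (max N M) \<phi>" .
    have "\<bar>v \<phi>\<bar> \<le> \<bar>D\<bar> * schwartz_seminorm M \<phi>"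
      by (rule order_trans[OF D[OF \<phi>]]) (simp add: mult_right_mono schwartz_seminorm_nonneg[OF \<phi>])
    also have "\<dots> \<le> \<bar>D\<bar> * schwartz_seminorm (max N M) \<phi>"
      by (intro mult_left_mono schwartz_seminorm_mono[OF \<phi>]) auto
    finally show ?thesis using 1 abs_triangle_ineq[of "u \<phi>" "v \<phi>"] by (simp add: distrib_right)
  qed
  then have "\<exists>C N. \<forall>\<phi>\<in>schwartz. \<bar>u \<phi> + v \<phi>\<bar> \<le> C * schwartz_seminorm N \<phi>" by blast
  then show ?thesis using u v unfolding is_tempered_def by (simp add: algebra_simps)
qed

lemma is_tempered_scale:
  assumes u: "is_tempered u" shows "is_tempered (\<lambda>\<phi>. c * u \<phi>)"
proof -
  from u obtain C N where "\<And>\<phi>. \<phi> \<in> schwartz \<Longrightarrow> \<bar>u \<phi>\<bar> \<le> C * schwartz_seminorm N \<phi>"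
    unfolding is_tempered_def by blast
  then have "\<And>\<phi>. \<phi> \<in> schwartz \<Longrightarrow> \<bar>c * u \<phi>\<bar> \<le> (\<bar>c\<bar> * C) * schwartz_seminorm N \<phi>"
    by (simp add: abs_mult mult.assoc mult_left_mono)
  then have "\<exists>C N. \<forall>\<phi>\<in>schwartz. \<bar>c * u \<phi>\<bar> \<le> C * schwartz_seminorm N \<phi>" by blast
  then show ?thesis using u unfolding is_tempered_def by (simp add: algebra_simps)
qed

instantiation tempered :: (euclidean_space) real_vector
begin

lift_definition zero_tempered :: "'a tempered" is "\<lambda>_. 0"
  by (auto simp: is_tempered_def intro!: exI[of _ 0])

lift_definition plus_tempered :: "'a tempered \<Rightarrow> 'a tempered \<Rightarrow> 'a tempered"
  is "\<lambda>u v \<phi>. u \<phi> + v \<phi>" by (rule is_tempered_add)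

lift_definition uminus_tempered :: "'a tempered \<Rightarrow> 'a tempered"
  is "\<lambda>u \<phi>. - u \<phi>" using is_tempered_scale[of _ "- 1"] by simp

lift_definition minus_tempered :: "'a tempered \<Rightarrow> 'a tempered \<Rightarrow> 'a tempered"
  is "\<lambda>u v \<phi>. u \<phi> - v \<phi>"
  using is_tempered_add is_tempered_scale[of _ "- 1"] by fastforce

lift_definition scaleR_tempered :: "real \<Rightarrow> 'a tempered \<Rightarrow> 'a tempered"
  is "\<lambda>c u \<phi>. c * u \<phi>" by (rule is_tempered_scale)

instance
  by standard (transfer; simp add: algebra_simps fun_eq_iff)+

end

text \<open>Identification of a function with the distribution \<open>\<phi> \<mapsto> \<integral> f \<phi> dx\<close>; meaningful when the latter
  is tempered, in particular for test functions.\<close>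

definition distr_of_fun :: "('a::euclidean_space \<Rightarrow> real) \<Rightarrow> 'a tempered" where
  "distr_of_fun f = Abs_tempered (\<lambda>\<phi>. if \<phi> \<in> schwartz then LINT x|lborel. f x * \<phi> x else 0)"

lemma schwartz_differentiable:
  assumes "\<phi> \<in> schwartz" shows "\<phi> differentiable (at x)"
  using assms by (auto simp: schwartz_def smooth_def dest!: spec[of _ "[]"])

lemma schwartz_continuous:
  assumes "\<phi> \<in> schwartz" shows "continuous_on UNIV \<phi>"
  using schwartz_differentiable[OF assms]
  by (auto intro!: continuous_at_imp_continuous_on differentiable_imp_continuous_within)

lemma test_functions_continuous:
  assumes "f \<in> test_functions U" shows "continuous_on UNIV f"
proof -
  have "f differentiable (at x)" for x
    using assms by (auto simp: test_functions_def smooth_def dest!: spec[of _ "[]"])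
  then show ?thesis
    by (auto intro!: continuous_at_imp_continuous_on differentiable_imp_continuous_within)
qed

lemma integrable_test_mult:
  fixes g :: "'a::euclidean_space \<Rightarrow> real"
  assumes f: "f \<in> test_functions U" and g: "continuous_on UNIV g"
  shows "integrable lborel (\<lambda>x. f x * g x)"
proof -
  let ?K = "closure {x. f x \<noteq> 0}"
  have "compact ?K" using f by (auto simp: test_functions_def)
  moreover have "continuous_on ?K (\<lambda>x. f x * g x)"
    by (intro continuous_on_mult continuous_on_subset[OF test_functions_continuous[OF f]]
          continuous_on_subset[OF g]) auto
  ultimately have "integrable lborel (\<lambda>x. indicator ?K x *\<^sub>R (f x * g x))"
    by (rule borel_integrable_compact)
  moreover have "(\<lambda>x. indicator ?K x *\<^sub>R (f x * g x)) = (\<lambda>x. f x * g x)"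
    using closure_subset[of "{x. f x \<noteq> 0}"] by (force simp: fun_eq_iff indicator_def)
  ultimately show ?thesis by simp
qed

lemma add_schwartz:
  assumes \<phi>: "\<phi> \<in> schwartz" and \<psi>: "\<psi> \<in> schwartz"
  shows "(\<lambda>x. \<phi> x + \<psi> x) \<in> schwartz"
proof -
  have d: "partials vs \<phi> differentiable (at x)" "partials vs \<psi> differentiable (at x)"
    if "set vs \<subseteq> Basis" for vs x
    using that \<phi> \<psi> by (auto simp: schwartz_def smooth_def)
  have p: "partials vs (\<lambda>x. \<phi> x + \<psi> x) = (\<lambda>x. partials vs \<phi> x + partials vs \<psi> x)"
    if "set vs \<subseteq> Basis" for vs
    using that
  proof (induction vs)
    case (Cons v vs)
    have "frechet_derivative (\<lambda>x. partials vs \<phi> x + partials vs \<psi> x) (at x) =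
        (\<lambda>h. frechet_derivative (partials vs \<phi>) (at x) h +
             frechet_derivative (partials vs \<psi>) (at x) h)" for x
      using d[of vs x] Cons.prems
      by (intro frechet_derivative_at[symmetric] has_derivative_add)
        (auto simp: frechet_derivative_works)
    then show ?case using Cons by auto
  qed simp
  have "bounded (range (\<lambda>x. (1 + norm x) ^ N *\<^sub>R (partials vs \<phi> x + partials vs \<psi> x)))"
    if "set vs \<subseteq> Basis" for N vs
  proof -
    have "bounded (range (\<lambda>x. (1 + norm x) ^ N *\<^sub>R partials vs \<phi> x))"
      "bounded (range (\<lambda>x. (1 + norm x) ^ N *\<^sub>R partials vs \<psi> x))"
      using that \<phi> \<psi> by (auto simp: schwartz_def)
    from bounded_plus_comp[OF this] show ?thesis by (simp add: scaleR_add_right)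
  qed
  then show ?thesis using d p by (auto simp: schwartz_def smooth_def)
qed

lemma scale_schwartz:
  fixes \<phi> :: "'a::euclidean_space \<Rightarrow> real"
  assumes \<phi>: "\<phi> \<in> schwartz"
  shows "(\<lambda>x. c * \<phi> x) \<in> schwartz"
proof -
  have d: "partials vs \<phi> differentiable (at x)" if "set vs \<subseteq> Basis" for vs x
    using that \<phi> by (auto simp: schwartz_def smooth_def)
  have p: "partials vs (\<lambda>x. c * \<phi> x) = (\<lambda>x. c * partials vs \<phi> x)"
    if "set vs \<subseteq> Basis" for vs
    using that
  proof (induction vs)
    case (Cons v vs)
    have "frechet_derivative (\<lambda>x. c * partials vs \<phi> x) (at x) =
        (\<lambda>h. c * frechet_derivative (partials vs \<phi>) (at x) h)" for x
      using d[of vs x] Cons.prems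
      by (intro frechet_derivative_at[symmetric])
        (auto intro!: derivative_eq_intros simp: frechet_derivative_works)
    then show ?case using Cons by auto
  qed simp
  have "bounded (range (\<lambda>x. (1 + norm x) ^ N *\<^sub>R (c * partials vs \<phi> x)))"
    if "set vs \<subseteq> Basis" for N vs
  proof -
    have "bounded (range (\<lambda>x. (1 + norm x) ^ N *\<^sub>R partials vs \<phi> x))"
      using that \<phi> by (auto simp: schwartz_def)
    from bounded_scaling[OF this, of c] show ?thesis
      by (simp add: image_image algebra_simps)
  qed
  then show ?thesis using d p by (auto simp: schwartz_def smooth_def)
qed

lemma pairing_distr_of_fun:
  fixes f :: "'a::euclidean_space \<Rightarrow> real"
  assumes f: "f \<in> test_functions U" and \<phi>: "\<phi> \<in> schwartz"
  shows "pairing (distr_of_fun f) \<phi> = (LINT x|lborel. f x * \<phi> x)"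
proof -
  let ?u = "\<lambda>\<phi>. if \<phi> \<in> schwartz then LINT x|lborel. f x * \<phi> x else 0"
  have int: "integrable lborel (\<lambda>x. f x * \<phi> x)" if "\<phi> \<in> schwartz" for \<phi>
    by (rule integrable_test_mult[OF f schwartz_continuous[OF that]])
  have intf: "integrable lborel (\<lambda>x. norm (f x))"
    using integrable_test_mult[OF f, of "\<lambda>_. 1"] by (simp add: integrable_norm)
  have "\<bar>?u \<phi>\<bar> \<le> (LINT x|lborel. norm (f x)) * schwartz_seminorm 0 \<phi>" if "\<phi> \<in> schwartz" for \<phi>
  proof -
    have "norm (LINT x|lborel. f x * \<phi> x) \<le> (LINT x|lborel. norm (f x) * schwartz_seminorm 0 \<phi>)"
    proof (rule order_trans[OF integral_norm_bound], rule integral_mono)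
      show "norm (f x * \<phi> x) \<le> norm (f x) * schwartz_seminorm 0 \<phi>" for x
        using schwartz_seminorm_upper[OF that, of "[]" 0 x]
        by (auto simp: abs_mult intro!: mult_left_mono)
    qed (use int[OF that] intf in auto)
    then show ?thesis using that by simp
  qed
  then have "\<exists>C N. \<forall>\<phi>\<in>schwartz. \<bar>?u \<phi>\<bar> \<le> C * schwartz_seminorm N \<phi>" by blast
  then have "is_tempered ?u"
    unfolding is_tempered_def
    using int by (auto simp: add_schwartz scale_schwartz algebra_simps)
  then have "pairing (distr_of_fun f) = ?u"
    by (simp add: distr_of_fun_def Abs_tempered_inverse)
  then show ?thesis using \<phi> by simp
qed

definition vanishes_on :: "'a::euclidean_space tempered \<Rightarrow> 'a set \<Rightarrow> bool" where
  "vanishes_on u V \<longleftrightarrow> (\<forall>\<phi>\<in>test_functions V. pairing u \<phi> = 0)"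

definition distr_support :: "'a::euclidean_space tempered \<Rightarrow> 'a set" where
  "distr_support u = - \<Union>{V. open V \<and> vanishes_on u V}"

section \<open>Bessel potential spaces\<close>

text \<open>The Fourier transform is normalised to be unitary on \<open>L\<^sup>2\<close>. On distributions it is defined by
  duality, \<open>\<langle>\<F>u, \<phi>\<rangle> = \<langle>u, \<F>\<phi>\<rangle>\<close>, where the real distribution \<open>u\<close> acts complex-linearly on
  complex Schwartz functions.\<close>

definition fourier :: "('a::euclidean_space \<Rightarrow> complex) \<Rightarrow> 'a \<Rightarrow> complex" where
  "fourier \<phi> \<xi> = (2 * pi) powr (- (real DIM('a) / 2)) *\<^sub>R (LINT x|lborel. cis (- (x \<bullet> \<xi>)) * \<phi> x)"

definition fourier_distr :: "'a::euclidean_space tempered \<Rightarrow> ('a \<Rightarrow> complex) \<Rightarrow> complex" where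
  "fourier_distr u \<phi> =
     Complex (pairing u (\<lambda>x. Re (fourier \<phi> x))) (pairing u (\<lambda>x. Im (fourier \<phi> x)))"

definition has_fourier_fun :: "'a::euclidean_space tempered \<Rightarrow> ('a \<Rightarrow> complex) \<Rightarrow> bool" where
  "has_fourier_fun u g \<longleftrightarrow> g \<in> borel_measurable lborel \<and>
     (\<forall>\<phi>\<in>schwartz. integrable lborel (\<lambda>\<xi>. g \<xi> * \<phi> \<xi>) \<and>
        fourier_distr u \<phi> = (LINT \<xi>|lborel. g \<xi> * \<phi> \<xi>))"

definition Hs :: "real \<Rightarrow> 'a::euclidean_space tempered set" where
  "Hs s = {u. \<exists>g. has_fourier_fun u g \<and>
      integrable lborel (\<lambda>\<xi>. ((1 + (norm \<xi>)\<^sup>2) powr (s / 2) * norm (g \<xi>))\<^sup>2)}"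

definition Hs_norm :: "real \<Rightarrow> 'a::euclidean_space tempered \<Rightarrow> real" where
  "Hs_norm s u =
     sqrt (LINT \<xi>|lborel. ((1 + (norm \<xi>)\<^sup>2) powr (s / 2) * norm ((SOME g. has_fourier_fun u g) \<xi>))\<^sup>2)"

text \<open>The closure of \<open>C\<^sub>c\<^sup>\<infinity>(U)\<close> in \<open>H\<^sup>s\<close>.\<close>

definition Hs_tilde :: "real \<Rightarrow> 'a::euclidean_space set \<Rightarrow> 'a tempered set" where
  "Hs_tilde s U =
     {u \<in> Hs s. \<forall>\<epsilon>>0. \<exists>\<phi>\<in>test_functions U. Hs_norm s (u - distr_of_fun \<phi>) < \<epsilon>}"

section \<open>Bilinear forms and the exterior DN map\<close>

type_synonym 'a form = "'a tempered \<Rightarrow> 'a tempered \<Rightarrow> real"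

definition bounded_form :: "real \<Rightarrow> 'a::euclidean_space form \<Rightarrow> bool" where
  "bounded_form s B \<longleftrightarrow>
     (\<forall>u\<in>Hs s. \<forall>v\<in>Hs s. \<forall>w\<in>Hs s. B (u + v) w = B u w + B v w \<and> B w (u + v) = B w u + B w v) \<and>
     (\<forall>c. \<forall>u\<in>Hs s. \<forall>v\<in>Hs s. B (c *\<^sub>R u) v = c * B u v \<and> B u (c *\<^sub>R v) = c * B u v) \<and>
     (\<exists>C. \<forall>u\<in>Hs s. \<forall>v\<in>Hs s. \<bar>B u v\<bar> \<le> C * Hs_norm s u * Hs_norm s v)"

definition left_UCP :: "real \<Rightarrow> 'a::euclidean_space form \<Rightarrow> 'a set \<Rightarrow> bool" where
  "left_UCP s B V \<longleftrightarrow> (\<forall>u\<in>Hs s. vanishes_on u V \<and>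
     (\<forall>\<phi>\<in>test_functions V. B u (distr_of_fun \<phi>) = 0) \<longrightarrow> u = 0)"

definition right_UCP :: "real \<Rightarrow> 'a::euclidean_space form \<Rightarrow> 'a set \<Rightarrow> bool" where
  "right_UCP s B V \<longleftrightarrow> (\<forall>u\<in>Hs s. vanishes_on u V \<and>
     (\<forall>\<phi>\<in>test_functions V. B (distr_of_fun \<phi>) u = 0) \<longrightarrow> u = 0)"

definition local_form :: "real \<Rightarrow> 'a::euclidean_space form \<Rightarrow> bool" where
  "local_form s B \<longleftrightarrow>
     (\<forall>u\<in>Hs s. \<forall>v\<in>Hs s. distr_support u \<inter> distr_support v = {} \<longrightarrow> B u v = 0)"

definition coercive_on :: "real \<Rightarrow> 'a::euclidean_space set \<Rightarrow> 'a form \<Rightarrow> bool" where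
  "coercive_on s \<Omega> B \<longleftrightarrow> (\<exists>c>0. \<forall>u\<in>Hs_tilde s \<Omega>. B u u \<ge> c * (Hs_norm s u)\<^sup>2)"

definition exterior_solution ::
    "real \<Rightarrow> 'a::euclidean_space set \<Rightarrow> 'a form \<Rightarrow> 'a tempered \<Rightarrow> 'a tempered" where
  "exterior_solution s \<Omega> B f =
     (THE u. u \<in> Hs s \<and> u - f \<in> Hs_tilde s \<Omega> \<and> (\<forall>\<phi>\<in>Hs_tilde s \<Omega>. B u \<phi> = 0))"

text \<open>The class of \<open>f\<close> in the quotient \<open>X = H\<^sup>s / Hs_tilde s \<Omega>\<close>.\<close>

definition ext_class :: "real \<Rightarrow> 'a::euclidean_space set \<Rightarrow> 'a tempered \<Rightarrow> 'a tempered set" where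
  "ext_class s \<Omega> f = {h \<in> Hs s. h - f \<in> Hs_tilde s \<Omega>}"

text \<open>\<open>DN_map s \<Omega> B F G\<close> is \<open>\<Lambda>\<^sub>B F G\<close> for classes \<open>F, G \<in> X\<close>: the common value of \<open>B u\<^sub>f g\<close> over all
  representatives \<open>f \<in> F\<close> and \<open>g \<in> G\<close>. For bounded \<open>B\<close> coercive in \<open>Hs_tilde s \<Omega>\<close> it does not
  depend on them.\<close>

definition DN_map ::
    "real \<Rightarrow> 'a::euclidean_space set \<Rightarrow> 'a form \<Rightarrow> 'a tempered set \<Rightarrow> 'a tempered set \<Rightarrow> real" where
  "DN_map s \<Omega> B F G = the_elem (\<Union>f\<in>F. \<Union>g\<in>G. {B (exterior_solution s \<Omega> B f) g})"

text \<open>\<open>\<Lambda>\<^sub>L\<^sub>,\<^sub>q\<^sub>1[f][g] = \<Lambda>\<^sub>L\<^sub>,\<^sub>q\<^sub>2[f][g]\<close> for all \<open>f \<in> C\<^sub>c\<^sup>\<infinity>(V\<^sub>1)\<close> and \<open>g \<in> C\<^sub>c\<^sup>\<infinity>(V\<^sub>2)\<close>.\<close>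

definition same_DN_data ::
    "real \<Rightarrow> 'a::euclidean_space set \<Rightarrow> 'a form \<Rightarrow> 'a form \<Rightarrow> 'a form \<Rightarrow> 'a set \<Rightarrow> 'a set \<Rightarrow> bool" where
  "same_DN_data s \<Omega> L q1 q2 V1 V2 \<longleftrightarrow> (\<forall>f\<in>test_functions V1. \<forall>g\<in>test_functions V2.
     DN_map s \<Omega> (\<lambda>u v. L u v + q1 u v)
       (ext_class s \<Omega> (distr_of_fun f)) (ext_class s \<Omega> (distr_of_fun g)) =
     DN_map s \<Omega> (\<lambda>u v. L u v + q2 u v)
       (ext_class s \<Omega> (distr_of_fun f)) (ext_class s \<Omega> (distr_of_fun g)))"

definition locally_integrable :: "('a::euclidean_space \<Rightarrow> real) \<Rightarrow> bool" where
  "locally_integrable Q \<longleftrightarrow> (\<forall>K. compact K \<longrightarrow> Q absolutely_integrable_on K)"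

text \<open>The form \<open>q\<close> is given on test functions by the function \<open>Q\<close>. A bounded \<open>q\<close> is then the
  extension by density.\<close>

definition form_of_fun :: "('a::euclidean_space \<Rightarrow> real) \<Rightarrow> 'a form \<Rightarrow> bool" where
  "form_of_fun Q q \<longleftrightarrow> (\<forall>\<phi>\<in>test_functions UNIV. \<forall>\<psi>\<in>test_functions UNIV.
     q (distr_of_fun \<phi>) (distr_of_fun \<psi>) = (LINT x|lebesgue. Q x * \<phi> x * \<psi> x))"

end

theory Submission
  imports
    Defs
    "HOL-Computational_Algebra.Polynomial"
    "HOL-Probability.Characteristic_Functions"
    "HOL-Probability.Sinc_Integral"
begin

text \<open>Write \<open>q = q1 - q2\<close> and \<open>u\<^sub>f\<close>, \<open>u\<^sub>g\<^sup>*\<close> for the exterior solutions of \<open>L + q1\<close> and of the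
  adjoint of \<open>L + q2\<close>. The difference of the DN data is \<open>q(u\<^sub>f, u\<^sub>g\<^sup>*)\<close>, and since \<open>q\<close> is local and the
  data \<open>f\<close>, \<open>g\<close> live away from \<open>\<Omega>\<close>, this equals \<open>q(u\<^sub>f - f, u\<^sub>g\<^sup>* - g) + q(f, g)\<close>. For disjoint \<open>W1\<close>, \<open>W2\<close> the
  last term vanishes; by the two UCPs the functions \<open>u\<^sub>f - f\<close> and \<open>u\<^sub>g\<^sup>* - g\<close> are dense in \<open>Hs_tilde s \<Omega>\<close>
  (Runge approximation), so \<open>q = 0\<close> there. For \<open>f\<close>, \<open>g\<close> supported in the same \<open>W\<close> this leaves \<open>q(f, g) = 0\<close>.
  When the forms are functions, the fundamental lemma of the calculus of variations concludes in
  \<open>\<Omega>\<close> and in the exterior. Existence of exterior solutions rests on Lax--Milgram and hence on the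
  completeness of \<open>H\<^sup>s\<close>, for which Fourier inversion on Schwartz functions is needed: it bounds
  \<open>\<langle>u, \<phi>\<rangle>\<close> by the \<open>H\<^sup>s\<close> norm of \<open>u\<close>.\<close>

section \<open>Smooth and Schwartz functions\<close>

text \<open>The two arguments of \<open>q\<close> have to be freed one after the other. In the first
  slot, approximation uses solutions for \<open>L + q1\<close> and the right UCP of
  \<open>L\<close>; in the second slot it uses solutions of the adjoint problem for
  \<open>L + q2\<close>, where the left UCP of \<open>L\<close> becomes the right UCP of its
  transpose. Only once \<open>q\<close> is known to vanish on \<open>Hs_tilde s \<Omega>\<close>
  does data on a common set \<open>W\<close> say anything about \<open>q\<close> outside. Density is
  used in the form "a bounded functional killing the approximants is zero", with the functional
  represented through the form itself. The forms may be asymmetric: Riesz representation is proved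
  for the symmetric part, and a contraction handles the rest. On the analytic side, distributions
  form a plain real vector space and \<open>Hs_norm\<close> is just a function on it, for which a
  triangle inequality up to the factor 2 is proved. The obstacle to completeness is that a limit on
  the Fourier side must still be realised as a real tempered distribution.\<close>

lemma partials_append: "partials (vs @ ws) f = partials vs (partials ws f)"
  by (induction vs) auto

text \<open>\<open>partials\<close> iterates \<open>frechet_derivative\<close>, so rather than a
  formula for every iterated derivative one exhibits a class \<open>F\<close> stable under one
  partial derivative. Any derivative \<open>D\<close> will do, since uniqueness of the derivative
  identifies it with \<open>frechet_derivative\<close>. The two coinduction rules below rest on
  this.\<close>

lemma partials_closed:
  assumes "f \<in> F"
    and closed: "\<And>f. f \<in> F \<Longrightarrow> \<exists>D. (\<forall>x. (f has_derivative D x) (at x)) \<and> (\<forall>v\<in>Basis. (\<lambda>x. D x v) \<in> F)"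
    and "set vs \<subseteq> Basis"
  shows "partials vs f \<in> F"
  using assms(3)
proof (induction vs)
  case (Cons v vs)
  then obtain D where D: "\<And>x. (partials vs f has_derivative D x) (at x)" "(\<lambda>x. D x v) \<in> F"
    using closed[of "partials vs f"] by auto
  have "frechet_derivative (partials vs f) (at x) = D x" for x
    using frechet_derivative_at[OF D(1)] by simp
  then show ?case using D by simp
qed (use assms in simp)

lemma smooth_coinduct:
  assumes "f \<in> F"
    and "\<And>f. f \<in> F \<Longrightarrow> \<exists>D. (\<forall>x. (f has_derivative D x) (at x)) \<and> (\<forall>v\<in>Basis. (\<lambda>x. D x v) \<in> F)"
  shows "smooth f"
proof -
  have "partials vs f differentiable (at x)" if "set vs \<subseteq> Basis" for vs x
  proof -
    have "partials vs f \<in> F" by (rule partials_closed[where F = F]) (fact assms that)+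
    from assms(2)[OF this] show ?thesis unfolding differentiable_def by blast
  qed
  then show ?thesis by (simp add: smooth_def)
qed

text \<open>Decay has to be checked only for the members of \<open>F\<close> themselves: their
  iterated derivatives are again members.\<close>

lemma schwartz_coinduct:
  assumes "f \<in> F"
    and "\<And>f. f \<in> F \<Longrightarrow> \<exists>D. (\<forall>x. (f has_derivative D x) (at x)) \<and> (\<forall>v\<in>Basis. (\<lambda>x. D x v) \<in> F)"
    and "\<And>f N. f \<in> F \<Longrightarrow> \<exists>C. \<forall>x. (1 + norm x) ^ N * norm (f x) \<le> C"
  shows "f \<in> schwartz"
proof -
  have "bounded (range (\<lambda>x. (1 + norm x) ^ N *\<^sub>R partials vs f x))" if "set vs \<subseteq> Basis" for N vs
  proof -
    have "partials vs f \<in> F" by (rule partials_closed[where F = F]) (fact assms that)+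
    from assms(3)[OF this] obtain C where "\<And>x. (1 + norm x) ^ N * norm (partials vs f x) \<le> C"
      by blast
    then show ?thesis by (intro boundedI[of _ C]) (auto simp: power_abs)
  qed
  moreover have "smooth f" by (rule smooth_coinduct[where F = F]) (fact assms)+
  ultimately show ?thesis by (simp add: schwartz_def)
qed

lemma smooth_has_derivative:
  "smooth f \<Longrightarrow> (f has_derivative frechet_derivative f (at x)) (at x)"
  by (auto simp: smooth_def frechet_derivative_works[symmetric] dest!: spec[of _ "[]"])

lemma smooth_closedI:
  assumes "smooth f" and "\<And>v. v \<in> Basis \<Longrightarrow> (\<lambda>x. frechet_derivative f (at x) v) \<in> F"
  shows "\<exists>D. (\<forall>x. (f has_derivative D x) (at x)) \<and> (\<forall>v\<in>Basis. (\<lambda>x. D x v) \<in> F)"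
  by (rule exI[of _ "\<lambda>x. frechet_derivative f (at x)"])
    (intro conjI allI ballI assms smooth_has_derivative)

lemma smooth_partial: "smooth f \<Longrightarrow> v \<in> Basis \<Longrightarrow> smooth (partials [v] f)"
  unfolding smooth_def partials_append[symmetric] by simp

lemma schwartz_has_derivative:
  "\<phi> \<in> schwartz \<Longrightarrow> (\<phi> has_derivative frechet_derivative \<phi> (at x)) (at x)"
  using smooth_has_derivative by (auto simp: schwartz_def)

lemma schwartz_partials: "\<phi> \<in> schwartz \<Longrightarrow> set ws \<subseteq> Basis \<Longrightarrow> partials ws \<phi> \<in> schwartz"
  unfolding schwartz_def smooth_def by (auto simp: partials_append[symmetric])

lemma schwartz_partial: "\<phi> \<in> schwartz \<Longrightarrow> v \<in> Basis \<Longrightarrow> (\<lambda>x. frechet_derivative \<phi> (at x) v) \<in> schwartz"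
  using schwartz_partials[of \<phi> "[v]"] by simp

lemma schwartz_bound:
  assumes "\<phi> \<in> schwartz"
  shows "\<exists>C. \<forall>x. (1 + norm x) ^ N * norm (\<phi> x) \<le> C"
  using schwartz_seminorm_upper[OF assms, of "[]" N] by auto

lemma schwartz_bounded_linear:
  fixes \<phi> :: "'a::euclidean_space \<Rightarrow> 'b::real_normed_vector"
  assumes T: "bounded_linear T" and "\<phi> \<in> schwartz"
  shows "(\<lambda>x. T (\<phi> x)) \<in> schwartz"
proof (rule schwartz_coinduct[of _ "(\<lambda>\<phi> x. T (\<phi> x)) ` schwartz"])
  show "\<exists>D. (\<forall>x. (f has_derivative D x) (at x)) \<and> (\<forall>v\<in>Basis. (\<lambda>x. D x v) \<in> (\<lambda>\<phi> x. T (\<phi> x)) ` schwartz)"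
    if "f \<in> (\<lambda>(\<phi>::'a \<Rightarrow> 'b) x. T (\<phi> x)) ` schwartz" for f
  proof -
    from that obtain \<phi> :: "'a \<Rightarrow> 'b" where \<phi>: "\<phi> \<in> schwartz" "f = (\<lambda>x. T (\<phi> x))" by auto
    show ?thesis
      unfolding \<phi>(2)
      by (intro exI[of _ "\<lambda>x h. T (frechet_derivative \<phi> (at x) h)"] conjI allI ballI imageI
          bounded_linear.has_derivative[OF T] schwartz_has_derivative[OF \<phi>(1)])
        (use schwartz_partial[OF \<phi>(1)] in \<open>auto intro!: image_eqI\<close>)
  qed
  show "\<exists>C. \<forall>x. (1 + norm x) ^ N * norm (f x) \<le> C"
    if "f \<in> (\<lambda>(\<phi>::'a \<Rightarrow> 'b) x. T (\<phi> x)) ` schwartz" for f N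
  proof -
    from that obtain \<phi> :: "'a \<Rightarrow> 'b" where \<phi>: "\<phi> \<in> schwartz" "f = (\<lambda>x. T (\<phi> x))" by auto
    obtain C where C: "\<And>x. (1 + norm x) ^ N * norm (\<phi> x) \<le> C" using schwartz_bound[OF \<phi>(1)] by blast
    obtain K where K: "K \<ge> 0" "\<And>y. norm (T y) \<le> norm y * K"
      using bounded_linear.nonneg_bounded[OF T] by blast
    have "(1 + norm x) ^ N * norm (T (\<phi> x)) \<le> C * K" for x
    proof -
      have "(1 + norm x) ^ N * norm (T (\<phi> x)) \<le> (1 + norm x) ^ N * (norm (\<phi> x) * K)"
        by (intro mult_left_mono K) auto
      also have "\<dots> \<le> C * K" using mult_right_mono[OF C[of x] K(1)] by (simp add: mult.assoc)
      finally show ?thesis .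
    qed
    then show ?thesis using \<phi> by auto
  qed
qed (use assms in auto)

lemma schwartz_zero: "(\<lambda>_. 0) \<in> schwartz"
  by (rule schwartz_coinduct[of _ "{\<lambda>_. 0}"]) (auto intro!: exI[of _ "\<lambda>_ _. 0"])

lemma schwartz_inner_mult:
  fixes \<phi> :: "'a::euclidean_space \<Rightarrow> 'b::real_normed_vector"
  assumes "\<phi> \<in> schwartz"
  shows "(\<lambda>x. (x \<bullet> w) *\<^sub>R \<phi> x) \<in> schwartz"
proof -
  \<comment> \<open>Products with the linear factor are not stable on their own: differentiating
    that factor leaves a constant multiple of \<open>\<eta>\<close>, which the summand
    \<open>\<psi>\<close> absorbs.\<close>
  let ?F = "{f :: 'a \<Rightarrow> 'b. \<exists>\<psi>\<in>schwartz. \<exists>\<eta>\<in>schwartz. f = (\<lambda>x. \<psi> x + (x \<bullet> w) *\<^sub>R \<eta> x)}"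
  show ?thesis
  proof (rule schwartz_coinduct[of _ ?F])
    show "(\<lambda>x. (x \<bullet> w) *\<^sub>R \<phi> x) \<in> ?F"
      using assms schwartz_zero
      by (intro CollectI bexI[where x="\<lambda>_. 0"] bexI[where x=\<phi>]) auto
  next
    fix f assume "f \<in> ?F"
    then obtain \<psi> \<eta> where f: "f = (\<lambda>x. \<psi> x + (x \<bullet> w) *\<^sub>R \<eta> x)" and s: "\<psi> \<in> schwartz" "\<eta> \<in> schwartz"
      by auto
    let ?D = "\<lambda>x v. frechet_derivative \<psi> (at x) v +
        ((x \<bullet> w) *\<^sub>R frechet_derivative \<eta> (at x) v + (v \<bullet> w) *\<^sub>R \<eta> x)"
    have "(\<lambda>x. ?D x v) \<in> ?F" if v: "v \<in> Basis" for v
    proof -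
      have "(\<lambda>x. frechet_derivative \<psi> (at x) v + (v \<bullet> w) *\<^sub>R \<eta> x) \<in> schwartz"
        by (intro add_schwartz schwartz_partial s v schwartz_bounded_linear[OF bounded_linear_scaleR_right])
      moreover have "(\<lambda>x. ?D x v) = (\<lambda>x. (frechet_derivative \<psi> (at x) v + (v \<bullet> w) *\<^sub>R \<eta> x)
          + (x \<bullet> w) *\<^sub>R frechet_derivative \<eta> (at x) v)" by auto
      ultimately show ?thesis using schwartz_partial[OF s(2) v]
        by (intro CollectI bexI[where x="\<lambda>x. frechet_derivative \<psi> (at x) v + (v \<bullet> w) *\<^sub>R \<eta> x"]
            bexI[where x="\<lambda>x. frechet_derivative \<eta> (at x) v"])
    qed
    moreover have "(f has_derivative ?D x) (at x)" for x
      unfolding f by (intro has_derivative_add has_derivative_scaleR schwartz_has_derivative s)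
        (auto intro!: derivative_eq_intros)
    ultimately show "\<exists>D. (\<forall>x. (f has_derivative D x) (at x)) \<and> (\<forall>v\<in>Basis. (\<lambda>x. D x v) \<in> ?F)"
      by (intro exI[of _ ?D]) blast
    fix N
    obtain C1 where C1: "\<And>x. (1 + norm x) ^ N * norm (\<psi> x) \<le> C1" using schwartz_bound[OF s(1)] by blast
    \<comment> \<open>The weight is one power higher here to pay for the linear factor in front of
      \<open>\<eta>\<close>.\<close>
    obtain C2 where C2: "\<And>x. (1 + norm x) ^ Suc N * norm (\<eta> x) \<le> C2" using schwartz_bound[OF s(2)] by blast
    have "(1 + norm x) ^ N * norm (f x) \<le> C1 + norm w * C2" for x
    proof -
      have "norm ((x \<bullet> w) *\<^sub>R \<eta> x) \<le> norm w * ((1 + norm x) * norm (\<eta> x))"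
      proof -
        have "\<bar>x \<bullet> w\<bar> \<le> norm w * (1 + norm x)"
          by (rule order_trans[OF Cauchy_Schwarz_ineq2]) (simp add: mult.commute[of "norm x"] mult_left_mono)
        from mult_right_mono[OF this, of "norm (\<eta> x)"] show ?thesis by (simp add: mult.assoc)
      qed
      then have "(1 + norm x) ^ N * norm (f x) \<le>
          (1 + norm x) ^ N * (norm (\<psi> x) + norm w * ((1 + norm x) * norm (\<eta> x)))"
        unfolding f by (intro mult_left_mono order_trans[OF norm_triangle_ineq]) auto
      also have "\<dots> = (1 + norm x) ^ N * norm (\<psi> x) + norm w * ((1 + norm x) ^ Suc N * norm (\<eta> x))"
        by (simp add: algebra_simps)
      also have "\<dots> \<le> C1 + norm w * C2" by (intro add_mono mult_left_mono C1 C2) auto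
      finally show ?thesis .
    qed
    then show "\<exists>C. \<forall>x. (1 + norm x) ^ N * norm (f x) \<le> C" by blast
  qed
qed

lemma compact_support_bounded:
  fixes f :: "'a::euclidean_space \<Rightarrow> 'b::real_normed_vector"
  assumes "continuous_on UNIV f" "compact K" "\<And>x. x \<notin> K \<Longrightarrow> f x = 0"
  shows "\<exists>C. \<forall>x. norm (f x) \<le> C"
proof -
  have "compact (f ` K)"
    using assms by (intro compact_continuous_image) (auto intro: continuous_on_subset)
  then obtain C where "C > 0" "\<And>x. x \<in> K \<Longrightarrow> norm (f x) \<le> C"
    using compact_imp_bounded bounded_pos by (metis imageI)
  then have "\<forall>x. norm (f x) \<le> C" using assms(3) by (metis norm_zero less_imp_le)
  then show ?thesis by blast
qed

lemma test_functions_schwartz: "test_functions U \<subseteq> schwartz"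
proof
  fix \<phi> assume \<phi>: "\<phi> \<in> test_functions U"
  define K where "K = closure {x. \<phi> x \<noteq> 0}"
  have K: "compact K" using \<phi> by (simp add: K_def test_functions_def)
  \<comment> \<open>The set \<open>K\<close> is fixed once; demanding only vanishing off
    \<open>K\<close> avoids following how supports shrink under differentiation. Derivatives vanish
    off \<open>K\<close> because its complement is open.\<close>
  let ?F = "{f :: 'a \<Rightarrow> real. smooth f \<and> (\<forall>x. x \<notin> K \<longrightarrow> f x = 0)}"
  show "\<phi> \<in> schwartz"
  proof (rule schwartz_coinduct[of _ ?F])
    show "\<phi> \<in> ?F"
      using \<phi> closure_subset[of "{x. \<phi> x \<noteq> 0}"] by (auto simp: test_functions_def K_def)
  next
    fix f assume f: "f \<in> ?F"
    have "frechet_derivative f (at x) v = 0" if "x \<notin> K" for x v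
    proof -
      have o: "open (- K)" using K by (simp add: compact_imp_closed open_Compl)
      have "((\<lambda>_. 0) has_derivative (\<lambda>_. 0)) (at x)" by simp
      then have "(f has_derivative (\<lambda>_. 0)) (at x)"
        by (rule has_derivative_transform_within_open[OF _ o]) (use that f in auto)
      from fun_cong[OF frechet_derivative_at[OF this], of v] show ?thesis by simp
    qed
    then have closed: "(\<lambda>x. frechet_derivative f (at x) v) \<in> ?F" if "v \<in> Basis" for v
      using smooth_partial[of f v] f that by auto
    have "smooth f" using f by blast
    from smooth_closedI[OF this closed] show "\<exists>D. (\<forall>x. (f has_derivative D x) (at x)) \<and> (\<forall>v\<in>Basis. (\<lambda>x. D x v) \<in> ?F)"
      .
    fix N
    have "continuous_on UNIV f"
    proof (rule continuous_at_imp_continuous_on, rule ballI)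
      fix x show "isCont f x"
        by (rule has_derivative_continuous[OF smooth_has_derivative[OF \<open>smooth f\<close>]])
    qed
    then have "continuous_on UNIV (\<lambda>x. (1 + norm x) ^ N *\<^sub>R f x)" by (intro continuous_intros) 
    from compact_support_bounded[OF this K] f
    obtain C where "\<And>x. norm ((1 + norm x) ^ N *\<^sub>R f x) \<le> C" by auto
    then show "\<exists>C. \<forall>x. (1 + norm x) ^ N * norm (f x) \<le> C"
      by (auto simp: abs_mult power_abs)
  qed
qed

section \<open>Integrals of product functions and of Schwartz functions\<close>

text \<open>Lebesgue measure on \<open>'a\<close> is the image of the product of one-dimensional
  Lebesgue measures, so Fubini factorises the integral. Both the decay weight and the Gaussian are
  reduced to dimension one this way.\<close>

lemma has_bochner_integral_prod_Basis:
  fixes f :: "'a::euclidean_space \<Rightarrow> real \<Rightarrow> 'c::{real_normed_field,banach,second_countable_topology}"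
  assumes "\<And>b. b \<in> Basis \<Longrightarrow> integrable lborel (f b)"
  shows "has_bochner_integral lborel (\<lambda>x::'a. \<Prod>b\<in>Basis. f b (x \<bullet> b)) (\<Prod>b\<in>Basis. LINT t|lborel. f b t)"
proof -
  interpret product_sigma_finite "\<lambda>_::'a. lborel :: real measure" ..
  have f: "(\<lambda>x. f b (x \<bullet> b)) \<in> borel_measurable borel" if "b \<in> Basis" for b
    using borel_measurable_integrable[OF assms[OF that]] by measurable
  have eq: "(\<Prod>b\<in>Basis. f b ((\<Sum>b\<in>Basis. g b *\<^sub>R b) \<bullet> b)) = (\<Prod>b\<in>Basis. f b (g b))" for g
    by (intro prod.cong) (auto simp: inner_sum_left inner_Basis if_distrib cong: if_cong)
  have m: "(\<lambda>f. \<Sum>b\<in>Basis. f b *\<^sub>R b) \<in> (\<Pi>\<^sub>M b\<in>Basis. lborel) \<rightarrow>\<^sub>M (borel :: 'a measure)" by measurable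
  have m2: "(\<lambda>x. \<Prod>b\<in>Basis. f b (x \<bullet> b)) \<in> borel_measurable borel"
    using f by measurable
  show ?thesis
    unfolding has_bochner_integral_iff
    using product_integrable_prod[of Basis f] product_integral_prod[of Basis f] assms
    by (subst (1 2) lborel_eq) (simp add: integrable_distr_eq[OF m m2] integral_distr[OF m m2] eq)
qed

text \<open>The exponent gives two powers to each coordinate:
  \<open>1 + (x \<bullet> b)\<^sup>2\<close> is at most \<open>(1 + norm x)\<^sup>2\<close>, so this
  weight lies below a product of the integrable functions
  \<open>inverse (1 + t\<^sup>2)\<close>.\<close>

abbreviation decay :: "'a::euclidean_space \<Rightarrow> real" where
  "decay x \<equiv> inverse ((1 + norm x) ^ (2 * DIM('a)))"

lemma integrable_decay_weight:
  "integrable lborel (decay :: 'a::euclidean_space \<Rightarrow> real)"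
proof (rule Bochner_Integration.integrable_bound)
  have "integrable lborel (\<lambda>x::real. inverse (1 + x\<^sup>2))"
    using integrable_inverse_1_plus_square by (simp add: set_integrable_def einterval_def)
  then show "integrable lborel (\<lambda>x::'a. \<Prod>b\<in>Basis. inverse (1 + (x \<bullet> b)\<^sup>2))"
    using has_bochner_integral_prod_Basis[where f="\<lambda>_ t. inverse (1 + t\<^sup>2)" and 'a='a]
    by (auto intro: integrable.intros)
  show "AE x in lborel. norm (decay (x::'a)) \<le>
      norm (\<Prod>b\<in>Basis. inverse (1 + (x \<bullet> b)\<^sup>2))"
  proof (rule AE_I2)
    fix x :: 'a
    have "(\<Prod>b\<in>Basis. 1 + (x \<bullet> b)\<^sup>2) \<le> (\<Prod>b\<in>(Basis::'a set). (1 + norm x)\<^sup>2)"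
    proof (rule prod_mono)
      fix b :: 'a assume "b \<in> Basis"
      then have "(x \<bullet> b)\<^sup>2 \<le> (norm x)\<^sup>2" using Basis_le_norm[of b x] by (simp add: abs_le_square_iff[symmetric])
      also have "1 + (norm x)\<^sup>2 \<le> (1 + norm x)\<^sup>2" by (simp add: power2_sum)
      finally show "0 \<le> 1 + (x \<bullet> b)\<^sup>2 \<and> 1 + (x \<bullet> b)\<^sup>2 \<le> (1 + norm x)\<^sup>2" by simp
    qed
    also have "\<dots> = (1 + norm x) ^ (2 * DIM('a))" by (simp add: power_mult)
    finally have "decay x \<le> inverse (\<Prod>b\<in>Basis. 1 + (x \<bullet> b)\<^sup>2)"
      by (intro le_imp_inverse_le prod_pos) (auto simp: add_pos_nonneg)
    then show "norm (decay x) \<le> norm (\<Prod>b\<in>Basis. inverse (1 + (x \<bullet> b)\<^sup>2))"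
      by (simp add: prod_inversef[symmetric] prod_nonneg abs_of_nonneg comp_def)
  qed
qed auto

lemma schwartz_measurable:
  "\<phi> \<in> schwartz \<Longrightarrow> \<phi> \<in> borel_measurable borel"
  using schwartz_continuous by (rule borel_measurable_continuous_onI)

lemma integrable_decay:
  fixes f :: "'a::euclidean_space \<Rightarrow> 'b::{banach,second_countable_topology}"
  assumes "f \<in> borel_measurable borel" "\<And>x. (1 + norm x) ^ (2 * DIM('a)) * norm (f x) \<le> C"
  shows "integrable lborel f"
    and "norm (integral\<^sup>L lborel f) \<le> C * (LINT x|lborel. decay (x::'a))"
proof -
  let ?w = "\<lambda>x::'a. decay x"
  have b: "norm (f x) \<le> C * ?w x" for x
    using assms(2)[of x] by (simp add: field_simps add_pos_nonneg)
  have i: "integrable lborel (\<lambda>x. C * ?w x)" using integrable_decay_weight[where 'a='a] by simp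
  show f: "integrable lborel f"
    by (rule Bochner_Integration.integrable_bound[OF i])
      (use assms(1) b in \<open>auto intro!: AE_I2 order_trans[OF b] abs_ge_self\<close>)
  have "norm (integral\<^sup>L lborel f) \<le> (LINT x|lborel. C * ?w x)"
    by (rule order_trans[OF integral_norm_bound], rule integral_mono) (use f i b in auto)
  then show "norm (integral\<^sup>L lborel f) \<le> C * integral\<^sup>L lborel ?w" by simp
qed

lemma schwartz_integrable_power:
  fixes \<phi> :: "'a::euclidean_space \<Rightarrow> 'b::{banach,second_countable_topology}"
  assumes "\<phi> \<in> schwartz"
  shows "integrable lborel (\<lambda>x. (1 + norm x) ^ N *\<^sub>R \<phi> x)"
proof -
  obtain C where C: "\<And>x. (1 + norm x) ^ (2 * DIM('a) + N) * norm (\<phi> x) \<le> C"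
    using schwartz_bound[OF assms] by blast
  show ?thesis
    by (rule integrable_decay[of _ C])
      (use assms C schwartz_measurable[OF assms] in \<open>auto simp: power_add mult.assoc\<close>)
qed

section \<open>Bump functions and the fundamental lemma of the calculus of variations\<close>

text \<open>Allowing a polynomial in \<open>1 / t\<close> in front of the classical flat function
  \<open>exp (- (1 / t))\<close> yields a family closed under differentiation.\<close>

definition flat :: "real poly \<Rightarrow> real \<Rightarrow> real" where
  "flat p t = (if t > 0 then poly p (1 / t) * exp (- (1 / t)) else 0)"

text \<open>The extra power \<open>x ^ k\<close> makes the induction on \<open>p\<close> go through,
  since \<open>pCons a p\<close> shifts \<open>p\<close> by one power of \<open>x\<close>.\<close>

lemma tendsto_poly_exp_minus:
  "((\<lambda>x::real. x ^ k * poly p x * exp (- x)) \<longlongrightarrow> 0) at_top"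
proof (induction p arbitrary: k)
  case (pCons a p)
  have "((\<lambda>x. a * (x ^ k / exp x) + x ^ Suc k * poly p x * exp (- x)) \<longlongrightarrow> a * 0 + 0) at_top"
    by (intro tendsto_intros tendsto_power_div_exp_0 pCons)
  then show ?case by (simp add: algebra_simps exp_minus divide_inverse)
qed simp

lemma flat_tendsto_0: "(flat p \<longlongrightarrow> 0) (at 0)"
proof -
  have "((\<lambda>t. (1 / t) ^ 0 * poly p (1 / t) * exp (- (1 / t))) \<longlongrightarrow> 0) (at_right 0)"
    by (rule filterlim_compose[OF tendsto_poly_exp_minus]) (simp add: filterlim_inverse_at_top_right divide_inverse)
  then have "(flat p \<longlongrightarrow> 0) (at_right 0)"
    by (rule Lim_transform_eventually) (auto simp: flat_def eventually_at_right_less intro: eventually_at_rightI[of 0 1])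
  moreover have "(flat p \<longlongrightarrow> 0) (at_left 0)"
    by (rule Lim_transform_eventually[OF tendsto_const])
      (auto simp: flat_def intro: eventually_at_leftI[of "-1"])
  ultimately show ?thesis by (simp add: filterlim_split_at_real)
qed

text \<open>For \<open>t > 0\<close> both the polynomial and the exponential contribute a factor
  \<open>(1 / t)\<^sup>2\<close>, with opposite signs; this is the origin of
  \<open>monom 1 2 * (p - pderiv p)\<close>.\<close>

lemma flat_has_derivative:
  "(flat p has_real_derivative flat (monom 1 2 * (p - pderiv p)) t) (at t)"
proof -
  consider "t > 0" | "t < 0" | "t = 0" by linarith
  then show ?thesis
  proof cases
    case 1
    have "((\<lambda>t. poly p (1 / t) * exp (- (1 / t))) has_real_derivative
        flat (monom 1 2 * (p - pderiv p)) t) (at t)"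
      using 1 by (auto intro!: derivative_eq_intros simp: flat_def poly_monom field_simps power2_eq_square)
    then show ?thesis
      by (rule has_field_derivative_transform_within_open[where S = "{0<..}"]) (use 1 in \<open>auto simp: flat_def\<close>)
  next
    case 2
    have "((\<lambda>_. 0) has_real_derivative flat (monom 1 2 * (p - pderiv p)) t) (at t)"
      using 2 by (auto simp: flat_def)
    then show ?thesis
      by (rule has_field_derivative_transform_within_open[where S = "{..<0}"]) (use 2 in \<open>auto simp: flat_def\<close>)
  next
    case 3
    \<comment> \<open>At the origin the difference quotient is again a flat function, because
      dividing by \<open>h\<close> multiplies the polynomial by one more power of
      \<open>1 / h\<close>; hence it tends to zero.\<close>
    have "(\<lambda>h. (flat p (0 + h) - flat p 0) / h) = flat (pCons 0 p)"
      by (auto simp: fun_eq_iff flat_def)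
    then show ?thesis
      using flat_tendsto_0[of "pCons 0 p"] 3 unfolding DERIV_def by (simp add: flat_def)
  qed
qed

text \<open>Closure under sums and products matches the sum and product rules, and
  \<open>flat\<close> composed with an affine map differentiates to a constant times another such
  function. Hence the class satisfies the smoothness coinduction.\<close>

inductive_set bumps :: "('a::euclidean_space \<Rightarrow> real) set" where
  const: "(\<lambda>_. c) \<in> bumps"
| flat: "(\<lambda>x. flat p (x \<bullet> w + d)) \<in> bumps"
| add: "f \<in> bumps \<Longrightarrow> g \<in> bumps \<Longrightarrow> (\<lambda>x. f x + g x) \<in> bumps"
| mult: "f \<in> bumps \<Longrightarrow> g \<in> bumps \<Longrightarrow> (\<lambda>x. f x * g x) \<in> bumps"

lemma bumps_derivative:
  assumes "f \<in> bumps"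
  shows "\<exists>D. (\<forall>x. (f has_derivative D x) (at x)) \<and> (\<forall>v\<in>Basis. (\<lambda>x. D x v) \<in> bumps)"
  using assms
proof induction
  case (const c)
  show ?case by (rule exI[of _ "\<lambda>_ _. 0"]) (auto intro: bumps.intros)
next
  case (flat p w d)
  let ?q = "monom 1 2 * (p - pderiv p)"
  have "((\<lambda>x. flat p (x \<bullet> w + d)) has_derivative (\<lambda>h. flat ?q (x \<bullet> w + d) * (h \<bullet> w))) (at x)" for x
    by (rule has_derivative_compose[OF _ flat_has_derivative[THEN has_field_derivative_imp_has_derivative]])
      (auto intro!: derivative_eq_intros)
  moreover have "(\<lambda>x. flat ?q (x \<bullet> w + d) * (v \<bullet> w)) \<in> bumps" for v
    by (intro bumps.intros)
  ultimately show ?case by (intro exI[of _ "\<lambda>x h. flat ?q (x \<bullet> w + d) * (h \<bullet> w)"]) auto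
next
  case (add f g)
  then obtain D E where D: "\<And>x. (f has_derivative D x) (at x)" "\<And>v. v \<in> Basis \<Longrightarrow> (\<lambda>x. D x v) \<in> bumps"
    and E: "\<And>x. (g has_derivative E x) (at x)" "\<And>v. v \<in> Basis \<Longrightarrow> (\<lambda>x. E x v) \<in> bumps" by blast
  show ?case
    by (rule exI[of _ "\<lambda>x h. D x h + E x h"]) (auto intro!: has_derivative_add D E bumps.intros)
next
  case (mult f g)
  then obtain D E where D: "\<And>x. (f has_derivative D x) (at x)" "\<And>v. v \<in> Basis \<Longrightarrow> (\<lambda>x. D x v) \<in> bumps"
    and E: "\<And>x. (g has_derivative E x) (at x)" "\<And>v. v \<in> Basis \<Longrightarrow> (\<lambda>x. E x v) \<in> bumps" by blast
  show ?case
    by (rule exI[of _ "\<lambda>x h. f x * E x h + D x h * g x"])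
      (auto intro!: has_derivative_mult D E bumps.intros mult.hyps)
qed

lemma bumps_smooth: "f \<in> bumps \<Longrightarrow> smooth f"
  by (rule smooth_coinduct[where F = bumps]) (auto dest: bumps_derivative)

lemma bumps_prod: "finite I \<Longrightarrow> (\<And>i. i \<in> I \<Longrightarrow> f i \<in> bumps) \<Longrightarrow> (\<lambda>x. \<Prod>i\<in>I. f i x) \<in> bumps"
  by (induction I rule: finite_induct) (auto intro: bumps.intros)

definition cutoff :: "real \<Rightarrow> real" where "cutoff t = (if t > 0 then exp (- (1 / t)) else 0)"

text \<open>The parameter \<open>k\<close> is the steepness at the faces of the box: letting it grow
  pushes the function towards the indicator of \<open>box a b\<close>, and halving it squares the
  function.\<close>

definition box_bump :: "'a::euclidean_space \<Rightarrow> 'a \<Rightarrow> real \<Rightarrow> 'a \<Rightarrow> real" where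
  "box_bump a b k x = (\<Prod>i\<in>Basis. cutoff (k * (x \<bullet> i - a \<bullet> i)) * cutoff (k * (b \<bullet> i - x \<bullet> i)))"

lemma cutoff_eq_flat: "cutoff = flat 1"
  by (simp add: cutoff_def flat_def fun_eq_iff)

lemma cutoff_bounds: "0 \<le> cutoff t" "cutoff t \<le> 1"
  by (auto simp: cutoff_def)

lemma box_bump_bumps: "box_bump a b k \<in> bumps"
proof -
  have eq: "k * (x \<bullet> i - a \<bullet> i) = x \<bullet> (k *\<^sub>R i) + (- k * (a \<bullet> i))"
    "k * (b \<bullet> i - x \<bullet> i) = x \<bullet> (- k *\<^sub>R i) + k * (b \<bullet> i)" for x i
    by (auto simp: algebra_simps)
  show ?thesis
    unfolding box_bump_def cutoff_eq_flat eq by (intro bumps_prod bumps.intros) auto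
qed

lemma box_bump_measurable [measurable]: "box_bump a b k \<in> borel_measurable borel"
proof (rule borel_measurable_continuous_onI, rule continuous_at_imp_continuous_on, rule ballI)
  fix x show "isCont (box_bump a b k) x"
    by (rule has_derivative_continuous[OF smooth_has_derivative[OF bumps_smooth[OF box_bump_bumps]]])
qed

lemma box_bump_bounds: "0 \<le> box_bump a b k x" "box_bump a b k x \<le> 1"
  unfolding box_bump_def by (auto intro!: prod_nonneg prod_le_1 mult_le_one cutoff_bounds mult_nonneg_nonneg)

lemma box_bump_pos_iff: "k > 0 \<Longrightarrow> 0 < box_bump a b k x \<longleftrightarrow> x \<in> box a b"
proof -
  assume k: "k > 0"
  have "0 < cutoff (k * s) * cutoff (k * t) \<longleftrightarrow> s > 0 \<and> t > 0" for s t
    using k by (auto simp: cutoff_def zero_less_mult_iff)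
  moreover have pos: "0 < (\<Prod>i\<in>Basis. g i) \<longleftrightarrow> (\<forall>i\<in>Basis. 0 < g i)" if "\<And>i. 0 \<le> g i" for g :: "'a \<Rightarrow> real"
    using prod_pos[of Basis g] prod_zero_iff[of Basis g] that by (metis finite_Basis less_le)
  ultimately show ?thesis
    using k unfolding box_bump_def
    by (subst pos) (simp_all add: mem_box cutoff_bounds)
qed

lemma box_bump_eq_0: "k > 0 \<Longrightarrow> x \<notin> box a b \<Longrightarrow> box_bump a b k x = 0"
  using box_bump_pos_iff[of k a b x] box_bump_bounds(1)[of a b k x] by auto

lemma box_bump_test:
  assumes "k > 0" "cbox a b \<subseteq> U"
  shows "box_bump a b k \<in> test_functions U"
proof -
  have "closure {x. box_bump a b k x \<noteq> 0} \<subseteq> cbox a b"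
    using box_bump_eq_0[OF assms(1)] box_subset_cbox[of a b] by (intro closure_minimal) auto
  moreover from this have "compact (closure {x. box_bump a b k x \<noteq> 0})"
    by (metis bounded_cbox bounded_subset closed_closure compact_eq_bounded_closed)
  ultimately show ?thesis using assms bumps_smooth[OF box_bump_bumps] by (auto simp: test_functions_def)
qed

lemma box_bump_square: "k > 0 \<Longrightarrow> box_bump a b k x * box_bump a b k x = box_bump a b (k / 2) x"
proof -
  assume "k > 0"
  then have "cutoff (k * t) * cutoff (k * t) = cutoff (k / 2 * t)" for t
    by (auto simp: cutoff_def exp_add[symmetric] zero_less_mult_iff zero_less_divide_iff field_simps)
  then show ?thesis
    unfolding box_bump_def prod.distrib[symmetric]
    by (intro prod.cong) (simp_all only: mult.assoc mult.left_commute[of "cutoff (k * (b \<bullet> _ - _))"], simp_all only: mult.assoc[symmetric])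
qed

lemma box_bump_tendsto:
  "(\<lambda>n. box_bump a b (real (Suc n)) x) \<longlonglongrightarrow> indicator (box a b) x"
proof (cases "x \<in> box a b")
  case True
  have s: "(\<lambda>n. cutoff (real (Suc n) * t)) \<longlonglongrightarrow> 1" if "t > 0" for t
  proof -
    have "(\<lambda>n. exp (- (1 / real (Suc n) * (1 / t)))) \<longlonglongrightarrow> exp (- (0 * (1 / t)))"
      by (intro tendsto_intros LIMSEQ_Suc[OF lim_1_over_n])
    then show ?thesis using that by (simp add: cutoff_def)
  qed
  have "(\<lambda>n. box_bump a b (real (Suc n)) x) \<longlonglongrightarrow> (\<Prod>i\<in>(Basis::'a set). 1 * 1)"
    unfolding box_bump_def using True by (intro tendsto_prod tendsto_mult s) (auto simp: mem_box)
  then show ?thesis using True by simp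
qed (simp add: box_bump_eq_0)

text \<open>The bumps tend to indicators of boxes, which form a generating \<open>\<inter>\<close>-stable system. Only bumps occur
  in the hypothesis because \<open>box_bump a b k\<close> is the square of the bump with parameter \<open>2 * k\<close>, so that
  the conclusion also follows from integrals against products of test functions.\<close>

lemma integral_box_bump_zero_imp_AE:
  fixes f :: "'a::euclidean_space \<Rightarrow> real"
  assumes U: "open U"
    and int: "\<And>a b. cbox a b \<subseteq> U \<Longrightarrow> set_integrable lborel (cbox a b) f"
    and zero: "\<And>a b k. cbox a b \<subseteq> U \<Longrightarrow> k > 0 \<Longrightarrow> (LINT x|lborel. f x * box_bump a b k x) = 0"
  shows "AE x in lborel. x \<in> U \<longrightarrow> f x = 0"
proof -
  \<comment> \<open>Dominated convergence in the steepness parameter; the majorant is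
    \<open>f\<close> cut off to \<open>cbox a b\<close>, where it is known to be integrable.\<close>
  have box0: "(LINT x|lborel. indicator (box a b) x * f x) = 0" if ab: "cbox a b \<subseteq> U" for a b
  proof -
    have i: "integrable lborel (\<lambda>x. indicator (cbox a b) x * f x)"
      using int[OF ab] by (simp add: set_integrable_def)
    have eq: "f x * box_bump a b (real (Suc n)) x = (indicator (cbox a b) x * f x) * box_bump a b (real (Suc n)) x" for x n
      using box_bump_eq_0[of "real (Suc n)" x a b] box_subset_cbox[of a b] by (auto simp: indicator_def)
    have m: "box_bump a b k \<in> borel_measurable lborel" for k
      using box_bump_measurable by simp
    have "(\<lambda>n. LINT x|lborel. f x * box_bump a b (real (Suc n)) x)
        \<longlonglongrightarrow> (LINT x|lborel. (indicator (cbox a b) x * f x) * indicator (box a b) x)"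
      unfolding eq
    proof (rule integral_dominated_convergence[where w = "\<lambda>x. norm (indicator (cbox a b) x * f x)"])
      show "AE x in lborel. norm (indicator (cbox a b) x * f x * box_bump a b (real (Suc n)) x)
          \<le> norm (indicator (cbox a b) x * f x)" for n
        using box_bump_bounds[of a b "real (Suc n)"] by (auto simp: abs_mult mult_left_le)
    qed (use i m in \<open>auto intro!: tendsto_mult_left box_bump_tendsto simp del: of_nat_Suc\<close>)
    then have "(LINT x|lborel. (indicator (cbox a b) x * f x) * indicator (box a b) x) = 0"
      using zero[OF ab] by (simp add: LIMSEQ_const_iff)
    moreover have "(indicator (cbox a b) x * f x) * indicator (box a b) x = indicator (box a b) x * f x" for x
      using box_subset_cbox[of a b] by (auto simp: indicator_def)
    ultimately show ?thesis by simp
  qed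
  have AE_box: "AE x in lborel. x \<in> box a b \<longrightarrow> f x = 0" if ab: "cbox a b \<subseteq> U" for a b
  proof -
    let ?g = "\<lambda>x. indicator (box a b) x * f x"
    have "set_integrable lborel (box a b) f"
      by (rule set_integrable_subset[OF int[OF ab]]) (auto simp: box_subset_cbox)
    then have g: "integrable lborel ?g" by (simp add: set_integrable_def)
    have si: "set_integrable lborel A ?g" if "A \<in> sets borel" for A
      using integrable_mult_indicator[OF _ g, of A] that by (simp add: set_integrable_def)
    \<comment> \<open>Dynkin's argument. The intersection of two boxes is a box, so
      \<open>box0\<close> covers the generators; the complement case uses \<open>box0\<close> on
      \<open>box a b\<close> itself, which says that the total integral of \<open>?g\<close> is
      zero.\<close>
    have "set_lebesgue_integral lborel A ?g = 0" if "A \<in> sets borel" for A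
    proof -
      have A: "A \<in> sigma_sets UNIV (range (\<lambda>(a, b). box a b :: 'a set))"
        using that unfolding borel_eq_box by (simp add: sets_measure_of)
      have I: "Int_stable (range (\<lambda>(a, b). box a b :: 'a set))"
        by (auto simp: Int_stable_def box_Int_box)
      have P: "range (\<lambda>(a, b). box a b :: 'a set) \<subseteq> Pow UNIV" by simp
      from I P A show ?thesis
      proof (induction rule: sigma_sets_induct_disjoint)
        case (basic A)
        then obtain c d :: 'a where A: "A = box c d" by auto
        obtain l u where lu: "box c d \<inter> box a b = box l u" "cbox l u \<subseteq> cbox a b"
          by (rule that[OF box_Int_box]) (auto simp: mem_box)
        have e: "(\<lambda>x. indicator A x *\<^sub>R ?g x) = (\<lambda>x. indicator (box l u) x * f x)"
          using lu(1) A by (auto simp: indicator_def fun_eq_iff)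
        show ?case
          unfolding set_lebesgue_integral_def e using lu(2) ab by (intro box0) auto
      next
        case empty
        then show ?case by (simp add: set_lebesgue_integral_def)
      next
        case (compl A)
        have A: "A \<in> sets borel" using compl unfolding borel_eq_box by (simp add: sets_measure_of)
        have "set_lebesgue_integral lborel UNIV ?g = 0"
          using box0[OF ab] by (simp add: set_lebesgue_integral_def)
        moreover have "set_lebesgue_integral lborel (A \<union> (UNIV - A)) ?g =
            set_lebesgue_integral lborel A ?g + set_lebesgue_integral lborel (UNIV - A) ?g"
          using A by (intro set_integral_Un si) auto
        ultimately show ?case using compl by simp
      next
        case (union A)
        have A: "A i \<in> sets borel" for i using union(2) unfolding borel_eq_box by (auto simp: sets_measure_of)
        have "set_lebesgue_integral lborel (\<Union>i. A i) ?g = (\<Sum>i. set_lebesgue_integral lborel (A i) ?g)"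
          using A union(1) by (intro lebesgue_integral_countable_add si) (auto simp: disjoint_family_on_def)
        then show ?case using union by simp
      qed
    qed
    then have "AE x in lborel. ?g x = 0"
      using sigma_finite_measure.density_zero[OF sigma_finite_lborel g] by simp
    then show ?thesis by eventually_elim (auto simp: indicator_def)
  qed
  \<comment> \<open>The countable cover of \<open>U\<close> used below consists of closed boxes; the
    faces that they add form a null set.\<close>
  have AE_cbox: "AE x in lborel. x \<in> cbox a b \<longrightarrow> f x = 0" if ab: "cbox a b \<subseteq> U" for a b
  proof -
    have "AE x in lborel. x \<notin> cbox a b - box a b"
    proof (rule AE_not_in)
      show "cbox a b - box a b \<in> null_sets lborel"
        using negligible_frontier_interval[of a b]
        by (auto simp: negligible_iff_null_sets null_sets_completion_iff)
    qed
    with AE_box[OF ab] show ?thesis by eventually_elim auto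
  qed
  obtain \<D> where D: "countable \<D>" "\<D> \<subseteq> Pow U" "\<And>X. X \<in> \<D> \<Longrightarrow> \<exists>a b. X = cbox a b" "\<Union>\<D> = U"
    using open_countable_Union_open_cbox[OF U] by metis
  have "AE x in lborel. \<forall>X\<in>\<D>. x \<in> X \<longrightarrow> f x = 0"
  proof (subst AE_ball_countable[OF D(1)], rule ballI)
    fix X assume "X \<in> \<D>"
    with D obtain a b where "X = cbox a b" "cbox a b \<subseteq> U" by fast
    with AE_cbox show "AE x in lborel. x \<in> X \<longrightarrow> f x = 0" by simp
  qed
  then show ?thesis by eventually_elim (use D(4) in auto)
qed

text \<open>The hypothesis is diagonal to fit a bilinear form evaluated at a pair of equal test
  functions. What has to be added to the bump criterion is measure-theoretic: \<open>f\<close> is a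
  Lebesgue function, whereas the criterion concerns \<open>lborel\<close>, so \<open>f\<close> is
  replaced by a Borel function equal to it almost everywhere.\<close>

lemma fundamental_lemma_calculus_of_variations:
  fixes f :: "'a::euclidean_space \<Rightarrow> real"
  assumes "open U" "locally_integrable f"
    and zero: "\<And>\<phi>. \<phi> \<in> test_functions U \<Longrightarrow> (LINT x|lebesgue. f x * \<phi> x * \<phi> x) = 0"
  shows "AE x in lebesgue. x \<in> U \<longrightarrow> f x = 0"
proof -
  have si: "set_integrable lebesgue (cbox a b) f" for a b
    using assms(2) by (auto simp: locally_integrable_def)
  have "f \<in> borel_measurable lebesgue"
  proof (rule borel_measurable_LIMSEQ_real)
    \<comment> \<open>Local integrability yields measurability only after cutting off to compact
      sets; these cubes exhaust the space.\<close>
    let ?C = "\<lambda>n. cbox (- (real n *\<^sub>R One)) (real n *\<^sub>R One) :: 'a set"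
    show "(\<lambda>x. indicator (?C n) x * f x) \<in> borel_measurable lebesgue" for n
      using si[of "- (real n *\<^sub>R One)" "real n *\<^sub>R One"] by (simp add: set_integrable_def borel_measurable_integrable)
    fix x :: 'a
    obtain N where N: "norm x \<le> real N" using real_arch_simple by blast
    have "x \<in> ?C n" if "n \<ge> N" for n
    proof -
      have "\<bar>x \<bullet> i\<bar> \<le> real n" if "i \<in> Basis" for i
        using Basis_le_norm[OF that, of x] N \<open>n \<ge> N\<close> by linarith
      then have "- real n \<le> x \<bullet> i \<and> x \<bullet> i \<le> real n" if "i \<in> Basis" for i
        using that by (simp add: abs_le_iff) (metis minus_le_iff)
      then show ?thesis by (simp add: mem_box)
    qed
    then show "(\<lambda>n. indicator (?C n) x * f x) \<longlonglongrightarrow> f x"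
      by (intro tendsto_eventually eventually_sequentiallyI[of N]) auto
  qed
  then obtain g where g: "g \<in> borel_measurable lborel" "AE x in lborel. f x = g x"
    using completion_ex_borel_measurable_real by blast
  have fg: "AE x in lebesgue. f x = g x" using g(2) by (rule AE_completion)
  have "AE x in lborel. x \<in> U \<longrightarrow> g x = 0"
  proof (rule integral_box_bump_zero_imp_AE[OF assms(1)])
    fix a b :: 'a
    have "integrable lebesgue (\<lambda>x. indicator (cbox a b) x * g x)"
      using si[of a b] fg g(1) unfolding set_integrable_def
      by (subst integrable_cong_AE[of _ _ "\<lambda>x. indicator (cbox a b) x *\<^sub>R f x"])
        (auto simp: borel_measurable_integrable measurable_completion)
    then show "set_integrable lborel (cbox a b) g"
      using g(1) by (simp add: set_integrable_def integrable_completion)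
  next
    fix a b :: 'a and k :: real assume ab: "cbox a b \<subseteq> U" and k: "k > 0"
    \<comment> \<open>Doubling the parameter takes the square root of a bump, so the diagonal
      hypothesis delivers the integral against \<open>box_bump a b k\<close>.\<close>
    let ?\<phi> = "box_bump a b (2 * k)"
    have \<phi>: "?\<phi> \<in> test_functions U" using ab k by (intro box_bump_test) auto
    have m: "box_bump a b k \<in> borel_measurable lborel" for k
      using box_bump_measurable by simp
    have "(LINT x|lborel. g x * box_bump a b k x) = (LINT x|lebesgue. g x * box_bump a b k x)"
      using g(1) m by (simp add: integral_completion)
    also have "\<dots> = (LINT x|lebesgue. f x * ?\<phi> x * ?\<phi> x)"
    proof (rule integral_cong_AE)
      have m': "box_bump a b k \<in> borel_measurable lebesgue" for k
        using m[of k] by (simp add: measurable_completion)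
      then show "(\<lambda>x. f x * ?\<phi> x * ?\<phi> x) \<in> borel_measurable lebesgue"
        "(\<lambda>x. g x * box_bump a b k x) \<in> borel_measurable lebesgue"
        using \<open>f \<in> borel_measurable lebesgue\<close> measurable_completion[OF g(1)]
        by (auto intro!: borel_measurable_times simp del: measurable_lborel1)
      show "AE x in lebesgue. g x * box_bump a b k x = f x * ?\<phi> x * ?\<phi> x"
        using fg by eventually_elim (use box_bump_square[of "2 * k" a b] k in \<open>simp add: mult.assoc\<close>)
    qed
    finally show "(LINT x|lborel. g x * box_bump a b k x) = 0" using zero[OF \<phi>] by simp
  qed
  then have "AE x in lebesgue. x \<in> U \<longrightarrow> g x = 0" by (rule AE_completion)
  with fg show ?thesis by eventually_elim auto
qed

section \<open>The Fourier transform on Schwartz functions\<close>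

lemma cis_measurable [measurable]: "cis \<in> borel_measurable borel"
  by (intro borel_measurable_continuous_onI continuous_intros)

lemma integrable_cis_mult:
  fixes f :: "'a \<Rightarrow> complex"
  assumes f: "integrable M f" and [measurable]: "r \<in> borel_measurable M"
  shows "integrable M (\<lambda>x. cis (r x) * f x)"
  by (rule Bochner_Integration.integrable_bound[OF f])
    (use borel_measurable_integrable[OF f] in \<open>auto simp: norm_mult\<close>)

definition fourier_const :: "'a::euclidean_space itself \<Rightarrow> real" where
  "fourier_const _ = (2 * pi) powr (- (real DIM('a) / 2))"

lemma fourier_const_pos: "fourier_const TYPE('a::euclidean_space) > 0"
  by (simp add: fourier_const_def)

lemma fourier_eq:
  "fourier \<phi> \<xi> = fourier_const TYPE('a) *\<^sub>R (LINT x|lborel. cis (- (x \<bullet> \<xi>)) * \<phi> (x::'a::euclidean_space))"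
  by (simp add: fourier_def fourier_const_def)

lemma norm_fourier_le:
  fixes \<phi> :: "'a::euclidean_space \<Rightarrow> complex"
  shows "norm (fourier \<phi> \<xi>) \<le> fourier_const TYPE('a) * (LINT x|lborel. norm (\<phi> x))"
proof -
  have "norm (LINT x|lborel. cis (- (x \<bullet> \<xi>)) * \<phi> x) \<le> (LINT x|lborel. norm (cis (- (x \<bullet> \<xi>)) * \<phi> x))"
    by (rule integral_norm_bound)
  then show ?thesis using fourier_const_pos[where 'a='a] by (simp add: fourier_eq norm_mult mult_left_mono)
qed

lemma fourier_add:
  fixes \<phi> \<psi> :: "'a::euclidean_space \<Rightarrow> complex"
  assumes "integrable lborel \<phi>" "integrable lborel \<psi>"
  shows "fourier (\<lambda>x. \<phi> x + \<psi> x) \<xi> = fourier \<phi> \<xi> + fourier \<psi> \<xi>"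
  using integrable_cis_mult[OF assms(1), of "\<lambda>x. - (x \<bullet> \<xi>)"] integrable_cis_mult[OF assms(2), of "\<lambda>x. - (x \<bullet> \<xi>)"]
  by (simp add: fourier_eq distrib_left scaleR_add_right)

lemma fourier_cmult:
  "fourier (\<lambda>x. c * \<phi> x) \<xi> = c * fourier \<phi> \<xi>"
proof -
  have "(\<lambda>x. cis (- (x \<bullet> \<xi>)) * (c * \<phi> x)) = (\<lambda>x. c * (cis (- (x \<bullet> \<xi>)) * \<phi> x))" by auto
  then show ?thesis by (simp add: fourier_eq)
qed

lemma schwartz_imp_integrable:
  fixes \<phi> :: "'a::euclidean_space \<Rightarrow> 'b::{banach,second_countable_topology}"
  shows "\<phi> \<in> schwartz \<Longrightarrow> integrable lborel \<phi>"
  using schwartz_integrable_power[of \<phi> 0] by simp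

text \<open>The second-order Taylor bound for the exponential, with its factor 1/2 discarded. It is
  the quantitative input both for differentiating a Fourier transform and for difference quotients
  of a character.\<close>

lemma cis_taylor2: "norm (cis (a + s) - cis a - \<i> * s * cis a) \<le> s\<^sup>2"
proof -
  have "cis (a + s) - cis a - \<i> * s * cis a = cis a * (iexp s - (\<Sum>k\<le>1. (\<i> * s) ^ k / fact k))"
    unfolding cis_conv_exp[symmetric] by (simp add: cis_mult[symmetric] algebra_simps)
  then have "norm (cis (a + s) - cis a - \<i> * s * cis a) \<le> \<bar>s\<bar> ^ Suc 1 / fact (Suc 1)"
    using iexp_approx1[of s 1] by (simp add: norm_mult)
  also have "\<dots> \<le> s\<^sup>2" by (simp add: power2_eq_square)
  finally show ?thesis .
qed

lemma schwartz_cmult: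
  fixes \<phi> :: "'a::euclidean_space \<Rightarrow> complex"
  shows "\<phi> \<in> schwartz \<Longrightarrow> (\<lambda>x. c * \<phi> x) \<in> schwartz"
  by (rule schwartz_bounded_linear[OF bounded_linear_mult_right])

lemma schwartz_inner_cmult:
  fixes \<phi> :: "'a::euclidean_space \<Rightarrow> complex"
  assumes "\<phi> \<in> schwartz" shows "(\<lambda>x. - \<i> * (x \<bullet> h) * \<phi> x) \<in> schwartz"
proof -
  have "(\<lambda>x. - \<i> * (x \<bullet> h) * \<phi> x) = (\<lambda>x. - \<i> * ((x \<bullet> h) *\<^sub>R \<phi> x))"
    by (auto simp: scaleR_conv_of_real)
  then show ?thesis using schwartz_cmult[OF schwartz_inner_mult[OF assms, of h], of "- \<i>"] by simp
qed

text \<open>Integrating the Taylor bound for \<open>cis\<close> against \<open>\<phi>\<close> makes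
  the remainder quadratic in the increment. The constant is the second absolute moment of
  \<open>\<phi>\<close>, finite by Schwartz decay.\<close>

lemma fourier_has_derivative:
  fixes \<phi> :: "'a::euclidean_space \<Rightarrow> complex"
  assumes \<phi>: "\<phi> \<in> schwartz"
  shows "(fourier \<phi> has_derivative (\<lambda>h. fourier (\<lambda>x. - \<i> * (x \<bullet> h) * \<phi> x) \<xi>)) (at \<xi>)"
proof -
  let ?D = "\<lambda>h. fourier (\<lambda>x. - \<i> * (x \<bullet> h) * \<phi> x) \<xi>"
  note [measurable] = schwartz_measurable[OF \<phi>]
  define K where "K = fourier_const TYPE('a) * (LINT x|lborel. (norm x)\<^sup>2 * norm (\<phi> x))"
  have i0: "integrable lborel (\<lambda>x. (1 + norm x) ^ N * norm (\<phi> x))" for N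
    using schwartz_integrable_power[OF \<phi>, of N] by (auto dest: integrable_norm simp: power_abs)
  have i2: "integrable lborel (\<lambda>x. (norm x)\<^sup>2 * norm (\<phi> x))"
    by (rule Bochner_Integration.integrable_bound[OF i0[of 2]])
      (use \<phi> in \<open>auto intro!: mult_right_mono simp: abs_mult power_mono\<close>)
  have ih: "integrable lborel (\<lambda>x. - \<i> * (x \<bullet> h) * \<phi> x)" for h
    using schwartz_imp_integrable[OF schwartz_inner_cmult[OF \<phi>]] by simp
  have i: "integrable lborel \<phi>" using schwartz_imp_integrable[OF \<phi>] .
  have bl: "bounded_linear ?D"
  proof (rule bounded_linear_intro[where K = "fourier_const TYPE('a) * (LINT x|lborel. norm x * norm (\<phi> x))"])
    fix a b
    have "(\<lambda>x. - \<i> * (x \<bullet> (a + b)) * \<phi> x) = (\<lambda>x. - \<i> * (x \<bullet> a) * \<phi> x + - \<i> * (x \<bullet> b) * \<phi> x)"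
      by (auto simp: algebra_simps inner_add_right)
    then show "?D (a + b) = ?D a + ?D b" using fourier_add[OF ih ih, of a b \<xi>] by simp
  next
    fix r a
    have "(\<lambda>x. - \<i> * (x \<bullet> (r *\<^sub>R a)) * \<phi> x) = (\<lambda>x. of_real r * (- \<i> * (x \<bullet> a) * \<phi> x))"
      by (auto simp: algebra_simps)
    then show "?D (r *\<^sub>R a) = r *\<^sub>R ?D a"
      using fourier_cmult[of "of_real r" "\<lambda>x. - \<i> * (x \<bullet> a) * \<phi> x" \<xi>] by (simp add: scaleR_conv_of_real)
  next
    fix h
    have i1: "integrable lborel (\<lambda>x. norm x * norm (\<phi> x))"
      by (rule Bochner_Integration.integrable_bound[OF i0[of 1]])
        (use \<phi> in \<open>auto intro!: mult_right_mono simp: abs_mult\<close>)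
    have "norm (- \<i> * (x \<bullet> h) * \<phi> x) \<le> norm h * (norm x * norm (\<phi> x))" for x
      using mult_right_mono[OF Cauchy_Schwarz_ineq2[of x h], of "norm (\<phi> x)"]
      by (simp add: norm_mult mult.assoc mult.left_commute)
    then have "(LINT x|lborel. norm (- \<i> * (x \<bullet> h) * \<phi> x)) \<le> (LINT x|lborel. norm h * (norm x * norm (\<phi> x)))"
      using i1 ih[of h, THEN integrable_norm] by (intro integral_mono) auto
    also have "\<dots> = norm h * (LINT x|lborel. norm x * norm (\<phi> x))" by simp
    finally have "fourier_const TYPE('a) * (LINT x|lborel. norm (- \<i> * (x \<bullet> h) * \<phi> x)) \<le>
        fourier_const TYPE('a) * (norm h * (LINT x|lborel. norm x * norm (\<phi> x)))"
      using fourier_const_pos[where 'a='a] by (intro mult_left_mono) auto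
    from order_trans[OF norm_fourier_le this]
    show "norm (?D h) \<le> norm h * (fourier_const TYPE('a) * (LINT x|lborel. norm x * norm (\<phi> x)))"
      by (simp only: mult.left_commute[of "norm h"])
  qed
  have quad: "norm (fourier \<phi> (\<xi> + h) - fourier \<phi> \<xi> - ?D h) \<le> K * (norm h)\<^sup>2" for h
  proof -
    let ?r = "\<lambda>x. cis (- (x \<bullet> (\<xi> + h))) * \<phi> x - cis (- (x \<bullet> \<xi>)) * \<phi> x - cis (- (x \<bullet> \<xi>)) * (- \<i> * (x \<bullet> h) * \<phi> x)"
    have ia: "integrable lborel (\<lambda>x. cis (- (x \<bullet> \<eta>)) * \<phi> x)"
      and ic: "integrable lborel (\<lambda>x. cis (- (x \<bullet> \<eta>)) * (- \<i> * (x \<bullet> h) * \<phi> x))" for \<eta>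
      by (intro integrable_cis_mult i ih; simp)+
    have ir: "integrable lborel ?r"
      by (intro Bochner_Integration.integrable_diff ia ic)
    have eq: "fourier \<phi> (\<xi> + h) - fourier \<phi> \<xi> - ?D h = fourier_const TYPE('a) *\<^sub>R (LINT x|lborel. ?r x)"
      by (simp only: fourier_eq scaleR_diff_right Bochner_Integration.integral_diff[OF ia ia]
          Bochner_Integration.integral_diff[OF Bochner_Integration.integrable_diff[OF ia ia] ic])
    have r: "norm (?r x) \<le> (norm h)\<^sup>2 * ((norm x)\<^sup>2 * norm (\<phi> x))" for x
    proof -
      have "?r x = (cis (- (x \<bullet> \<xi>) + - (x \<bullet> h)) - cis (- (x \<bullet> \<xi>)) - \<i> * (- (x \<bullet> h)) * cis (- (x \<bullet> \<xi>))) * \<phi> x"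
        by (simp add: inner_add_right algebra_simps)
      also have "norm \<dots> \<le> (- (x \<bullet> h))\<^sup>2 * norm (\<phi> x)"
        using cis_taylor2[of "- (x \<bullet> \<xi>)" "- (x \<bullet> h)"]
        by (simp only: norm_mult) (intro mult_right_mono, auto)
      also have "(- (x \<bullet> h))\<^sup>2 \<le> (norm x * norm h)\<^sup>2"
        using Cauchy_Schwarz_ineq2[of x h] by (simp add: abs_le_square_iff[symmetric])
      finally show ?thesis by (simp add: power_mult_distrib mult_ac mult_right_mono)
    qed
    define I where "I = (LINT x|lborel. ?r x)"
    define J where "J = (LINT x|lborel. (norm x)\<^sup>2 * norm (\<phi> x))"
    have "norm I \<le> (LINT x|lborel. (norm h)\<^sup>2 * ((norm x)\<^sup>2 * norm (\<phi> x)))"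
      unfolding I_def by (rule order_trans[OF integral_norm_bound], rule integral_mono)
        (use r i2 ir[THEN integrable_norm] in auto)
    then have "norm I \<le> (norm h)\<^sup>2 * J" by (simp add: J_def)
    then show ?thesis
      unfolding eq K_def I_def[symmetric] J_def[symmetric] using fourier_const_pos[where 'a='a]
      by (simp add: mult.assoc mult.commute[of J])
  qed
  show ?thesis
  proof (rule has_derivativeI_sandwich[where e = 1 and H = "\<lambda>y. K * norm (y - \<xi>)"])
    show "((\<lambda>y. K * norm (y - \<xi>)) \<longlongrightarrow> 0) (at \<xi>)"
      by (auto intro!: tendsto_eq_intros)
    show "norm (fourier \<phi> y - fourier \<phi> \<xi> - ?D (y - \<xi>)) / norm (y - \<xi>) \<le> K * norm (y - \<xi>)"
      if "y \<noteq> \<xi>" for y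
      using quad[of "y - \<xi>"] that by (simp add: divide_le_eq power2_eq_square mult.assoc)
  qed (use bl in auto)
qed

section \<open>Translation, differentiation and decay on the Fourier side\<close>

lemma integral_lborel_affine:
  fixes f :: "'a::euclidean_space \<Rightarrow> 'b::{banach,second_countable_topology}"
  assumes [measurable]: "f \<in> borel_measurable borel" and "c \<noteq> 0"
  shows "(LINT x|lborel. f x) = \<bar>c\<bar> ^ DIM('a) *\<^sub>R (LINT x|lborel. f (t + c *\<^sub>R x))"
proof -
  have "(LINT x|lborel. f x) = (LINT x|distr lborel borel (\<lambda>x. t + c *\<^sub>R x). \<bar>c\<bar> ^ DIM('a) *\<^sub>R f x)"
    by (subst lborel_affine[OF assms(2), of t], subst integral_density) (auto simp: ennreal_power)
  also have "\<dots> = (LINT x|lborel. \<bar>c\<bar> ^ DIM('a) *\<^sub>R f (t + c *\<^sub>R x))"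
    by (subst integral_distr) auto
  finally show ?thesis by simp
qed

lemma integrable_lborel_affine:
  fixes f :: "'a::euclidean_space \<Rightarrow> 'b::{banach,second_countable_topology}"
  assumes f: "integrable lborel f" and "c \<noteq> 0"
  shows "integrable lborel (\<lambda>x. f (t + c *\<^sub>R x))"
proof -
  have [measurable]: "f \<in> borel_measurable borel" using borel_measurable_integrable[OF f] by simp
  have "integrable (distr lborel borel (\<lambda>x. t + c *\<^sub>R x)) (\<lambda>x. \<bar>c\<bar> ^ DIM('a) *\<^sub>R f x)"
    using f by (subst (asm) lborel_affine[OF assms(2), of t], subst (asm) integrable_density) (auto simp: ennreal_power)
  then have "integrable lborel (\<lambda>x. \<bar>c\<bar> ^ DIM('a) *\<^sub>R f (t + c *\<^sub>R x))"
    by (subst (asm) integrable_distr_eq) auto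
  from integrable_scaleR_right[OF this, of "inverse (\<bar>c\<bar> ^ DIM('a))"]
  show ?thesis using assms(2) by simp
qed

lemma difference_quotient_tendsto:
  fixes f :: "real \<Rightarrow> 'b::real_normed_vector"
  assumes "(f has_vector_derivative D) (at 0)" "t \<longlonglongrightarrow> 0" "\<And>n. t n \<noteq> 0"
  shows "(\<lambda>n. (f (t n) - f 0) /\<^sub>R t n) \<longlonglongrightarrow> D"
proof -
  have "((\<lambda>h. norm (f (0 + h) - f 0 - h *\<^sub>R D) / norm h) \<longlongrightarrow> 0) (at 0)"
    using assms(1) by (simp add: has_vector_derivative_def has_derivative_at)
  then have "(\<lambda>n. norm (f (0 + t n) - f 0 - t n *\<^sub>R D) / norm (t n)) \<longlonglongrightarrow> 0"
    by (rule filterlim_compose) (use assms(2,3) in \<open>auto simp: filterlim_at\<close>)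
  moreover have "norm (f (0 + t n) - f 0 - t n *\<^sub>R D) / norm (t n) = norm ((f (t n) - f 0) /\<^sub>R t n - D)" for n
  proof -
    have "(f (t n) - f 0) /\<^sub>R t n - D = (f (0 + t n) - f 0 - t n *\<^sub>R D) /\<^sub>R t n"
      using assms(3)[of n] by (simp add: scaleR_diff_right)
    then show ?thesis by (simp add: divide_inverse mult.commute)
  qed
  ultimately have "(\<lambda>n. norm ((f (t n) - f 0) /\<^sub>R t n - D)) \<longlonglongrightarrow> 0"
    by simp
  then have "(\<lambda>n. (f (t n) - f 0) /\<^sub>R t n - D) \<longlonglongrightarrow> 0"
    by (rule tendsto_norm_zero_cancel)
  then show ?thesis using LIM_zero_iff by blast
qed

lemma fourier_translate:
  fixes \<phi> :: "'a::euclidean_space \<Rightarrow> complex"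
  assumes [measurable]: "\<phi> \<in> borel_measurable borel"
  shows "fourier (\<lambda>x. \<phi> (x + a)) \<xi> = cis (a \<bullet> \<xi>) * fourier \<phi> \<xi>"
proof -
  have eq: "cis (- ((a + x) \<bullet> \<xi>)) * \<phi> (a + x) = cis (- (a \<bullet> \<xi>)) * (cis (- (x \<bullet> \<xi>)) * \<phi> (x + a))" for x
    by (simp add: inner_add_left cis_mult add.commute mult.assoc[symmetric])
  have "(LINT x|lborel. cis (- (x \<bullet> \<xi>)) * \<phi> x) = (LINT x|lborel. cis (- ((a + x) \<bullet> \<xi>)) * \<phi> (a + x))"
    by (subst integral_lborel_affine[where c = 1 and t = a]) auto
  also have "\<dots> = cis (- (a \<bullet> \<xi>)) * (LINT x|lborel. cis (- (x \<bullet> \<xi>)) * \<phi> (x + a))"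
    unfolding eq by (rule integral_mult_right_zero)
  finally have "cis (a \<bullet> \<xi>) * (LINT x|lborel. cis (- (x \<bullet> \<xi>)) * \<phi> x) =
      cis (a \<bullet> \<xi>) * cis (- (a \<bullet> \<xi>)) * (LINT x|lborel. cis (- (x \<bullet> \<xi>)) * \<phi> (x + a))"
    by (simp only: mult.assoc)
  then show ?thesis by (simp add: fourier_eq cis_mult)
qed

lemma fourier_partial:
  fixes \<phi> :: "'a::euclidean_space \<Rightarrow> complex"
  assumes \<phi>: "\<phi> \<in> schwartz" and v: "v \<in> Basis"
  shows "fourier (\<lambda>x. frechet_derivative \<phi> (at x) v) \<xi> = \<i> * (v \<bullet> \<xi>) * fourier \<phi> \<xi>"
proof -
  let ?D = "\<lambda>x. frechet_derivative \<phi> (at x) v"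
  let ?t = "\<lambda>n. inverse (real (Suc n))"
  \<comment> \<open>Difference quotients: translation turns into multiplication by a character, so no integration by
    parts in coordinates is needed.\<close>
  let ?q = "\<lambda>n x. (\<phi> (x + ?t n *\<^sub>R v) - \<phi> x) /\<^sub>R ?t n"
  have D: "?D \<in> schwartz" using schwartz_partial[OF \<phi> v] .
  have [measurable]: "\<phi> \<in> borel_measurable borel" "?D \<in> borel_measurable borel"
    by (rule schwartz_measurable[OF \<phi>], rule schwartz_measurable[OF D])
  have t0: "?t \<longlonglongrightarrow> 0" by (rule LIMSEQ_inverse_real_of_nat)
  obtain C where C: "\<And>x. (1 + norm x) ^ (2 * DIM('a)) * norm (?D x) \<le> C" using schwartz_bound[OF D] by blast
  have along: "((\<lambda>\<tau>. \<phi> (x + \<tau> *\<^sub>R v)) has_derivative (\<lambda>h. h *\<^sub>R ?D (x + \<tau> *\<^sub>R v))) (at \<tau>)" for x \<tau>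
  proof -
    have "((\<lambda>\<tau>. \<phi> (x + \<tau> *\<^sub>R v)) has_derivative (\<lambda>h. frechet_derivative \<phi> (at (x + \<tau> *\<^sub>R v)) (h *\<^sub>R v))) (at \<tau>)"
      by (rule has_derivative_compose[OF _ schwartz_has_derivative[OF \<phi>]]) (auto intro!: derivative_eq_intros)
    moreover have "frechet_derivative \<phi> (at (x + \<tau> *\<^sub>R v)) (h *\<^sub>R v) = h *\<^sub>R ?D (x + \<tau> *\<^sub>R v)" for h
      using has_derivative_bounded_linear[OF schwartz_has_derivative[OF \<phi>]]
      by (simp add: bounded_linear.linear linear_cmul)
    ultimately show ?thesis by simp
  qed
  \<comment> \<open>The mean value theorem gives a majorant independent of \<open>n\<close>. The
    intermediate point lies within distance 1 of \<open>x\<close>, so \<open>1 + norm x\<close> is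
    at most twice its value there; this is the origin of \<open>2 ^ (2 * DIM('a))\<close>.\<close>
  have q: "norm (?q n x) \<le> 2 ^ (2 * DIM('a)) * C * decay x" for n x
  proof -
    have "0 < ?t n" by simp
    have "continuous_on {0..?t n} (\<lambda>\<tau>. \<phi> (x + \<tau> *\<^sub>R v))"
      using along has_derivative_continuous by (blast intro: continuous_at_imp_continuous_on)
    from mvt_general[OF \<open>0 < ?t n\<close> this along]
    obtain \<tau> where \<tau>: "0 < \<tau>" "\<tau> < ?t n"
      "norm (\<phi> (x + ?t n *\<^sub>R v) - \<phi> x) \<le> norm (?t n *\<^sub>R ?D (x + \<tau> *\<^sub>R v))" by auto
    have "norm (d /\<^sub>R t) \<le> e" if "norm d \<le> t * e" "0 < t" for d :: complex and t e :: real
      using that by (simp add: field_simps)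
    from this[OF _ \<open>0 < ?t n\<close>] have "norm (?q n x) \<le> norm (?D (x + \<tau> *\<^sub>R v))"
      using \<tau>(3) \<open>0 < ?t n\<close> by (simp only: norm_scaleR abs_of_pos)
    also have "\<dots> \<le> 2 ^ (2 * DIM('a)) * C * decay x"
    proof -
      have "?t n \<le> 1" by (simp add: field_simps)
      then have "\<tau> \<le> 1" using \<tau>(2) by simp
      have "norm x \<le> norm (x + \<tau> *\<^sub>R v) + norm (\<tau> *\<^sub>R v)"
        using norm_triangle_ineq4[of "x + \<tau> *\<^sub>R v" "\<tau> *\<^sub>R v"] by simp
      moreover have "norm (\<tau> *\<^sub>R v) = \<tau>" using v \<open>0 < \<tau>\<close> by simp
      moreover have "1 + a \<le> 2 * (1 + b)" if "a \<le> b + c" "c = \<tau>" "0 \<le> b" for a b c :: real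
      proof -
        have "a \<le> b + \<tau>" using that by simp
        also have "\<dots> \<le> b + 1" using \<open>\<tau> \<le> 1\<close> by simp
        also have "\<dots> \<le> b + (b + 1)" using \<open>0 \<le> b\<close> by simp
        finally show ?thesis by simp
      qed
      ultimately have "1 + norm x \<le> 2 * (1 + norm (x + \<tau> *\<^sub>R v))"
        using norm_ge_zero by blast
      then have "(1 + norm x) ^ (2 * DIM('a)) \<le> 2 ^ (2 * DIM('a)) * (1 + norm (x + \<tau> *\<^sub>R v)) ^ (2 * DIM('a))"
        unfolding power_mult_distrib[symmetric] by (intro power_mono) auto
      then have "(1 + norm x) ^ (2 * DIM('a)) * norm (?D (x + \<tau> *\<^sub>R v)) \<le>
          2 ^ (2 * DIM('a)) * ((1 + norm (x + \<tau> *\<^sub>R v)) ^ (2 * DIM('a)) * norm (?D (x + \<tau> *\<^sub>R v)))"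
        unfolding mult.assoc[symmetric] by (intro mult_right_mono) auto
      also have "\<dots> \<le> 2 ^ (2 * DIM('a)) * C" by (intro mult_left_mono C) auto
      finally have "(1 + norm x) ^ (2 * DIM('a)) * norm (?D (x + \<tau> *\<^sub>R v)) \<le> 2 ^ (2 * DIM('a)) * C" .
      moreover have "(1 + norm x) ^ (2 * DIM('a)) > 0" by (simp add: add_pos_nonneg)
      ultimately show ?thesis by (simp add: field_simps)
    qed
    finally show ?thesis .
  qed
  have "(\<lambda>n. LINT x|lborel. cis (- (x \<bullet> \<xi>)) * ?q n x) \<longlonglongrightarrow> (LINT x|lborel. cis (- (x \<bullet> \<xi>)) * ?D x)"
  proof (rule integral_dominated_convergence)
    show "integrable lborel (\<lambda>x. 2 ^ (2 * DIM('a)) * C * decay (x::'a))"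
      using integrable_decay_weight[where 'a='a] by simp
    show "AE x in lborel. norm (cis (- (x \<bullet> \<xi>)) * ?q n x) \<le> 2 ^ (2 * DIM('a)) * C * decay x" for n
      using q by (auto simp only: norm_mult norm_cis mult_1)
    show "AE x in lborel. (\<lambda>n. cis (- (x \<bullet> \<xi>)) * ?q n x) \<longlonglongrightarrow> cis (- (x \<bullet> \<xi>)) * ?D x"
    proof (intro AE_I2 tendsto_mult_left)
      fix x
      have "((\<lambda>\<tau>. \<phi> (x + \<tau> *\<^sub>R v)) has_vector_derivative ?D x) (at 0)"
        using along[of x 0] by (simp add: has_vector_derivative_def)
      from difference_quotient_tendsto[OF this t0] show "(\<lambda>n. ?q n x) \<longlonglongrightarrow> ?D x"
        by simp
    qed
  qed measurable
  then have L: "(\<lambda>n. fourier (?q n) \<xi>) \<longlonglongrightarrow> fourier ?D \<xi>"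
    unfolding fourier_eq by (intro tendsto_scaleR tendsto_const)
  have F: "fourier (?q n) \<xi> = (cis (?t n * (v \<bullet> \<xi>)) - 1) /\<^sub>R ?t n * fourier \<phi> \<xi>" for n
  proof -
    have i: "integrable lborel \<phi>" using schwartz_imp_integrable[OF \<phi>] .
    have i': "integrable lborel (\<lambda>x. \<phi> (x + ?t n *\<^sub>R v))"
      using integrable_lborel_affine[OF i, of 1 "?t n *\<^sub>R v"] by (simp add: add.commute)
    have "fourier (?q n) \<xi> = fourier (\<lambda>x. of_real (inverse (?t n)) * (\<phi> (x + ?t n *\<^sub>R v) + (- 1) * \<phi> x)) \<xi>"
      by (simp add: scaleR_conv_of_real)
    also have "\<dots> = of_real (inverse (?t n)) * (fourier (\<lambda>x. \<phi> (x + ?t n *\<^sub>R v)) \<xi> + (- 1) * fourier \<phi> \<xi>)"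
      using i by (simp only: fourier_cmult) (subst fourier_add[OF i'], simp, simp only: fourier_cmult)
    finally show ?thesis
      by (simp add: fourier_translate scaleR_conv_of_real algebra_simps)
  qed
  \<comment> \<open>The derivative of the character at zero: \<open>cis_taylor2\<close> leaves an
    error of order \<open>?t n\<close>.\<close>
  have "(\<lambda>n. (cis (?t n * (v \<bullet> \<xi>)) - 1) /\<^sub>R ?t n) \<longlonglongrightarrow> \<i> * (v \<bullet> \<xi>)"
  proof (rule LIM_zero_cancel, rule Lim_null_comparison)
    have "norm ((cis (t * (v \<bullet> \<xi>)) - 1) /\<^sub>R t - \<i> * (v \<bullet> \<xi>)) \<le> t * (v \<bullet> \<xi>)\<^sup>2" if "t > 0" for t
    proof -
      have "(cis (t * (v \<bullet> \<xi>)) - 1) /\<^sub>R t - \<i> * (v \<bullet> \<xi>) =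
          ((cis (0 + t * (v \<bullet> \<xi>)) - cis 0 - \<i> * (t * (v \<bullet> \<xi>)) * cis 0) /\<^sub>R t)"
        using that by (simp add: scaleR_conv_of_real field_simps)
      also have "norm \<dots> \<le> (t * (v \<bullet> \<xi>))\<^sup>2 / t"
        using cis_taylor2[of 0 "t * (v \<bullet> \<xi>)"] that by (simp add: divide_right_mono divide_inverse_commute)
      also have "\<dots> = t * (v \<bullet> \<xi>)\<^sup>2" using that by (simp add: power2_eq_square)
      finally show ?thesis .
    qed
    then show "\<forall>\<^sub>F n in sequentially. norm ((cis (?t n * (v \<bullet> \<xi>)) - 1) /\<^sub>R ?t n - \<i> * (v \<bullet> \<xi>)) \<le> ?t n * (v \<bullet> \<xi>)\<^sup>2"
      by (intro always_eventually allI) (simp del: of_nat_Suc inverse_inverse_eq)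
    show "(\<lambda>n. ?t n * (v \<bullet> \<xi>)\<^sup>2) \<longlonglongrightarrow> 0" using tendsto_mult_left_zero[OF t0] by simp
  qed
  then have "(\<lambda>n. fourier (?q n) \<xi>) \<longlonglongrightarrow> \<i> * (v \<bullet> \<xi>) * fourier \<phi> \<xi>"
    unfolding F by (intro tendsto_mult tendsto_const)
  from LIMSEQ_unique[OF L this] show ?thesis .
qed

lemma fourier_iterated_partial:
  fixes \<phi> :: "'a::euclidean_space \<Rightarrow> complex"
  assumes \<phi>: "\<phi> \<in> schwartz" and v: "v \<in> Basis"
  shows "fourier (partials (replicate M v) \<phi>) \<xi> = (\<i> * (v \<bullet> \<xi>)) ^ M * fourier \<phi> \<xi>"
proof (induction M)
  case (Suc M)
  have "partials (replicate M v) \<phi> \<in> schwartz"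
    using v by (intro schwartz_partials \<phi>) auto
  from fourier_partial[OF this v, of \<xi>] Suc show ?case by simp
qed simp

text \<open>The norm exceeds the largest coordinate by at most a dimensional factor. Pure powers of
  single coordinates are used on the right because they correspond to repeated derivatives in one
  direction, so that decay of a Fourier transform can be read off from those.\<close>

lemma one_plus_norm_power_le:
  fixes \<xi> :: "'a::euclidean_space"
  shows "(1 + norm \<xi>) ^ M \<le> (1 + real DIM('a)) ^ M * (1 + (\<Sum>b\<in>Basis. \<bar>b \<bullet> \<xi>\<bar> ^ M))"
proof -
  \<comment> \<open>Inserting \<open>1\<close> into the maximum lets \<open>m\<close> also dominate
    the summand 1 in \<open>1 + norm \<xi>\<close>.\<close>
  define m where "m = Max (insert 1 ((\<lambda>b. \<bar>b \<bullet> \<xi>\<bar>) ` Basis))"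
  have m: "1 \<le> m" "\<And>b. b \<in> Basis \<Longrightarrow> \<bar>b \<bullet> \<xi>\<bar> \<le> m"
    unfolding m_def by (rule Max_ge; force)+
  have "m \<in> insert 1 ((\<lambda>b. \<bar>b \<bullet> \<xi>\<bar>) ` Basis)" unfolding m_def by (rule Max_in) auto
  then have mM: "m ^ M \<le> 1 + (\<Sum>b\<in>Basis. \<bar>b \<bullet> \<xi>\<bar> ^ M)"
  proof
    assume "m = 1" then show ?thesis by (simp add: sum_nonneg)
  next
    assume "m \<in> (\<lambda>b. \<bar>b \<bullet> \<xi>\<bar>) ` Basis"
    then obtain b where "b \<in> Basis" "m = \<bar>b \<bullet> \<xi>\<bar>" by blast
    then show ?thesis using member_le_sum[of b Basis "\<lambda>b. \<bar>b \<bullet> \<xi>\<bar> ^ M"] by simp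
  qed
  have "norm \<xi> \<le> (\<Sum>b\<in>Basis. \<bar>\<xi> \<bullet> b\<bar>)" by (rule norm_le_l1)
  also have "\<dots> \<le> (\<Sum>b\<in>(Basis::'a set). m)" using m(2) by (intro sum_mono) (simp add: inner_commute)
  finally have "1 + norm \<xi> \<le> (1 + real DIM('a)) * m" using m(1) by (simp add: algebra_simps)
  then have "(1 + norm \<xi>) ^ M \<le> ((1 + real DIM('a)) * m) ^ M" by (intro power_mono) auto
  also have "\<dots> = (1 + real DIM('a)) ^ M * m ^ M" by (rule power_mult_distrib)
  also have "\<dots> \<le> (1 + real DIM('a)) ^ M * (1 + (\<Sum>b\<in>Basis. \<bar>b \<bullet> \<xi>\<bar> ^ M))"
    by (intro mult_left_mono mM) auto
  finally show ?thesis .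
qed

text \<open>\<open>K\<close> is chosen before \<open>\<phi>\<close>, since the bound later serves as
  continuity in the Schwartz topology. \<open>M\<close> derivatives are spent on the power of
  \<open>1 + norm \<xi>\<close>, and the additional \<open>2 * DIM('a)\<close> weights make the
  differentiated function integrable.\<close>

lemma fourier_decay:
  shows "\<exists>K\<ge>0. \<forall>\<phi>\<in>schwartz. \<forall>\<xi>::'a::euclidean_space.
    (1 + norm \<xi>) ^ M * norm (fourier \<phi> \<xi>) \<le> K * schwartz_seminorm (M + 2 * DIM('a)) \<phi>"
proof -
  let ?N = "M + 2 * DIM('a)"
  define A where "A = fourier_const TYPE('a) * (LINT x|lborel. decay (x::'a))"
  have A0: "A \<ge> 0" unfolding A_def using fourier_const_pos[where 'a='a] by simp
  have *: "norm (fourier (partials vs \<phi>) \<xi>) \<le> A * schwartz_seminorm ?N \<phi>"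
    if \<phi>: "\<phi> \<in> schwartz" and vs: "set vs \<subseteq> Basis" "length vs \<le> M" for \<phi> and \<xi> :: 'a and vs
  proof -
    let ?\<psi> = "partials vs \<phi>"
    have \<psi>: "?\<psi> \<in> schwartz" using schwartz_partials[OF \<phi> vs(1)] .
    have "(1 + norm x) ^ (2 * DIM('a)) * norm (norm (?\<psi> x)) \<le> schwartz_seminorm ?N \<phi>" for x
    proof -
      have "(1 + norm x) ^ (2 * DIM('a)) * norm (?\<psi> x) \<le> (1 + norm x) ^ ?N * norm (?\<psi> x)"
        by (intro mult_right_mono power_increasing) auto
      also have "\<dots> \<le> schwartz_seminorm ?N \<phi>" using vs by (intro schwartz_seminorm_upper[OF \<phi>]) auto
      finally show ?thesis by simp
    qed
    from integrable_decay(2)[OF _ this]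
    have "(LINT x|lborel. norm (?\<psi> x)) \<le>
        schwartz_seminorm ?N \<phi> * (LINT x|lborel. decay (x::'a))"
      using schwartz_measurable[OF \<psi>] by simp
    from mult_left_mono[OF this fourier_const_pos[where 'a='a, THEN less_imp_le]]
    have "fourier_const TYPE('a) * (LINT x|lborel. norm (?\<psi> x)) \<le> A * schwartz_seminorm ?N \<phi>"
      unfolding A_def by (simp only: mult.assoc mult.commute[of "schwartz_seminorm _ _"])
    then show ?thesis using norm_fourier_le order_trans by blast
  qed
  define K where "K = (1 + real DIM('a)) ^ M * ((1 + real DIM('a)) * A)"
  have "(1 + norm \<xi>) ^ M * norm (fourier \<phi> \<xi>) \<le> K * schwartz_seminorm ?N \<phi>"
    if \<phi>: "\<phi> \<in> schwartz" for \<phi> and \<xi> :: 'a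
  proof -
    have "\<bar>b \<bullet> \<xi>\<bar> ^ M * norm (fourier \<phi> \<xi>) \<le> A * schwartz_seminorm ?N \<phi>" if "b \<in> Basis" for b
      using *[OF \<phi>, of "replicate M b" \<xi>] that fourier_iterated_partial[OF \<phi> that, of M \<xi>]
      by (auto simp: norm_mult norm_power in_set_replicate dest!: meta_mp[of "set _ \<subseteq> _"])
    then have s: "(\<Sum>b\<in>Basis. \<bar>b \<bullet> \<xi>\<bar> ^ M * norm (fourier \<phi> \<xi>)) \<le> (\<Sum>b\<in>(Basis::'a set). A * schwartz_seminorm ?N \<phi>)"
      by (intro sum_mono)
    have "(1 + norm \<xi>) ^ M * norm (fourier \<phi> \<xi>) \<le>
        (1 + real DIM('a)) ^ M * (1 + (\<Sum>b\<in>Basis. \<bar>b \<bullet> \<xi>\<bar> ^ M)) * norm (fourier \<phi> \<xi>)"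
      by (intro mult_right_mono one_plus_norm_power_le) auto
    also have "\<dots> = (1 + real DIM('a)) ^ M *
        (norm (fourier \<phi> \<xi>) + (\<Sum>b\<in>Basis. \<bar>b \<bullet> \<xi>\<bar> ^ M * norm (fourier \<phi> \<xi>)))"
      by (simp add: algebra_simps sum_distrib_left)
    also have "\<dots> \<le> (1 + real DIM('a)) ^ M * (A * schwartz_seminorm ?N \<phi> + (\<Sum>b\<in>(Basis::'a set). A * schwartz_seminorm ?N \<phi>))"
      using *[OF \<phi>, of "[]" \<xi>] s by (intro mult_left_mono add_mono) auto
    also have "\<dots> = K * schwartz_seminorm ?N \<phi>" by (simp add: K_def algebra_simps)
    finally show ?thesis .
  qed
  moreover have "K \<ge> 0" using A0 by (simp add: K_def)
  ultimately show ?thesis by blast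
qed

text \<open>Differentiating a Fourier transform yields the transform of another Schwartz function,
  so the class of all transforms is itself closed under partial derivatives.\<close>

lemma fourier_schwartz:
  fixes \<phi> :: "'a::euclidean_space \<Rightarrow> complex"
  assumes "\<phi> \<in> schwartz"
  shows "fourier \<phi> \<in> schwartz"
proof (rule schwartz_coinduct[of _ "fourier ` schwartz"])
  fix f :: "'a \<Rightarrow> complex" assume "f \<in> fourier ` schwartz"
  then obtain \<phi> where f: "f = fourier \<phi>" and \<phi>: "\<phi> \<in> schwartz" by blast
  show "\<exists>D. (\<forall>x. (f has_derivative D x) (at x)) \<and> (\<forall>v\<in>Basis. (\<lambda>x. D x v) \<in> fourier ` schwartz)"
    unfolding f
    by (rule exI[of _ "\<lambda>\<xi> h. fourier (\<lambda>x. - \<i> * (x \<bullet> h) * \<phi> x) \<xi>"])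
      (intro conjI allI ballI fourier_has_derivative[OF \<phi>] imageI schwartz_inner_cmult \<phi>)
  show "\<exists>C. \<forall>x. (1 + norm x) ^ N * norm (f x) \<le> C" for N
    using fourier_decay[where 'a='a, of N] \<phi> unfolding f by blast
qed (use assms in simp)

text \<open>Both sides are iterated integrals of
  \<open>cis (- (x \<bullet> \<xi>)) * \<phi> x * \<psi> \<xi>\<close>, which is absolutely
  integrable because the character has modulus one; Fubini exchanges them.\<close>

lemma fourier_multiplication_formula:
  fixes \<phi> \<psi> :: "'a::euclidean_space \<Rightarrow> complex"
  assumes i: "integrable lborel \<phi>" "integrable lborel \<psi>"
  shows "(LINT \<xi>|lborel. fourier \<phi> \<xi> * \<psi> \<xi>) = (LINT x|lborel. \<phi> x * fourier \<psi> x)"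
proof -
  have [measurable]: "\<phi> \<in> borel_measurable borel" "\<psi> \<in> borel_measurable borel"
    using i[THEN borel_measurable_integrable] by auto
  let ?f = "\<lambda>(x, \<xi>). cis (- (x \<bullet> \<xi>)) * \<phi> x * \<psi> \<xi>"
  have int: "integrable (lborel \<Otimes>\<^sub>M lborel) ?f"
  proof (rule lborel_pair.Fubini_integrable)
    show "integrable lborel (\<lambda>x. LINT \<xi>|lborel. norm (?f (x, \<xi>)))"
      using i[THEN integrable_norm] by (simp add: norm_mult)
    have "integrable lborel (\<lambda>\<xi>. ?f (x, \<xi>))" for x
    proof -
      have "integrable lborel (\<lambda>\<xi>. \<phi> x * (cis (- (x \<bullet> \<xi>)) * \<psi> \<xi>))"
        using integrable_cis_mult[OF i(2), of "\<lambda>\<xi>. - (x \<bullet> \<xi>)"] by simp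
      then show ?thesis by (simp add: mult_ac)
    qed
    then show "AE x in lborel. integrable lborel (\<lambda>\<xi>. ?f (x, \<xi>))" by simp
  qed measurable
  have 1: "(LINT x|lborel. cis (- (x \<bullet> \<xi>)) * \<phi> x * \<psi> \<xi>) = (LINT x|lborel. cis (- (x \<bullet> \<xi>)) * \<phi> x) * \<psi> \<xi>" for \<xi>
    by (rule integral_mult_left_zero)
  have 2: "(LINT \<xi>|lborel. cis (- (x \<bullet> \<xi>)) * \<phi> x * \<psi> \<xi>) = \<phi> x * (LINT \<xi>|lborel. cis (- (x \<bullet> \<xi>)) * \<psi> \<xi>)" for x
    by (subst integral_mult_right_zero[symmetric]) (simp add: mult_ac)
  have "(LINT \<xi>|lborel. (LINT x|lborel. cis (- (x \<bullet> \<xi>)) * \<phi> x) * \<psi> \<xi>) =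
      (LINT x|lborel. \<phi> x * (LINT \<xi>|lborel. cis (- (x \<bullet> \<xi>)) * \<psi> \<xi>))"
    using lborel_pair.Fubini_integral[OF int] unfolding 1 2 .
  then show ?thesis by (simp add: fourier_eq inner_commute)
qed

section \<open>The Gaussian and Fourier inversion\<close>

definition gauss :: "'a::euclidean_space \<Rightarrow> complex" where
  "gauss x = of_real (exp (- (norm x)\<^sup>2 / 2))"

text \<open>Up to the normalising factor \<open>sqrt (2 * pi)\<close> this is the characteristic
  function of the standard normal distribution.\<close>

lemma gauss_1d:
  shows "integrable lborel (\<lambda>t::real. cis (- (t * s)) * of_real (exp (- t\<^sup>2 / 2)))"
    and "(LINT t|lborel. cis (- (t * s)) * of_real (exp (- t\<^sup>2 / 2))) = of_real (sqrt (2 * pi) * exp (- s\<^sup>2 / 2))"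
proof -
  have eq: "cis (- (t * s)) * of_real (exp (- t\<^sup>2 / 2)) = of_real (sqrt (2 * pi)) * (std_normal_density t *\<^sub>R iexp (- s * t))" for t
    by (simp add: std_normal_density_def cis_conv_exp scaleR_conv_of_real mult_ac)
  have "integrable lborel std_normal_density" using integrable_normal_moment[of 1 0 0] by simp
  then have "integrable lborel (\<lambda>t. cis (- s * t) * complex_of_real (std_normal_density t))"
    by (intro integrable_cis_mult integrable_of_real) auto
  then have i: "integrable lborel (\<lambda>t. std_normal_density t *\<^sub>R iexp (- s * t))"
    by (simp add: cis_conv_exp scaleR_conv_of_real mult.commute)
  then show "integrable lborel (\<lambda>t::real. cis (- (t * s)) * of_real (exp (- t\<^sup>2 / 2)))"
    unfolding eq by (rule integrable_mult_right)
  have "(LINT t|lborel. std_normal_density t *\<^sub>R iexp (- s * t)) = char std_normal_distribution (- s)"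
    unfolding char_def by (subst integral_density) auto
  also have "\<dots> = of_real (exp (- s\<^sup>2 / 2))" by (simp add: char_std_normal_distribution)
  finally show "(LINT t|lborel. cis (- (t * s)) * of_real (exp (- t\<^sup>2 / 2))) = of_real (sqrt (2 * pi) * exp (- s\<^sup>2 / 2))"
    unfolding eq by (subst integral_mult_right_zero) simp
qed

lemma norm_power2_eq_sum: "(norm (x::'a::euclidean_space))\<^sup>2 = (\<Sum>b\<in>Basis. (x \<bullet> b)\<^sup>2)"
  by (simp add: norm_eq_sqrt_inner euclidean_inner[of x x] power2_eq_square sum_nonneg)

lemma gauss_fourier_integral:
  fixes \<xi> :: "'a::euclidean_space"
  shows "has_bochner_integral lborel (\<lambda>x. cis (- (x \<bullet> \<xi>)) * gauss x) (of_real (sqrt (2 * pi) ^ DIM('a)) * gauss \<xi>)"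
proof -
  let ?f = "\<lambda>b t. cis (- (t * (\<xi> \<bullet> b))) * complex_of_real (exp (- t\<^sup>2 / 2))"
  have "has_bochner_integral lborel (\<lambda>x::'a. \<Prod>b\<in>Basis. ?f b (x \<bullet> b)) (\<Prod>b\<in>(Basis::'a set). LINT t|lborel. ?f b t)"
    by (rule has_bochner_integral_prod_Basis) (rule gauss_1d)
  moreover have "(\<Prod>b\<in>Basis. ?f b (x \<bullet> b)) = cis (- (x \<bullet> \<xi>)) * gauss x" for x :: 'a
  proof -
    have "(\<Prod>b\<in>Basis. cis (- ((x \<bullet> b) * (\<xi> \<bullet> b)))) = cis (- (x \<bullet> \<xi>))"
      by (simp add: cis_conv_exp exp_sum[symmetric] euclidean_inner[of x \<xi>] sum_distrib_left sum_negf)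
    moreover have "(\<Prod>b\<in>Basis. complex_of_real (exp (- (x \<bullet> b)\<^sup>2 / 2))) = gauss x"
      by (simp only: of_real_prod[symmetric] exp_sum[symmetric] finite_Basis gauss_def norm_power2_eq_sum)
        (simp add: sum_negf sum_divide_distrib)
    ultimately show ?thesis by (simp add: prod.distrib)
  qed
  moreover have "(\<Prod>b\<in>(Basis::'a set). LINT t|lborel. ?f b t) = of_real (sqrt (2 * pi) ^ DIM('a)) * gauss \<xi>"
  proof -
    have "(\<Prod>b\<in>(Basis::'a set). LINT t|lborel. ?f b t) =
        of_real (\<Prod>b\<in>(Basis::'a set). sqrt (2 * pi) * exp (- (\<xi> \<bullet> b)\<^sup>2 / 2))"
      by (simp only: gauss_1d(2) of_real_prod)
    also have "\<dots> = of_real (sqrt (2 * pi) ^ DIM('a)) * gauss \<xi>"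
      by (simp only: prod.distrib exp_sum[symmetric] finite_Basis gauss_def norm_power2_eq_sum prod_constant of_real_mult)
        (simp add: sum_negf sum_divide_distrib)
    finally show ?thesis .
  qed
  ultimately show ?thesis by simp
qed

lemma fourier_const_sqrt: "fourier_const TYPE('a::euclidean_space) * sqrt (2 * pi) ^ DIM('a) = 1"
proof -
  have "sqrt (2 * pi) ^ DIM('a) = (2 * pi) powr (real DIM('a) / 2)"
    by (simp add: powr_half_sqrt[symmetric] powr_realpow[symmetric] powr_powr)
  then show ?thesis by (simp add: fourier_const_def powr_add[symmetric])
qed

text \<open>The complex conjugates spare the reflection: this is \<open>\<F>(\<F>\<phi>)(- x) = \<phi> x\<close>. It is proved by inserting
  the factor \<open>gauss (e *\<^sub>R \<xi>)\<close>, moving the Fourier transform over to it, and letting \<open>e\<close> tend to \<open>0\<close>.\<close>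

lemma fourier_inversion:
  fixes \<phi> :: "'a::euclidean_space \<Rightarrow> complex"
  assumes \<phi>: "\<phi> \<in> schwartz"
  shows "fourier (\<lambda>\<xi>. cnj (fourier \<phi> \<xi>)) x = cnj (\<phi> x)"
proof -
  have F: "fourier \<phi> \<in> schwartz" using fourier_schwartz[OF \<phi>] .
  let ?\<epsilon> = "\<lambda>n. inverse (real (Suc n))"
  let ?\<psi> = "\<lambda>n \<xi>. cis (x \<bullet> \<xi>) * gauss (?\<epsilon> n *\<^sub>R \<xi>)"
  have \<epsilon>0: "?\<epsilon> \<longlonglongrightarrow> 0" by (rule LIMSEQ_inverse_real_of_nat)
  have cont_gauss: "continuous_on UNIV (gauss :: 'a \<Rightarrow> complex)"
    unfolding gauss_def by (intro continuous_intros) auto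
  have [measurable]: "(gauss :: 'a \<Rightarrow> complex) \<in> borel_measurable borel"
    using cont_gauss by (rule borel_measurable_continuous_onI)
  have [measurable]: "\<phi> \<in> borel_measurable borel" "fourier \<phi> \<in> borel_measurable borel"
    by (rule schwartz_measurable[OF \<phi>], rule schwartz_measurable[OF F])
  have ig: "integrable lborel (gauss :: 'a \<Rightarrow> complex)"
    and g1: "(LINT x|lborel. gauss (x::'a)) = of_real (sqrt (2 * pi) ^ DIM('a))"
    using gauss_fourier_integral[of "0::'a"] by (simp_all add: has_bochner_integral_iff gauss_def[of 0])
  have ig': "integrable lborel (\<lambda>\<xi>::'a. gauss (?\<epsilon> n *\<^sub>R \<xi>))" for n
    using integrable_lborel_affine[OF ig, of "?\<epsilon> n" 0] by simp
  have i\<psi>: "integrable lborel (?\<psi> n)" for n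
    by (rule integrable_cis_mult[OF ig']) simp
  \<comment> \<open>Rescaling by \<open>real (Suc n)\<close>, the reciprocal of
    \<open>?\<epsilon> n\<close>, turns the flattened Gaussian into one concentrated near
    \<open>x\<close> whose integral does not depend on \<open>n\<close>: an approximate
    identity.\<close>
  have F\<psi>: "fourier (?\<psi> n) y = of_real (real (Suc n) ^ DIM('a)) * gauss (real (Suc n) *\<^sub>R (y - x))" for n y
  proof -
    have "(LINT \<xi>|lborel. cis (- (\<xi> \<bullet> y)) * ?\<psi> n \<xi>) =
        real (Suc n) ^ DIM('a) *\<^sub>R (LINT \<xi>|lborel. cis (- ((real (Suc n) *\<^sub>R \<xi>) \<bullet> y)) * ?\<psi> n (real (Suc n) *\<^sub>R \<xi>))"
      by (subst integral_lborel_affine[where c = "real (Suc n)" and t = 0]) auto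
    also have "(\<lambda>\<xi>. cis (- ((real (Suc n) *\<^sub>R \<xi>) \<bullet> y)) * ?\<psi> n (real (Suc n) *\<^sub>R \<xi>)) =
        (\<lambda>\<xi>. cis (- (\<xi> \<bullet> (real (Suc n) *\<^sub>R (y - x)))) * gauss \<xi>)"
    proof
      fix \<xi> :: 'a
      have "cis (- ((real (Suc n) *\<^sub>R \<xi>) \<bullet> y)) * cis (x \<bullet> (real (Suc n) *\<^sub>R \<xi>)) =
          cis (- (\<xi> \<bullet> (real (Suc n) *\<^sub>R (y - x))))"
        unfolding cis_mult by (rule arg_cong[of _ _ cis]) (simp add: inner_diff_right inner_commute algebra_simps)
      then show "cis (- ((real (Suc n) *\<^sub>R \<xi>) \<bullet> y)) * ?\<psi> n (real (Suc n) *\<^sub>R \<xi>) =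
          cis (- (\<xi> \<bullet> (real (Suc n) *\<^sub>R (y - x)))) * gauss \<xi>"
        by (simp add: mult.assoc[symmetric] del: of_nat_Suc)
    qed
    also have "(LINT \<xi>|lborel. cis (- (\<xi> \<bullet> (real (Suc n) *\<^sub>R (y - x)))) * gauss \<xi>) =
        of_real (sqrt (2 * pi) ^ DIM('a)) * gauss (real (Suc n) *\<^sub>R (y - x))"
      using gauss_fourier_integral[of "real (Suc n) *\<^sub>R (y - x)"] by (simp only: has_bochner_integral_iff)
    finally have I: "(LINT \<xi>|lborel. cis (- (\<xi> \<bullet> y)) * ?\<psi> n \<xi>) = real (Suc n) ^ DIM('a) *\<^sub>R
        (of_real (sqrt (2 * pi) ^ DIM('a)) * gauss (real (Suc n) *\<^sub>R (y - x)))" .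
    have "fourier (?\<psi> n) y = of_real (fourier_const TYPE('a) * sqrt (2 * pi) ^ DIM('a)) *
        (of_real (real (Suc n) ^ DIM('a)) * gauss (real (Suc n) *\<^sub>R (y - x)))"
      unfolding fourier_eq I scaleR_conv_of_real of_real_mult by (simp only: mult_ac)
    then show ?thesis by (simp only: fourier_const_sqrt of_real_1 mult_1)
  qed
  have eq: "(LINT \<xi>|lborel. fourier \<phi> \<xi> * ?\<psi> n \<xi>) = (LINT z|lborel. \<phi> (x + ?\<epsilon> n *\<^sub>R z) * gauss z)" for n
  proof -
    have "(LINT \<xi>|lborel. fourier \<phi> \<xi> * ?\<psi> n \<xi>) = (LINT y|lborel. \<phi> y * fourier (?\<psi> n) y)"
      by (rule fourier_multiplication_formula[OF schwartz_imp_integrable[OF \<phi>] i\<psi>])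
    also have "\<dots> = ?\<epsilon> n ^ DIM('a) *\<^sub>R (LINT z|lborel. \<phi> (x + ?\<epsilon> n *\<^sub>R z) * fourier (?\<psi> n) (x + ?\<epsilon> n *\<^sub>R z))"
      unfolding F\<psi> by (subst integral_lborel_affine[where c = "?\<epsilon> n" and t = x]) auto
    also have "\<dots> = ?\<epsilon> n ^ DIM('a) *\<^sub>R (LINT z|lborel. of_real (real (Suc n) ^ DIM('a)) * (\<phi> (x + ?\<epsilon> n *\<^sub>R z) * gauss z))"
      unfolding F\<psi> by (simp add: mult.left_commute del: of_nat_Suc)
    also have "\<dots> = (LINT z|lborel. \<phi> (x + ?\<epsilon> n *\<^sub>R z) * gauss z)"
    proof -
      have "?\<epsilon> n ^ DIM('a) * real (Suc n) ^ DIM('a) = 1"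
        unfolding power_mult_distrib[symmetric] by simp
      then show ?thesis
        unfolding integral_mult_right_zero
        unfolding scaleR_conv_of_real mult.assoc[symmetric] of_real_mult[symmetric]
        by (simp only: of_real_1 mult_1)
    qed
    finally show ?thesis .
  qed
  have gb: "norm (gauss z) \<le> 1" for z :: 'a by (simp add: gauss_def)
  have gt: "(\<lambda>n. gauss (?\<epsilon> n *\<^sub>R \<xi>)) \<longlonglongrightarrow> 1" for \<xi> :: 'a
  proof -
    have "(\<lambda>n. gauss (?\<epsilon> n *\<^sub>R \<xi>)) \<longlonglongrightarrow> gauss (0 *\<^sub>R \<xi>)"
      by (rule continuous_on_tendsto_compose[OF cont_gauss]) (intro tendsto_intros \<epsilon>0, auto)
    then show ?thesis by (simp add: gauss_def)
  qed
  \<comment> \<open>One sequence, two limits. On the frequency side the Gaussian tends to one; in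
    the fact \<open>L2\<close> the function \<open>\<phi>\<close> is evaluated ever closer to
    \<open>x\<close> against a fixed Gaussian.\<close>
  have L1: "(\<lambda>n. LINT \<xi>|lborel. fourier \<phi> \<xi> * ?\<psi> n \<xi>) \<longlonglongrightarrow> (LINT \<xi>|lborel. fourier \<phi> \<xi> * (cis (x \<bullet> \<xi>) * 1))"
  proof (rule integral_dominated_convergence)
    show "integrable lborel (\<lambda>\<xi>. norm (fourier \<phi> \<xi>))" using schwartz_imp_integrable[OF F] by simp
    show "AE \<xi> in lborel. (\<lambda>n. fourier \<phi> \<xi> * ?\<psi> n \<xi>) \<longlonglongrightarrow> fourier \<phi> \<xi> * (cis (x \<bullet> \<xi>) * 1)"
      by (intro AE_I2 tendsto_intros gt)
    show "AE \<xi> in lborel. norm (fourier \<phi> \<xi> * ?\<psi> n \<xi>) \<le> norm (fourier \<phi> \<xi>)" for n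
      using gb by (auto simp: norm_mult mult_left_le simp del: of_nat_Suc)
  qed measurable
  obtain C where C: "\<And>y. norm (\<phi> y) \<le> C" using schwartz_bound[OF \<phi>, of 0] by auto
  have L2: "(\<lambda>n. LINT z|lborel. \<phi> (x + ?\<epsilon> n *\<^sub>R z) * gauss z) \<longlonglongrightarrow> (LINT z|lborel. \<phi> x * gauss (z::'a))"
  proof (rule integral_dominated_convergence)
    show "integrable lborel (\<lambda>z::'a. C * norm (gauss z))" using ig by simp
    show "AE z in lborel. norm (\<phi> (x + ?\<epsilon> n *\<^sub>R z) * gauss z) \<le> C * norm (gauss z)" for n
      using C by (auto simp: norm_mult mult_right_mono)
    show "AE z in lborel. (\<lambda>n. \<phi> (x + ?\<epsilon> n *\<^sub>R z) * gauss z) \<longlonglongrightarrow> \<phi> x * gauss z"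
    proof (intro AE_I2 tendsto_mult_right)
      fix z
      have "(\<lambda>n. \<phi> (x + ?\<epsilon> n *\<^sub>R z)) \<longlonglongrightarrow> \<phi> (x + 0 *\<^sub>R z)"
        by (rule continuous_on_tendsto_compose[OF schwartz_continuous[OF \<phi>]]) (intro tendsto_intros \<epsilon>0, auto)
      then show "(\<lambda>n. \<phi> (x + ?\<epsilon> n *\<^sub>R z)) \<longlonglongrightarrow> \<phi> x" by simp
    qed
  qed measurable
  have "(LINT \<xi>|lborel. fourier \<phi> \<xi> * cis (x \<bullet> \<xi>)) = \<phi> x * of_real (sqrt (2 * pi) ^ DIM('a))"
    using LIMSEQ_unique[OF L1[unfolded eq] L2] g1 by simp
  then have inv: "fourier_const TYPE('a) *\<^sub>R (LINT \<xi>|lborel. fourier \<phi> \<xi> * cis (x \<bullet> \<xi>)) = \<phi> x"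
    using fourier_const_sqrt[where 'a='a] by (simp add: scaleR_conv_of_real mult_ac of_real_mult[symmetric] del: of_real_mult of_real_power)
  have "fourier (\<lambda>\<xi>. cnj (fourier \<phi> \<xi>)) x = fourier_const TYPE('a) *\<^sub>R (LINT \<xi>|lborel. cnj (fourier \<phi> \<xi> * cis (x \<bullet> \<xi>)))"
    by (simp add: fourier_eq cis_cnj mult.commute inner_commute)
  also have "\<dots> = cnj (fourier_const TYPE('a) *\<^sub>R (LINT \<xi>|lborel. fourier \<phi> \<xi> * cis (x \<bullet> \<xi>)))"
    by (simp only: Bochner_Integration.integral_cnj complex_cnj_scaleR)
  also have "\<dots> = cnj (\<phi> x)" unfolding inv ..
  finally show ?thesis .
qed

section \<open>Weighted square integrable functions\<close>

definition wt :: "real \<Rightarrow> 'a::euclidean_space \<Rightarrow> real" where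
  "wt s \<xi> = (1 + (norm \<xi>)\<^sup>2) powr (s / 2)"

lemma wt_pos: "wt s \<xi> > 0"
  by (simp add: wt_def add_pos_nonneg powr_gt_zero) (metis add_pos_nonneg less_irrefl zero_le_power2 zero_less_one)

lemma wt_measurable [measurable]: "wt s \<in> borel_measurable borel"
  unfolding wt_def by measurable

lemma wt_mult_wt_minus: "wt s \<xi> * wt (- s) \<xi> = 1"
proof -
  have "1 + (norm \<xi>)\<^sup>2 > 0" by (simp add: add_pos_nonneg)
  then show ?thesis by (simp add: wt_def powr_add[symmetric])
qed

text \<open>Passing to \<open>\<bar>s\<bar>\<close> and rounding up gives a polynomial majorant
  valid for negative orders too, so one decay estimate serves both \<open>s\<close> and the dual
  order \<open>- s\<close>.\<close>

lemma wt_le: "wt s \<xi> \<le> (1 + norm \<xi>) ^ nat \<lceil>\<bar>s\<bar>\<rceil>"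
proof -
  have "wt s \<xi> \<le> (1 + (norm \<xi>)\<^sup>2) powr (\<bar>s\<bar> / 2)" unfolding wt_def by (rule powr_mono) auto
  also have "\<dots> \<le> ((1 + norm \<xi>)\<^sup>2) powr (\<bar>s\<bar> / 2)" by (intro powr_mono2) (auto simp: power2_sum)
  also have "\<dots> = (1 + norm \<xi>) powr \<bar>s\<bar>"
    by (simp add: powr_realpow[symmetric] powr_powr add_pos_nonneg del: powr_numeral)
  also have "\<dots> \<le> (1 + norm \<xi>) powr (real (nat \<lceil>\<bar>s\<bar>\<rceil>))" by (intro powr_mono) auto
  also have "\<dots> = (1 + norm \<xi>) ^ nat \<lceil>\<bar>s\<bar>\<rceil>" by (rule powr_realpow) (simp add: add_pos_nonneg)
  finally show ?thesis .
qed

text \<open>The discriminant criterion, degenerate quadratics included. Besides Cauchy--Schwarz it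
  will serve with \<open>A = 0\<close>, where it forces the linear coefficient to vanish: the
  first-order condition at a minimum.\<close>

lemma quadratic_nonneg_imp:
  fixes A B C :: real
  assumes "\<And>t. 0 \<le> A - 2 * t * B + t\<^sup>2 * C" "0 \<le> C"
  shows "B\<^sup>2 \<le> A * C"
proof (cases "C = 0")
  case True
  have "B = 0"
  proof (rule ccontr)
    assume "B \<noteq> 0"
    then have "A - 2 * ((A + 1) / (2 * B)) * B = - 1" by (simp add: field_simps)
    with assms(1)[of "(A + 1) / (2 * B)"] True show False by simp
  qed
  then show ?thesis using True by simp
next
  case False
  then have "C > 0" using assms(2) by simp
  have "0 \<le> (A - 2 * (B / C) * B + (B / C)\<^sup>2 * C) * C" using assms by (intro mult_nonneg_nonneg)
  also have "\<dots> = A * C - B\<^sup>2" using \<open>C > 0\<close> by (simp add: field_simps power2_eq_square)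
  finally show ?thesis by simp
qed

lemma integral_Cauchy_Schwarz:
  fixes f g :: "'a \<Rightarrow> real"
  assumes [measurable]: "f \<in> borel_measurable M" "g \<in> borel_measurable M"
    and f: "integrable M (\<lambda>x. (f x)\<^sup>2)" and g: "integrable M (\<lambda>x. (g x)\<^sup>2)"
  shows "integrable M (\<lambda>x. f x * g x)"
    and "\<bar>LINT x|M. f x * g x\<bar> \<le> sqrt (LINT x|M. (f x)\<^sup>2) * sqrt (LINT x|M. (g x)\<^sup>2)"
proof -
  show i: "integrable M (\<lambda>x. f x * g x)"
  proof (rule Bochner_Integration.integrable_bound)
    show "integrable M (\<lambda>x. (f x)\<^sup>2 + (g x)\<^sup>2)" using f g by simp
    have "\<bar>a * b\<bar> \<le> a\<^sup>2 + b\<^sup>2" for a b :: real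
    proof -
      have "2 * \<bar>a * b\<bar> \<le> a\<^sup>2 + b\<^sup>2"
        using sum_squares_bound[of "\<bar>a\<bar>" "\<bar>b\<bar>"] by (simp add: abs_mult)
      then show ?thesis using abs_ge_zero[of "a * b"] by linarith
    qed
    then show "AE x in M. norm (f x * g x) \<le> norm ((f x)\<^sup>2 + (g x)\<^sup>2)" by (auto intro: order_trans)
  qed simp
  have "(LINT x|M. f x * g x)\<^sup>2 \<le> (LINT x|M. (f x)\<^sup>2) * (LINT x|M. (g x)\<^sup>2)"
  proof (rule quadratic_nonneg_imp)
    fix t :: real
    have "0 \<le> (LINT x|M. (f x - t * g x)\<^sup>2)" by simp
    also have "(\<lambda>x. (f x - t * g x)\<^sup>2) = (\<lambda>x. (f x)\<^sup>2 - (2 * t) * (f x * g x) + t\<^sup>2 * (g x)\<^sup>2)"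
      by (auto simp: power2_eq_square algebra_simps)
    also have "(LINT x|M. (f x)\<^sup>2 - (2 * t) * (f x * g x) + t\<^sup>2 * (g x)\<^sup>2) =
        (LINT x|M. (f x)\<^sup>2) - 2 * t * (LINT x|M. f x * g x) + t\<^sup>2 * (LINT x|M. (g x)\<^sup>2)"
      using f g i by simp
    finally show "0 \<le> (LINT x|M. (f x)\<^sup>2) - 2 * t * (LINT x|M. f x * g x) + t\<^sup>2 * (LINT x|M. (g x)\<^sup>2)" .
  qed simp
  then show "\<bar>LINT x|M. f x * g x\<bar> \<le> sqrt (LINT x|M. (f x)\<^sup>2) * sqrt (LINT x|M. (g x)\<^sup>2)"
    unfolding real_sqrt_mult[symmetric] by (intro real_le_rsqrt) simp
qed

definition wL2 :: "real \<Rightarrow> ('a::euclidean_space \<Rightarrow> complex) set" where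
  "wL2 s = {g \<in> borel_measurable borel. integrable lborel (\<lambda>\<xi>. (wt s \<xi> * norm (g \<xi>))\<^sup>2)}"

definition wnorm :: "real \<Rightarrow> ('a::euclidean_space \<Rightarrow> complex) \<Rightarrow> real" where
  "wnorm s g = sqrt (LINT \<xi>|lborel. (wt s \<xi> * norm (g \<xi>))\<^sup>2)"

lemma wnorm_nonneg: "0 \<le> wnorm s g"
  by (simp add: wnorm_def)

lemma wL2_measurable: "g \<in> wL2 s \<Longrightarrow> g \<in> borel_measurable borel"
  by (simp add: wL2_def)

text \<open>The pointwise inequality
  \<open>(a + b)\<^sup>2 \<le> 2 * a\<^sup>2 + 2 * b\<^sup>2\<close> is integrated, hence the
  constant 2. Later uses concern boundedness and convergence, where this constant is
  harmless.\<close>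

lemma wL2_add:
  assumes "g \<in> wL2 s" "h \<in> wL2 s"
  shows "(\<lambda>\<xi>. g \<xi> + h \<xi>) \<in> wL2 s" and "wnorm s (\<lambda>\<xi>. g \<xi> + h \<xi>) \<le> 2 * (wnorm s g + wnorm s h)"
proof -
  let ?p = "\<lambda>g \<xi>. (wt s \<xi> * norm (g \<xi> :: complex))\<^sup>2"
  have [measurable]: "g \<in> borel_measurable borel" "h \<in> borel_measurable borel"
    and i: "integrable lborel (?p g)" "integrable lborel (?p h)" using assms by (auto simp: wL2_def)
  have le: "?p (\<lambda>\<xi>. g \<xi> + h \<xi>) \<xi> \<le> 2 * ?p g \<xi> + 2 * ?p h \<xi>" for \<xi>
  proof -
    have "wt s \<xi> * norm (g \<xi> + h \<xi>) \<le> wt s \<xi> * norm (g \<xi>) + wt s \<xi> * norm (h \<xi>)"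
      unfolding distrib_left[symmetric] using wt_pos[of s \<xi>] by (intro mult_left_mono norm_triangle_ineq) auto
    then have "?p (\<lambda>\<xi>. g \<xi> + h \<xi>) \<xi> \<le> (wt s \<xi> * norm (g \<xi>) + wt s \<xi> * norm (h \<xi>))\<^sup>2"
      using wt_pos[of s \<xi>] by (intro power_mono) auto
    also have "\<dots> \<le> 2 * ?p g \<xi> + 2 * ?p h \<xi>"
      using sum_squares_bound[of "wt s \<xi> * norm (g \<xi>)" "wt s \<xi> * norm (h \<xi>)"] by (simp add: power2_sum)
    finally show ?thesis .
  qed
  have ib: "integrable lborel (\<lambda>\<xi>. 2 * ?p g \<xi> + 2 * ?p h \<xi>)" using i by simp
  have ig: "integrable lborel (?p (\<lambda>\<xi>. g \<xi> + h \<xi>))"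
    by (rule Bochner_Integration.integrable_bound[OF ib]) (auto intro: order_trans[OF le])
  then show "(\<lambda>\<xi>. g \<xi> + h \<xi>) \<in> wL2 s" by (simp add: wL2_def)
  have "(LINT \<xi>|lborel. ?p (\<lambda>\<xi>. g \<xi> + h \<xi>) \<xi>) \<le> (LINT \<xi>|lborel. 2 * ?p g \<xi> + 2 * ?p h \<xi>)"
    by (rule integral_mono[OF ig ib le])
  also have "\<dots> = 2 * (wnorm s g)\<^sup>2 + 2 * (wnorm s h)\<^sup>2" using i by (simp add: wnorm_def)
  also have "\<dots> \<le> (2 * (wnorm s g + wnorm s h))\<^sup>2"
    using wnorm_nonneg[of s g] wnorm_nonneg[of s h] by (simp add: power2_eq_square algebra_simps)
  finally show "wnorm s (\<lambda>\<xi>. g \<xi> + h \<xi>) \<le> 2 * (wnorm s g + wnorm s h)"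
    unfolding wnorm_def[of s "\<lambda>\<xi>. g \<xi> + h \<xi>"]
    by (intro real_le_lsqrt) (simp_all add: wnorm_nonneg)
qed

lemma wL2_scale:
  assumes "g \<in> wL2 s"
  shows "(\<lambda>\<xi>. c *\<^sub>R g \<xi>) \<in> wL2 s" and "wnorm s (\<lambda>\<xi>. c *\<^sub>R g \<xi>) = \<bar>c\<bar> * wnorm s g"
proof -
  have eq: "(wt s \<xi> * norm (c *\<^sub>R g \<xi>))\<^sup>2 = c\<^sup>2 * (wt s \<xi> * norm (g \<xi>))\<^sup>2" for \<xi>
    by (simp add: power_mult_distrib)
  show "(\<lambda>\<xi>. c *\<^sub>R g \<xi>) \<in> wL2 s" using assms by (auto simp: wL2_def eq simp del: norm_scaleR)
  show "wnorm s (\<lambda>\<xi>. c *\<^sub>R g \<xi>) = \<bar>c\<bar> * wnorm s g"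
    unfolding wnorm_def eq by (simp add: real_sqrt_mult)
qed

text \<open>The weights of orders \<open>s\<close> and \<open>- s\<close> are reciprocal, so
  inserting their product reduces everything to Cauchy--Schwarz: the duality between the two
  orders.\<close>

lemma wL2_pairing:
  assumes "g \<in> wL2 s" "h \<in> wL2 (- s)"
  shows "integrable lborel (\<lambda>\<xi>. g \<xi> * h \<xi>)" and "norm (LINT \<xi>|lborel. g \<xi> * h \<xi>) \<le> wnorm s g * wnorm (- s) h"
proof -
  have [measurable]: "g \<in> borel_measurable borel" "h \<in> borel_measurable borel"
    using assms by (auto simp: wL2_def)
  let ?f = "\<lambda>\<xi>. wt s \<xi> * norm (g \<xi>)" and ?h = "\<lambda>\<xi>. wt (- s) \<xi> * norm (h \<xi>)"
  have eq: "?f \<xi> * ?h \<xi> = norm (g \<xi> * h \<xi>)" for \<xi>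
  proof -
    have "?f \<xi> * ?h \<xi> = (wt s \<xi> * wt (- s) \<xi>) * norm (g \<xi> * h \<xi>)" by (simp only: norm_mult mult_ac)
    then show ?thesis by (simp add: wt_mult_wt_minus)
  qed
  have i: "integrable lborel (\<lambda>\<xi>. ?f \<xi> * ?h \<xi>)"
    and b: "\<bar>LINT \<xi>|lborel. ?f \<xi> * ?h \<xi>\<bar> \<le> wnorm s g * wnorm (- s) h"
    unfolding wnorm_def by (intro integral_Cauchy_Schwarz; use assms in \<open>simp add: wL2_def\<close>)+
  show "integrable lborel (\<lambda>\<xi>. g \<xi> * h \<xi>)"
    using i unfolding eq by (subst (asm) integrable_norm_iff) auto
  show "norm (LINT \<xi>|lborel. g \<xi> * h \<xi>) \<le> wnorm s g * wnorm (- s) h"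
    using b unfolding eq by (intro order_trans[OF integral_norm_bound]) simp
qed

lemma decay_wL2:
  fixes h :: "'a::euclidean_space \<Rightarrow> complex"
  assumes "h \<in> borel_measurable borel"
    and "\<And>\<xi>. (1 + norm \<xi>) ^ (nat \<lceil>\<bar>s\<bar>\<rceil> + 2 * DIM('a)) * norm (h \<xi>) \<le> K"
  shows "h \<in> wL2 s" "wnorm s h \<le> K * sqrt (LINT x|lborel. decay (x::'a))"
proof -
  let ?e = "\<lambda>x::'a. decay x"
  have p: "(1 + norm x) ^ k > 0" for x :: 'a and k by (simp add: add_pos_nonneg)
  have K: "K \<ge> 0" using order_trans[OF norm_ge_zero[of "h 0"]] assms(2)[of 0] by simp
  have le: "(wt s \<xi> * norm (h \<xi>))\<^sup>2 \<le> K\<^sup>2 * ?e \<xi>" for \<xi>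
  proof -
    have "(1 + norm \<xi>) ^ (2 * DIM('a)) * (wt s \<xi> * norm (h \<xi>)) \<le>
        (1 + norm \<xi>) ^ (2 * DIM('a)) * ((1 + norm \<xi>) ^ nat \<lceil>\<bar>s\<bar>\<rceil> * norm (h \<xi>))"
      by (intro mult_left_mono mult_right_mono wt_le) auto
    also have "\<dots> \<le> K" using assms(2)[of \<xi>] by (simp add: power_add mult_ac)
    finally have "wt s \<xi> * norm (h \<xi>) \<le> K * ?e \<xi>" using p[of \<xi> "2 * DIM('a)"] by (simp add: field_simps)
    then have "(wt s \<xi> * norm (h \<xi>))\<^sup>2 \<le> (K * ?e \<xi>)\<^sup>2"
      using wt_pos[of s \<xi>] by (intro power_mono) auto
    also have "\<dots> = K\<^sup>2 * (?e \<xi> * ?e \<xi>)" by (simp add: power2_eq_square)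
    \<comment> \<open>The decay weight is at most one, so its square is dominated by the weight
      itself, which is integrable.\<close>
    also have "\<dots> \<le> K\<^sup>2 * (?e \<xi> * 1)"
      by (intro mult_left_mono) (auto intro!: le_imp_inverse_le[of 1, simplified] one_le_power)
    finally show ?thesis by simp
  qed
  have ib: "integrable lborel (\<lambda>\<xi>. K\<^sup>2 * ?e \<xi>)" using integrable_decay_weight[where 'a='a] by simp
  have i: "integrable lborel (\<lambda>\<xi>. (wt s \<xi> * norm (h \<xi>))\<^sup>2)"
    by (rule Bochner_Integration.integrable_bound[OF ib]) (use assms(1) le in \<open>auto intro: order_trans[OF le]\<close>)
  then show "h \<in> wL2 s" using assms(1) by (simp add: wL2_def)
  have "(LINT \<xi>|lborel. (wt s \<xi> * norm (h \<xi>))\<^sup>2) \<le> (LINT \<xi>|lborel. K\<^sup>2 * ?e \<xi>)"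
    by (rule integral_mono[OF i ib le])
  then have "wnorm s h \<le> sqrt (K\<^sup>2 * (LINT x|lborel. ?e x))" by (simp add: wnorm_def)
  then show "wnorm s h \<le> K * sqrt (LINT x|lborel. ?e x)" using K by (simp add: real_sqrt_mult)
qed

lemma schwartz_wL2:
  fixes \<phi> :: "'a::euclidean_space \<Rightarrow> complex"
  assumes "\<phi> \<in> schwartz" shows "\<phi> \<in> wL2 s"
proof -
  obtain C where "\<And>x. (1 + norm x) ^ (nat \<lceil>\<bar>s\<bar>\<rceil> + 2 * DIM('a)) * norm (\<phi> x) \<le> C"
    using schwartz_bound[OF assms] by blast
  then show ?thesis by (rule decay_wL2(1)[OF schwartz_measurable[OF assms]])
qed

section \<open>Tempered distributions\<close>

lemma pairing_tempered: "is_tempered (pairing u)"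
  using pairing[of u] by simp

lemma pairing_add_fun:
  "\<phi> \<in> schwartz \<Longrightarrow> \<psi> \<in> schwartz \<Longrightarrow> pairing u (\<lambda>x. \<phi> x + \<psi> x) = pairing u \<phi> + pairing u \<psi>"
  using pairing_tempered[of u] by (simp add: is_tempered_def)

lemma tempered_eqI:
  assumes "\<And>\<phi>. \<phi> \<in> schwartz \<Longrightarrow> pairing u \<phi> = pairing v \<phi>"
  shows "u = v"
proof -
  have "pairing u \<phi> = pairing v \<phi>" for \<phi>
    using assms pairing_tempered[of u] pairing_tempered[of v]
    by (cases "\<phi> \<in> schwartz") (simp_all add: is_tempered_def)
  then show ?thesis by (simp add: pairing_inject[symmetric] fun_eq_iff)
qed

lemma fourier_distr_add: "fourier_distr (u + v) \<phi> = fourier_distr u \<phi> + fourier_distr v \<phi>"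
  by (simp add: fourier_distr_def plus_tempered.rep_eq complex_eq_iff)

lemma fourier_distr_scale: "fourier_distr (c *\<^sub>R u) \<phi> = c *\<^sub>R fourier_distr u \<phi>"
  by (simp add: fourier_distr_def scaleR_tempered.rep_eq complex_eq_iff)

lemma has_fourier_fun_add:
  assumes "has_fourier_fun u g" "has_fourier_fun v h"
  shows "has_fourier_fun (u + v) (\<lambda>\<xi>. g \<xi> + h \<xi>)"
  using assms by (auto simp: has_fourier_fun_def fourier_distr_add distrib_right)

lemma has_fourier_fun_scale:
  assumes "has_fourier_fun u g"
  shows "has_fourier_fun (c *\<^sub>R u) (\<lambda>\<xi>. c *\<^sub>R g \<xi>)"
  using assms by (auto simp: has_fourier_fun_def fourier_distr_scale)

lemma AE_zero_if_all_test_zero: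
  fixes f :: "'a::euclidean_space \<Rightarrow> real"
  assumes [measurable]: "f \<in> borel_measurable borel"
    and i: "\<And>\<phi>. \<phi> \<in> test_functions UNIV \<Longrightarrow> integrable lborel (\<lambda>x. f x * \<phi> x)"
    and z: "\<And>\<phi>. \<phi> \<in> test_functions UNIV \<Longrightarrow> (LINT x|lborel. f x * \<phi> x) = 0"
  shows "AE x in lborel. f x = 0"
proof -
  have "AE x in lborel. x \<in> UNIV \<longrightarrow> f x = 0"
  proof (rule integral_box_bump_zero_imp_AE)
    fix a b :: 'a
    \<comment> \<open>A bump on the box enlarged by one in every coordinate is positive on the
      compact \<open>cbox a b\<close>, hence bounded below there by its minimum; integrability of
      the product with \<open>?\<rho>\<close> then gives integrability of \<open>f\<close> on the
      box.\<close>
    let ?\<rho> = "box_bump (a - One) (b + One) 1"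
    have \<rho>: "?\<rho> \<in> test_functions UNIV" by (rule box_bump_test) auto
    show "set_integrable lborel (cbox a b) f"
    proof (cases "cbox a b = {}")
      case False
      have pos: "?\<rho> x > 0" if "x \<in> cbox a b" for x
      proof -
        have "(a - One) \<bullet> i < x \<bullet> i \<and> x \<bullet> i < (b + One) \<bullet> i" if i: "i \<in> Basis" for i
        proof -
          have "a \<bullet> i \<le> x \<bullet> i" "x \<bullet> i \<le> b \<bullet> i" using \<open>x \<in> cbox a b\<close> i by (auto simp: mem_box)
          then show ?thesis using i by (simp add: inner_diff_left inner_add_left)
        qed
        then show ?thesis by (subst box_bump_pos_iff) (auto simp: mem_box)
      qed
      have "continuous_on (cbox a b) ?\<rho>"
        using test_functions_continuous[OF \<rho>] continuous_on_subset by blast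
      from continuous_attains_inf[OF compact_cbox False this]
      obtain y where y: "y \<in> cbox a b" "\<And>x. x \<in> cbox a b \<Longrightarrow> ?\<rho> y \<le> ?\<rho> x" by blast
      have "integrable lborel (\<lambda>x. f x * ?\<rho> x / ?\<rho> y)" using i[OF \<rho>] by simp
      then show ?thesis
        unfolding set_integrable_def
      proof (rule Bochner_Integration.integrable_bound)
        have "norm (indicator (cbox a b) x *\<^sub>R f x) \<le> norm (f x * ?\<rho> x / ?\<rho> y)" for x
        proof (cases "x \<in> cbox a b")
          case True
          have "\<bar>f x\<bar> * ?\<rho> y \<le> \<bar>f x\<bar> * ?\<rho> x" using y(2)[OF True] by (intro mult_left_mono) auto
          then show ?thesis using pos[OF y(1)] pos[OF True] True by (simp add: abs_mult field_simps)
        qed simp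
        then show "AE x in lborel. norm (indicator (cbox a b) x *\<^sub>R f x) \<le> norm (f x * ?\<rho> x / ?\<rho> y)" by simp
      qed measurable
    qed (simp add: set_integrable_def)
  next
    fix a b :: 'a and k :: real assume "k > 0"
    then show "(LINT x|lborel. f x * box_bump a b k x) = 0"
      by (intro z box_bump_test) auto
  qed simp
  then show ?thesis by simp
qed

text \<open>The available almost-everywhere criterion is for real functions, so the real and
  imaginary parts of the difference are tested separately against real test functions.\<close>

lemma has_fourier_fun_unique:
  fixes u :: "'a::euclidean_space tempered"
  assumes g: "has_fourier_fun u g" and h: "has_fourier_fun u h"
  shows "AE \<xi> in lborel. g \<xi> = h \<xi>"
proof -
  have [measurable]: "g \<in> borel_measurable borel" "h \<in> borel_measurable borel"
    using g h by (auto simp: has_fourier_fun_def)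
  let ?d = "\<lambda>\<xi>. g \<xi> - h \<xi>"
  have d: "integrable lborel (\<lambda>\<xi>. ?d \<xi> * of_real (\<phi> \<xi>))" "(LINT \<xi>|lborel. ?d \<xi> * of_real (\<phi> \<xi>)) = 0"
    if "\<phi> \<in> test_functions UNIV" for \<phi>
  proof -
    have "(\<lambda>\<xi>. complex_of_real (\<phi> \<xi>)) \<in> schwartz"
      using that test_functions_schwartz by (intro schwartz_bounded_linear[OF bounded_linear_of_real]) blast
    with g h show "integrable lborel (\<lambda>\<xi>. ?d \<xi> * of_real (\<phi> \<xi>))" "(LINT \<xi>|lborel. ?d \<xi> * of_real (\<phi> \<xi>)) = 0"
      by (auto simp: has_fourier_fun_def left_diff_distrib)
  qed
  have "AE \<xi> in lborel. Re (?d \<xi>) = 0"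
    using integrable_Re[OF d(1)] integral_Re[OF d(1)] d(2)
    by (intro AE_zero_if_all_test_zero) (simp_all flip: integral_Re)
  moreover have "AE \<xi> in lborel. Im (?d \<xi>) = 0"
    using integrable_Im[OF d(1)] integral_Im[OF d(1)] d(2)
    by (intro AE_zero_if_all_test_zero) (simp_all flip: integral_Im)
  ultimately show ?thesis by eventually_elim (simp add: complex_eq_iff)
qed

section \<open>Bessel potential spaces\<close>

lemma wnorm_cong_AE:
  assumes "AE \<xi> in lborel. g \<xi> = h \<xi>" "g \<in> borel_measurable borel" "h \<in> borel_measurable borel"
  shows "wnorm s g = wnorm s h" "g \<in> wL2 s \<longleftrightarrow> h \<in> wL2 s"
proof -
  have ae: "AE \<xi> in lborel. (wt s \<xi> * norm (g \<xi>))\<^sup>2 = (wt s \<xi> * norm (h \<xi>))\<^sup>2"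
    using assms(1) by eventually_elim simp
  show "wnorm s g = wnorm s h"
    unfolding wnorm_def using assms ae by (intro arg_cong[of _ _ sqrt] integral_cong_AE) auto
  show "g \<in> wL2 s \<longleftrightarrow> h \<in> wL2 s"
    unfolding wL2_def using assms ae integrable_cong_AE[OF _ _ ae] by auto
qed

lemma Hs_iff: "u \<in> Hs s \<longleftrightarrow> (\<exists>g\<in>wL2 s. has_fourier_fun u g)"
  by (auto simp: Hs_def wL2_def wt_def has_fourier_fun_def)

text \<open>The function chosen by \<open>SOME\<close> agrees almost everywhere with any other
  representative, so the norm may be computed from whichever one is at hand.\<close>

lemma Hs_norm_eq:
  assumes "has_fourier_fun u g" shows "Hs_norm s u = wnorm s g"
proof -
  let ?h = "SOME g. has_fourier_fun u g"
  have h: "has_fourier_fun u ?h" using assms by (rule someI[of "has_fourier_fun u"])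
  have "wnorm s ?h = wnorm s g"
    using has_fourier_fun_unique[OF h assms] h assms by (intro wnorm_cong_AE) (auto simp: has_fourier_fun_def)
  then show ?thesis by (simp add: Hs_norm_def wnorm_def wt_def)
qed

lemma Hs_norm_nonneg: "0 \<le> Hs_norm s u"
  by (simp add: Hs_norm_def)

lemma Hs_add:
  assumes "u \<in> Hs s" "v \<in> Hs s"
  shows "u + v \<in> Hs s" and "Hs_norm s (u + v) \<le> 2 * (Hs_norm s u + Hs_norm s v)"
proof -
  obtain g h where "g \<in> wL2 s" "h \<in> wL2 s" and f: "has_fourier_fun u g" "has_fourier_fun v h"
    using assms by (auto simp: Hs_iff)
  with wL2_add[of g s h] has_fourier_fun_add[OF f]
  show "u + v \<in> Hs s" "Hs_norm s (u + v) \<le> 2 * (Hs_norm s u + Hs_norm s v)"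
    by (auto simp: Hs_iff Hs_norm_eq)
qed

lemma Hs_scale:
  assumes "u \<in> Hs s"
  shows "c *\<^sub>R u \<in> Hs s" and "Hs_norm s (c *\<^sub>R u) = \<bar>c\<bar> * Hs_norm s u"
proof -
  obtain g where "g \<in> wL2 s" and f: "has_fourier_fun u g"
    using assms by (auto simp: Hs_iff)
  with wL2_scale[of g s c] has_fourier_fun_scale[OF f, of c]
  show "c *\<^sub>R u \<in> Hs s" "Hs_norm s (c *\<^sub>R u) = \<bar>c\<bar> * Hs_norm s u"
    by (auto simp: Hs_iff Hs_norm_eq)
qed

lemma Hs_minus: "u \<in> Hs s \<Longrightarrow> - u \<in> Hs s" "u \<in> Hs s \<Longrightarrow> Hs_norm s (- u) = Hs_norm s u"
  using Hs_scale[of u s "- 1"] by auto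

lemma Hs_diff:
  assumes "u \<in> Hs s" "v \<in> Hs s"
  shows "u - v \<in> Hs s" and "Hs_norm s (u - v) \<le> 2 * (Hs_norm s u + Hs_norm s v)"
  using Hs_add[of u s "- v"] Hs_minus[of v s] assms by auto

section \<open>Pairings expressed through the Fourier side\<close>

lemma partials_of_real:
  fixes \<phi> :: "'a::euclidean_space \<Rightarrow> real"
  assumes "smooth \<phi>" "set vs \<subseteq> Basis"
  shows "partials vs (\<lambda>x. complex_of_real (\<phi> x)) = (\<lambda>x. of_real (partials vs \<phi> x))"
  using assms(2)
proof (induction vs)
  case (Cons v vs)
  have "(partials vs \<phi> has_derivative frechet_derivative (partials vs \<phi>) (at x)) (at x)" for x
    using assms(1) Cons.prems by (simp add: smooth_def frechet_derivative_works[symmetric])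
  then have D: "((\<lambda>x. complex_of_real (partials vs \<phi> x)) has_derivative
      (\<lambda>h. of_real (frechet_derivative (partials vs \<phi>) (at x) h))) (at x)" for x
    by (rule has_derivative_of_real)
  have "frechet_derivative (\<lambda>x. complex_of_real (partials vs \<phi> x)) (at x) v =
      of_real (frechet_derivative (partials vs \<phi>) (at x) v)" for x
    using frechet_derivative_at[OF D, of x] by metis
  moreover have "partials vs (\<lambda>x. complex_of_real (\<phi> x)) = (\<lambda>x. of_real (partials vs \<phi> x))"
    using Cons by simp
  ultimately show ?case by simp
qed simp

lemma schwartz_seminorm_of_real:
  fixes \<phi> :: "'a::euclidean_space \<Rightarrow> real"
  assumes "smooth \<phi>"
  shows "schwartz_seminorm N (\<lambda>x. complex_of_real (\<phi> x)) = schwartz_seminorm N \<phi>"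
  unfolding schwartz_seminorm_def
  by (rule arg_cong[of _ _ Sup], rule image_cong) (auto simp: partials_of_real[OF assms])

lemma schwartz_of_real:
  fixes \<phi> :: "'a::euclidean_space \<Rightarrow> real"
  shows "\<phi> \<in> schwartz \<Longrightarrow> (\<lambda>x. complex_of_real (\<phi> x)) \<in> schwartz"
  by (rule schwartz_bounded_linear[OF bounded_linear_of_real])

lemma schwartz_cnj:
  fixes \<phi> :: "'a::euclidean_space \<Rightarrow> complex"
  shows "\<phi> \<in> schwartz \<Longrightarrow> (\<lambda>x. cnj (\<phi> x)) \<in> schwartz"
  by (rule schwartz_bounded_linear[OF bounded_linear_cnj])

text \<open>The duality defining the Fourier transform of \<open>u\<close> is applied to the
  conjugate of the transform of \<open>\<phi>\<close>; by inversion its own transform is the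
  conjugate of \<open>\<phi>\<close>, which is \<open>\<phi>\<close> because \<open>\<phi>\<close>
  is real.\<close>

lemma pairing_via_fourier_fun:
  fixes \<phi> :: "'a::euclidean_space \<Rightarrow> real"
  assumes g: "has_fourier_fun u g" and \<phi>: "\<phi> \<in> schwartz"
  shows "pairing u \<phi> = Re (LINT \<xi>|lborel. g \<xi> * cnj (fourier (\<lambda>x. of_real (\<phi> x)) \<xi>))"
proof -
  let ?\<psi> = "\<lambda>\<xi>. cnj (fourier (\<lambda>x. of_real (\<phi> x)) \<xi>)"
  have \<psi>: "?\<psi> \<in> schwartz" by (intro schwartz_cnj fourier_schwartz schwartz_of_real \<phi>)
  have "Re (fourier_distr u ?\<psi>) = pairing u \<phi>"
    by (simp add: fourier_distr_def fourier_inversion[OF schwartz_of_real[OF \<phi>]])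
  moreover have "fourier_distr u ?\<psi> = (LINT \<xi>|lborel. g \<xi> * ?\<psi> \<xi>)"
    using g \<psi> by (simp add: has_fourier_fun_def)
  ultimately show ?thesis by simp
qed

text \<open>The transform of \<open>\<phi>\<close> lies in the weighted space of the dual order
  \<open>- s\<close>, with norm controlled by a Schwartz seminorm. The constants are uniform in
  \<open>u\<close> and \<open>\<phi>\<close>: convergence in \<open>Hs s\<close> therefore implies
  convergence of pairings, and a limit of pairings inherits a seminorm bound.\<close>

lemma pairing_bound:
  shows "\<exists>C\<ge>0. \<exists>N. \<forall>u\<in>Hs s. \<forall>\<phi>::'a::euclidean_space \<Rightarrow> real\<in>schwartz.
    \<bar>pairing u \<phi>\<bar> \<le> C * schwartz_seminorm N \<phi> * Hs_norm s u"
proof -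
  let ?m = "nat \<lceil>\<bar>- s\<bar>\<rceil> + 2 * DIM('a)"
  let ?N = "?m + 2 * DIM('a)"
  let ?I = "sqrt (LINT x|lborel. decay (x::'a))"
  obtain K where K: "K \<ge> 0" "\<And>\<phi> \<xi>::'a. \<phi> \<in> schwartz \<Longrightarrow>
      (1 + norm \<xi>) ^ ?m * norm (fourier \<phi> \<xi>) \<le> K * schwartz_seminorm ?N \<phi>"
    using fourier_decay[where 'a='a, of ?m] by blast
  have "\<bar>pairing u \<phi>\<bar> \<le> (K * ?I) * schwartz_seminorm ?N \<phi> * Hs_norm s u"
    if u: "u \<in> Hs s" and \<phi>: "\<phi> \<in> schwartz" for u and \<phi> :: "'a \<Rightarrow> real"
  proof -
    obtain g where g: "g \<in> wL2 s" "has_fourier_fun u g" using u by (auto simp: Hs_iff)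
    let ?\<psi> = "\<lambda>\<xi>. cnj (fourier (\<lambda>x. of_real (\<phi> x)) \<xi>)"
    have \<psi>: "?\<psi> \<in> schwartz" by (intro schwartz_cnj fourier_schwartz schwartz_of_real \<phi>)
    have "smooth \<phi>" using \<phi> by (simp add: schwartz_def)
    have "(1 + norm \<xi>) ^ ?m * norm (?\<psi> \<xi>) \<le> K * schwartz_seminorm ?N \<phi>" for \<xi>
      using K(2)[OF schwartz_of_real[OF \<phi>], of \<xi>] by (simp add: schwartz_seminorm_of_real[OF \<open>smooth \<phi>\<close>])
    note d = decay_wL2[OF schwartz_measurable[OF \<psi>] this]
    have "\<bar>pairing u \<phi>\<bar> \<le> norm (LINT \<xi>|lborel. g \<xi> * ?\<psi> \<xi>)"
      unfolding pairing_via_fourier_fun[OF g(2) \<phi>] by (rule abs_Re_le_cmod)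
    also have "\<dots> \<le> wnorm s g * wnorm (- s) ?\<psi>" by (rule wL2_pairing(2)[OF g(1) d(1)])
    also have "\<dots> \<le> wnorm s g * (K * schwartz_seminorm ?N \<phi> * ?I)"
      by (intro mult_left_mono d(2) wnorm_nonneg)
    finally show ?thesis unfolding Hs_norm_eq[OF g(2)] by (simp only: mult_ac)
  qed
  moreover have "K * ?I \<ge> 0" using K(1) by simp
  ultimately show ?thesis by blast
qed

lemma Hs_norm_zero_imp:
  assumes "u \<in> Hs s" "Hs_norm s u = 0" shows "u = 0"
proof (rule tempered_eqI)
  fix \<phi> :: "'a \<Rightarrow> real" assume "\<phi> \<in> schwartz"
  with pairing_bound[where 'a='a, of s] assms have "\<bar>pairing u \<phi>\<bar> \<le> 0" by (metis mult_zero_right)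
  then show "pairing u \<phi> = pairing 0 \<phi>" by (simp add: zero_tempered.rep_eq)
qed

section \<open>Completeness of the Bessel potential spaces\<close>

text \<open>Fatou's lemma for the weighted squares. Besides the norm bound it supplies membership of
  the limit, which pointwise convergence alone would not give.\<close>

lemma wL2_Fatou:
  fixes h :: "nat \<Rightarrow> 'a::euclidean_space \<Rightarrow> complex"
  assumes h: "\<And>i. h i \<in> wL2 s" "\<And>i. i \<ge> M \<Longrightarrow> wnorm s (h i) \<le> \<epsilon>" and "0 \<le> \<epsilon>"
    and [measurable]: "g \<in> borel_measurable borel"
    and lim: "AE \<xi> in lborel. (\<lambda>i. h i \<xi>) \<longlonglongrightarrow> g \<xi>"
  shows "g \<in> wL2 s" "wnorm s g \<le> \<epsilon>"
proof -
  let ?p = "\<lambda>g \<xi>. (wt s \<xi> * norm (g \<xi> :: complex))\<^sup>2"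
  have [measurable]: "h i \<in> borel_measurable borel" for i using h(1)[of i] by (rule wL2_measurable)
  have "(\<integral>\<^sup>+ \<xi>. ennreal (?p g \<xi>) \<partial>lborel) = (\<integral>\<^sup>+ \<xi>. liminf (\<lambda>i. ennreal (?p (h i) \<xi>)) \<partial>lborel)"
  proof (rule nn_integral_cong_AE)
    show "AE \<xi> in lborel. ennreal (?p g \<xi>) = liminf (\<lambda>i. ennreal (?p (h i) \<xi>))"
      using lim
    proof eventually_elim
      case (elim \<xi>)
      then have "(\<lambda>i. ennreal (?p (h i) \<xi>)) \<longlonglongrightarrow> ennreal (?p g \<xi>)"
        by (intro tendsto_ennrealI tendsto_intros)
      from lim_imp_Liminf[OF sequentially_bot this] show ?case by simp
    qed
  qed
  also have "\<dots> \<le> liminf (\<lambda>i. \<integral>\<^sup>+ \<xi>. ennreal (?p (h i) \<xi>) \<partial>lborel)"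
    by (rule nn_integral_liminf) measurable
  also have "\<dots> \<le> ennreal (\<epsilon>\<^sup>2)"
  proof (rule Liminf_le)
    show "\<forall>\<^sub>F i in sequentially. (\<integral>\<^sup>+ \<xi>. ennreal (?p (h i) \<xi>) \<partial>lborel) \<le> ennreal (\<epsilon>\<^sup>2)"
    proof (rule eventually_sequentiallyI)
      fix i assume "M \<le> i"
      have "(\<integral>\<^sup>+ \<xi>. ennreal (?p (h i) \<xi>) \<partial>lborel) = ennreal (LINT \<xi>|lborel. ?p (h i) \<xi>)"
        using h(1)[of i] by (intro nn_integral_eq_integral) (auto simp: wL2_def)
      moreover have "(LINT \<xi>|lborel. ?p (h i) \<xi>) \<le> \<epsilon>\<^sup>2"
        using h(2)[OF \<open>M \<le> i\<close>] unfolding wnorm_def by (rule sqrt_le_D)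
      ultimately show "(\<integral>\<^sup>+ \<xi>. ennreal (?p (h i) \<xi>) \<partial>lborel) \<le> ennreal (\<epsilon>\<^sup>2)" by (simp add: ennreal_leI)
    qed
  qed auto
  finally have le: "(\<integral>\<^sup>+ \<xi>. ennreal (?p g \<xi>) \<partial>lborel) \<le> ennreal (\<epsilon>\<^sup>2)" .
  have i: "integrable lborel (?p g)"
    by (rule integrableI_bounded) (use le in \<open>auto intro: le_less_trans\<close>)
  then show "g \<in> wL2 s" by (simp add: wL2_def)
  have "ennreal (LINT \<xi>|lborel. ?p g \<xi>) \<le> ennreal (\<epsilon>\<^sup>2)"
    using le i by (subst nn_integral_eq_integral[symmetric]) auto
  then have "(LINT \<xi>|lborel. ?p g \<xi>) \<le> \<epsilon>\<^sup>2" by (simp add: ennreal_le_iff)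
  then show "wnorm s g \<le> \<epsilon>" unfolding wnorm_def using \<open>0 \<le> \<epsilon>\<close> by (rule real_le_lsqrt[rotated])
qed

lemma wL2_diff: "g \<in> wL2 s \<Longrightarrow> h \<in> wL2 s \<Longrightarrow> (\<lambda>\<xi>. g \<xi> - h \<xi>) \<in> wL2 s"
  using wL2_add(1)[of g s "\<lambda>\<xi>. (- 1) *\<^sub>R h \<xi>"] wL2_scale(1)[of h s "- 1"] by simp

lemma wL2_complete:
  fixes g :: "nat \<Rightarrow> 'a::euclidean_space \<Rightarrow> complex"
  assumes g: "\<And>n. g n \<in> wL2 s"
    and cauchy: "\<And>\<epsilon>. \<epsilon> > 0 \<Longrightarrow> \<exists>M. \<forall>m\<ge>M. \<forall>n\<ge>M. wnorm s (\<lambda>\<xi>. g m \<xi> - g n \<xi>) < \<epsilon>"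
  obtains G where "G \<in> wL2 s" "(\<lambda>n. wnorm s (\<lambda>\<xi>. g n \<xi> - G \<xi>)) \<longlonglongrightarrow> 0"
proof -
  \<comment> \<open>Multiplying by a positive weight dual to \<open>wL2 s\<close> reduces to completeness of \<open>L\<^sup>1\<close>.\<close>
  define E where "E \<xi> = inverse ((1 + norm \<xi>) ^ (nat \<lceil>\<bar>- s\<bar>\<rceil> + 2 * DIM('a)))" for \<xi> :: 'a
  let ?e = "\<lambda>\<xi>. complex_of_real (E \<xi>)"
  have pos: "E \<xi> > 0" for \<xi>
    by (simp add: E_def add_pos_nonneg)
  then have ne: "?e \<xi> \<noteq> 0" for \<xi>
    using less_imp_neq[of 0 "E \<xi>"] by simp
  have [measurable]: "E \<in> borel_measurable borel" unfolding E_def by measurable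
  have e: "?e \<in> wL2 (- s)"
  proof (rule decay_wL2(1)[where K = 1])
    show "?e \<in> borel_measurable borel" by measurable
    fix \<xi> :: 'a
    have ne0: "(1 + norm \<xi>) ^ k \<noteq> 0" for k by (simp add: add_nonneg_eq_0_iff)
    have "(1 + norm \<xi>) ^ (nat \<lceil>\<bar>- s\<bar>\<rceil> + 2 * DIM('a)) * E \<xi> = 1"
      unfolding E_def by (rule right_inverse[OF ne0])
    moreover have "norm (?e \<xi>) = E \<xi>" using pos[of \<xi>] by simp
    ultimately show "(1 + norm \<xi>) ^ (nat \<lceil>\<bar>- s\<bar>\<rceil> + 2 * DIM('a)) * norm (?e \<xi>) \<le> 1"
      by simp
  qed
  have [measurable]: "g n \<in> borel_measurable borel" for n using g[of n] by (rule wL2_measurable)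
  have L1: "integrable lborel (\<lambda>\<xi>. g n \<xi> * ?e \<xi>)" for n by (rule wL2_pairing(1)[OF g e])
  have C1: "\<exists>M. \<forall>m\<ge>M. \<forall>n\<ge>M. (LINT \<xi>|lborel. norm (g m \<xi> * ?e \<xi> - g n \<xi> * ?e \<xi>)) < \<epsilon>" if "\<epsilon> > 0" for \<epsilon>
  proof -
    have "\<epsilon> / (wnorm (- s) ?e + 1) > 0" using that wnorm_nonneg[of "- s" ?e] by simp
    from cauchy[OF this] obtain M where M: "\<And>m n. m \<ge> M \<Longrightarrow> n \<ge> M \<Longrightarrow>
      wnorm s (\<lambda>\<xi>. g m \<xi> - g n \<xi>) < \<epsilon> / (wnorm (- s) ?e + 1)" by blast
    have "(LINT \<xi>|lborel. norm (g m \<xi> * ?e \<xi> - g n \<xi> * ?e \<xi>)) < \<epsilon>" if "m \<ge> M" "n \<ge> M" for m n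
    proof -
      \<comment> \<open>Replacing the difference by its modulus turns the pairing with the positive
        weight into an \<open>L\<^sup>1\<close> norm and leaves the weighted norm unchanged.\<close>
      let ?d = "\<lambda>\<xi>. complex_of_real (norm (g m \<xi> - g n \<xi>))"
      have d: "?d \<in> wL2 s" "wnorm s ?d = wnorm s (\<lambda>\<xi>. g m \<xi> - g n \<xi>)"
        using wL2_diff[OF g g, of m n] by (simp_all add: wL2_def wnorm_def)
      have eq: "norm (g m \<xi> * ?e \<xi> - g n \<xi> * ?e \<xi>) = Re (?d \<xi> * ?e \<xi>)" for \<xi>
      proof -
        have "norm (g m \<xi> * ?e \<xi> - g n \<xi> * ?e \<xi>) = norm (g m \<xi> - g n \<xi>) * norm (?e \<xi>)"
          by (simp only: left_diff_distrib[symmetric] norm_mult)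
        then show ?thesis using pos[of \<xi>] by simp
      qed
      have "(LINT \<xi>|lborel. norm (g m \<xi> * ?e \<xi> - g n \<xi> * ?e \<xi>)) = Re (LINT \<xi>|lborel. ?d \<xi> * ?e \<xi>)"
        unfolding eq by (rule integral_Re[OF wL2_pairing(1)[OF d(1) e]])
      also have "\<dots> \<le> wnorm s (\<lambda>\<xi>. g m \<xi> - g n \<xi>) * wnorm (- s) ?e"
        using wL2_pairing(2)[OF d(1) e] complex_Re_le_cmod order_trans unfolding d(2) by blast
      also have "\<dots> \<le> \<epsilon> / (wnorm (- s) ?e + 1) * wnorm (- s) ?e"
        using M[OF that] by (intro mult_right_mono wnorm_nonneg) auto
      also have "\<dots> < \<epsilon>" using \<open>\<epsilon> > 0\<close> wnorm_nonneg[of "- s" ?e] by (simp add: field_simps)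
      finally show ?thesis .
    qed
    then show ?thesis by blast
  qed
  \<comment> \<open>An \<open>L\<^sup>1\<close> Cauchy sequence has a subsequence that is Cauchy
    almost everywhere; dividing by the nonvanishing weight recovers a pointwise limit of the
    functions \<open>g (r i)\<close>.\<close>
  obtain r where r: "strict_mono r" "AE \<xi> in lborel. Cauchy (\<lambda>i. g (r i) \<xi> * ?e \<xi>)"
    using cauchy_L1_AE_cauchy_subseq[of lborel "\<lambda>n \<xi>. g n \<xi> * ?e \<xi>", OF L1 C1] by blast
  define G where "G = (\<lambda>\<xi>. lim (\<lambda>i. g (r i) \<xi> * ?e \<xi>) / ?e \<xi>)"
  have [measurable]: "G \<in> borel_measurable borel" unfolding G_def by measurable
  have lim: "AE \<xi> in lborel. (\<lambda>i. g (r i) \<xi>) \<longlonglongrightarrow> G \<xi>"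
    using r(2)
  proof eventually_elim
    case (elim \<xi>)
    then have "(\<lambda>i. g (r i) \<xi> * ?e \<xi>) \<longlonglongrightarrow> lim (\<lambda>i. g (r i) \<xi> * ?e \<xi>)"
      by (simp add: Cauchy_convergent_iff convergent_LIMSEQ_iff)
    then have "(\<lambda>i. g (r i) \<xi> * ?e \<xi> / ?e \<xi>) \<longlonglongrightarrow> G \<xi>"
      unfolding G_def by (rule tendsto_divide[OF _ tendsto_const ne])
    then show ?case unfolding nonzero_mult_div_cancel_right[OF ne] .
  qed
  \<comment> \<open>The index \<open>n\<close> stays fixed while Fatou's lemma is applied along the
    subsequence, so the estimate covers the whole sequence.\<close>
  have est: "\<exists>M. \<forall>n\<ge>M. (\<lambda>\<xi>. g n \<xi> - G \<xi>) \<in> wL2 s \<and> wnorm s (\<lambda>\<xi>. g n \<xi> - G \<xi>) \<le> \<epsilon>" if "\<epsilon> > 0" for \<epsilon>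
  proof -
    obtain M where M: "\<And>m n. m \<ge> M \<Longrightarrow> n \<ge> M \<Longrightarrow> wnorm s (\<lambda>\<xi>. g m \<xi> - g n \<xi>) < \<epsilon>"
      using cauchy[OF \<open>\<epsilon> > 0\<close>] by blast
    have "(\<lambda>\<xi>. g n \<xi> - G \<xi>) \<in> wL2 s \<and> wnorm s (\<lambda>\<xi>. g n \<xi> - G \<xi>) \<le> \<epsilon>" if "n \<ge> M" for n
    proof -
      have 1: "(\<lambda>\<xi>. g n \<xi> - g (r i) \<xi>) \<in> wL2 s" for i by (intro wL2_diff g)
      have 2: "wnorm s (\<lambda>\<xi>. g n \<xi> - g (r i) \<xi>) \<le> \<epsilon>" if "i \<ge> M" for i
        using M[OF \<open>n \<ge> M\<close>, of "r i"] seq_suble[OF r(1), of i] that by simp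
      have 3: "AE \<xi> in lborel. (\<lambda>i. g n \<xi> - g (r i) \<xi>) \<longlonglongrightarrow> g n \<xi> - G \<xi>"
        using lim by eventually_elim (intro tendsto_intros)
      show ?thesis
        using wL2_Fatou[of "\<lambda>i \<xi>. g n \<xi> - g (r i) \<xi>" s M \<epsilon> "\<lambda>\<xi>. g n \<xi> - G \<xi>", OF 1 2 _ _ 3] \<open>\<epsilon> > 0\<close>
        by auto
    qed
    then show ?thesis by blast
  qed
  obtain M where "(\<lambda>\<xi>. g M \<xi> - G \<xi>) \<in> wL2 s" using est[of 1] by auto
  from wL2_diff[OF g[of M] this] have G: "G \<in> wL2 s" by simp
  have "(\<lambda>n. wnorm s (\<lambda>\<xi>. g n \<xi> - G \<xi>)) \<longlonglongrightarrow> 0"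
  proof (rule LIMSEQ_I)
    fix \<epsilon> :: real assume "\<epsilon> > 0"
    then obtain M where "\<And>n. n \<ge> M \<Longrightarrow> wnorm s (\<lambda>\<xi>. g n \<xi> - G \<xi>) \<le> \<epsilon> / 2" using est[of "\<epsilon> / 2"] by auto
    then have "wnorm s (\<lambda>\<xi>. g n \<xi> - G \<xi>) < \<epsilon>" if "n \<ge> M" for n
      by (rule le_less_trans) (use \<open>\<epsilon> > 0\<close> that in auto)
    then show "\<exists>M. \<forall>n\<ge>M. norm (wnorm s (\<lambda>\<xi>. g n \<xi> - G \<xi>) - 0) < \<epsilon>"
      by (intro exI[of _ M]) (simp add: wnorm_nonneg)
  qed
  with G show thesis by (rule that)
qed

lemma has_fourier_fun_diff:
  "has_fourier_fun u g \<Longrightarrow> has_fourier_fun v h \<Longrightarrow> has_fourier_fun (u - v) (\<lambda>\<xi>. g \<xi> - h \<xi>)"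
  using has_fourier_fun_add[of u g "- v" "\<lambda>\<xi>. - h \<xi>"] has_fourier_fun_scale[of v h "- 1"] by simp

text \<open>Completeness of the weighted space produces only a Fourier-side limit \<open>G\<close>.
  A real tempered distribution with transform \<open>G\<close> still has to be built: it is the
  limit of the pairings, which converge by \<open>pairing_bound\<close>.\<close>

lemma Hs_complete:
  fixes X :: "nat \<Rightarrow> 'a::euclidean_space tempered"
  assumes X: "\<And>n. X n \<in> Hs s"
    and cauchy: "\<And>\<epsilon>. \<epsilon> > 0 \<Longrightarrow> \<exists>M. \<forall>m\<ge>M. \<forall>n\<ge>M. Hs_norm s (X m - X n) < \<epsilon>"
  obtains x where "x \<in> Hs s" "(\<lambda>n. Hs_norm s (X n - x)) \<longlonglongrightarrow> 0"
proof -
  obtain g where g: "\<And>n. g n \<in> wL2 s" "\<And>n. has_fourier_fun (X n) (g n)"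
    using X unfolding Hs_iff by metis
  have N: "Hs_norm s (X m - X n) = wnorm s (\<lambda>\<xi>. g m \<xi> - g n \<xi>)" for m n
    by (rule Hs_norm_eq[OF has_fourier_fun_diff[OF g(2) g(2)]])
  obtain G where G: "G \<in> wL2 s" "(\<lambda>n. wnorm s (\<lambda>\<xi>. g n \<xi> - G \<xi>)) \<longlonglongrightarrow> 0"
    using wL2_complete[of g s, OF g(1) cauchy[unfolded N]] by blast
  obtain C K where C: "C \<ge> 0" and b: "\<And>u \<phi>. u \<in> Hs s \<Longrightarrow> \<phi> \<in> schwartz \<Longrightarrow>
      \<bar>pairing u \<phi>\<bar> \<le> C * schwartz_seminorm K \<phi> * Hs_norm s (u :: 'a tempered)"
    using pairing_bound[where 'a='a, of s] by blast
  have pc: "pairing (u - v) \<phi> = pairing u \<phi> - pairing v \<phi>" for u v :: "'a tempered" and \<phi>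
    by (simp add: minus_tempered.rep_eq)
  \<comment> \<open>The default \<open>0\<close> off the Schwartz functions is demanded by
    \<open>is_tempered\<close>.\<close>
  let ?L = "\<lambda>\<phi>. if \<phi> \<in> schwartz then lim (\<lambda>n. pairing (X n) \<phi>) else 0"
  have L: "(\<lambda>n. pairing (X n) \<phi>) \<longlonglongrightarrow> ?L \<phi>" if \<phi>: "\<phi> \<in> schwartz" for \<phi>
  proof -
    let ?c = "C * schwartz_seminorm K \<phi>"
    have c: "?c \<ge> 0" using C schwartz_seminorm_nonneg[OF \<phi>] by simp
    have "Cauchy (\<lambda>n. pairing (X n) \<phi>)"
    proof (rule CauchyI)
      fix \<epsilon> :: real assume "\<epsilon> > 0"
      then have "\<epsilon> / (?c + 1) > 0" using c by simp
      from cauchy[OF this] obtain M where M: "\<And>m n. m \<ge> M \<Longrightarrow> n \<ge> M \<Longrightarrow> Hs_norm s (X m - X n) < \<epsilon> / (?c + 1)"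
        by blast
      have "norm (pairing (X m) \<phi> - pairing (X n) \<phi>) < \<epsilon>" if "m \<ge> M" "n \<ge> M" for m n
      proof -
        have "norm (pairing (X m) \<phi> - pairing (X n) \<phi>) \<le> ?c * Hs_norm s (X m - X n)"
          using b[OF Hs_diff(1)[OF X X] \<phi>] by (simp add: pc)
        also have "\<dots> \<le> ?c * (\<epsilon> / (?c + 1))" using M[OF that] c by (intro mult_left_mono) auto
        also have "\<dots> < \<epsilon>" using \<open>\<epsilon> > 0\<close> c by (simp add: field_simps)
        finally show ?thesis .
      qed
      then show "\<exists>M. \<forall>m\<ge>M. \<forall>n\<ge>M. norm (pairing (X m) \<phi> - pairing (X n) \<phi>) < \<epsilon>" by blast
    qed
    then show ?thesis using \<phi> by (simp add: Cauchy_convergent_iff convergent_LIMSEQ_iff)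
  qed
  obtain M where M: "\<And>m n. m \<ge> M \<Longrightarrow> n \<ge> M \<Longrightarrow> Hs_norm s (X m - X n) < 1" using cauchy[of 1] by auto
  \<comment> \<open>A bound for the norms of the tail: its members are within distance one of
    \<open>X M\<close>, and \<open>Hs_add\<close> costs a factor 2. It yields one seminorm bound for
    the limit functional.\<close>
  let ?B = "2 * (1 + Hs_norm s (X M))"
  have B: "Hs_norm s (X n) \<le> ?B" if "n \<ge> M" for n
    using Hs_add(2)[OF Hs_diff(1)[OF X X] X, of n M M] M[OF that, of M] by simp
  have "is_tempered ?L"
    unfolding is_tempered_def
  proof (intro conjI ballI allI)
    fix \<phi> \<psi> :: "'a \<Rightarrow> real" assume s: "\<phi> \<in> schwartz" "\<psi> \<in> schwartz"
    have "(\<lambda>n. pairing (X n) (\<lambda>x. \<phi> x + \<psi> x)) \<longlonglongrightarrow> ?L \<phi> + ?L \<psi>"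
      using tendsto_add[OF L[OF s(1)] L[OF s(2)]] by (simp add: pairing_add_fun s)
    from LIMSEQ_unique[OF L[OF add_schwartz[OF s]] this]
    show "?L (\<lambda>x. \<phi> x + \<psi> x) = ?L \<phi> + ?L \<psi>" .
  next
    fix c and \<phi> :: "'a \<Rightarrow> real" assume s: "\<phi> \<in> schwartz"
    have "pairing u (\<lambda>x. c * \<phi> x) = c * pairing u \<phi>" for u
      using pairing_tempered[of u] s by (simp add: is_tempered_def)
    then have "(\<lambda>n. pairing (X n) (\<lambda>x. c * \<phi> x)) \<longlonglongrightarrow> c * ?L \<phi>"
      using tendsto_mult_left[OF L[OF s], of c] by simp
    from LIMSEQ_unique[OF L[OF scale_schwartz[OF s]] this]
    show "?L (\<lambda>x. c * \<phi> x) = c * ?L \<phi>" .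
  next
    have "\<bar>?L \<phi>\<bar> \<le> (C * ?B) * schwartz_seminorm K \<phi>" if s: "\<phi> \<in> schwartz" for \<phi>
    proof (rule LIMSEQ_le_const2[OF tendsto_rabs[OF L[OF s]]])
      have "\<bar>pairing (X n) \<phi>\<bar> \<le> (C * ?B) * schwartz_seminorm K \<phi>" if "n \<ge> M" for n
      proof -
        have "\<bar>pairing (X n) \<phi>\<bar> \<le> C * schwartz_seminorm K \<phi> * Hs_norm s (X n)" by (rule b[OF X s])
        also have "\<dots> \<le> C * schwartz_seminorm K \<phi> * ?B"
          using C schwartz_seminorm_nonneg[OF s] by (intro mult_left_mono B[OF that]) auto
        finally show ?thesis by (simp only: mult_ac)
      qed
      then show "\<exists>M. \<forall>n\<ge>M. \<bar>pairing (X n) \<phi>\<bar> \<le> (C * ?B) * schwartz_seminorm K \<phi>" by blast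
    qed
    then show "\<exists>C N. \<forall>\<phi>\<in>schwartz. \<bar>?L \<phi>\<bar> \<le> C * schwartz_seminorm N \<phi>" by blast
  qed simp
  define x where "x = Abs_tempered ?L"
  have px: "pairing x = ?L" unfolding x_def using \<open>is_tempered ?L\<close> by (simp add: Abs_tempered_inverse)
  have "has_fourier_fun x G"
    unfolding has_fourier_fun_def
  proof (intro conjI ballI)
    show "G \<in> borel_measurable lborel" using wL2_measurable[OF G(1)] by simp
    fix \<phi> :: "'a \<Rightarrow> complex" assume \<phi>: "\<phi> \<in> schwartz"
    show "integrable lborel (\<lambda>\<xi>. G \<xi> * \<phi> \<xi>)" by (rule wL2_pairing(1)[OF G(1) schwartz_wL2[OF \<phi>]])
    have F: "fourier \<phi> \<in> schwartz" by (rule fourier_schwartz[OF \<phi>])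
    have RI: "(\<lambda>x. Re (fourier \<phi> x)) \<in> schwartz" "(\<lambda>x. Im (fourier \<phi> x)) \<in> schwartz"
      by (rule schwartz_bounded_linear[OF bounded_linear_Re F], rule schwartz_bounded_linear[OF bounded_linear_Im F])
    \<comment> \<open>The Fourier identities of the \<open>X n\<close> are passed to the limit on
      both sides: pointwise convergence of pairings on one side, weighted norm convergence paired
      with \<open>\<phi>\<close> on the other.\<close>
    have 1: "(\<lambda>n. fourier_distr (X n) \<phi>) \<longlonglongrightarrow> fourier_distr x \<phi>"
      unfolding fourier_distr_def px by (intro tendsto_Complex L RI)
    have 2: "(\<lambda>n. fourier_distr (X n) \<phi>) \<longlonglongrightarrow> (LINT \<xi>|lborel. G \<xi> * \<phi> \<xi>)"
    proof (rule LIM_zero_cancel, rule Lim_null_comparison)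
      have "norm (fourier_distr (X n) \<phi> - (LINT \<xi>|lborel. G \<xi> * \<phi> \<xi>)) \<le>
          wnorm s (\<lambda>\<xi>. g n \<xi> - G \<xi>) * wnorm (- s) \<phi>" for n
      proof -
        have "fourier_distr (X n) \<phi> - (LINT \<xi>|lborel. G \<xi> * \<phi> \<xi>) = (LINT \<xi>|lborel. (g n \<xi> - G \<xi>) * \<phi> \<xi>)"
          using g(2)[of n] \<phi> wL2_pairing(1)[OF G(1) schwartz_wL2[OF \<phi>]]
          by (simp add: has_fourier_fun_def left_diff_distrib)
        then show ?thesis using wL2_pairing(2)[OF wL2_diff[OF g(1) G(1)] schwartz_wL2[OF \<phi>]] by simp
      qed
      then show "\<forall>\<^sub>F n in sequentially. norm (fourier_distr (X n) \<phi> - (LINT \<xi>|lborel. G \<xi> * \<phi> \<xi>)) \<le>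
          wnorm s (\<lambda>\<xi>. g n \<xi> - G \<xi>) * wnorm (- s) \<phi>" by simp
      show "(\<lambda>n. wnorm s (\<lambda>\<xi>. g n \<xi> - G \<xi>) * wnorm (- s) \<phi>) \<longlonglongrightarrow> 0"
        by (rule tendsto_mult_left_zero[OF G(2)])
    qed
    show "fourier_distr x \<phi> = (LINT \<xi>|lborel. G \<xi> * \<phi> \<xi>)" by (rule LIMSEQ_unique[OF 1 2])
  qed
  note hx = this
  show thesis
  proof (rule that)
    show "x \<in> Hs s" using hx G(1) by (auto simp: Hs_iff)
    show "(\<lambda>n. Hs_norm s (X n - x)) \<longlonglongrightarrow> 0"
      using G(2) by (simp add: Hs_norm_eq[OF has_fourier_fun_diff[OF g(2) hx]])
  qed
qed

section \<open>Test functions and the space \<open>Hs_tilde\<close>\<close>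

lemma test_functions_support_mono:
  assumes f: "f \<in> test_functions U" and h: "smooth h" "\<And>x. h x \<noteq> 0 \<Longrightarrow> x \<in> closure {x. f x \<noteq> 0}"
  shows "h \<in> test_functions U"
proof -
  have "closure {x. h x \<noteq> 0} \<subseteq> closure {x. f x \<noteq> 0}" using h(2) by (intro closure_minimal) auto
  moreover have "compact (closure {x. f x \<noteq> 0})" using f by (simp add: test_functions_def)
  ultimately have "compact (closure {x. h x \<noteq> 0})"
    using compact_Int_closed[OF _ closed_closure[of "{x. h x \<noteq> 0}"]] by (metis Int_absorb1)
  with \<open>closure {x. h x \<noteq> 0} \<subseteq> _\<close> show ?thesis using f h(1) by (auto simp: test_functions_def)
qed

lemma test_functions_scale:
  assumes f: "f \<in> test_functions U" shows "(\<lambda>x. c * f x) \<in> test_functions U"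
proof (rule test_functions_support_mono[OF f])
  have "f \<in> schwartz" using f test_functions_schwartz by blast
  from scale_schwartz[OF this] show "smooth (\<lambda>x. c * f x)" by (simp add: schwartz_def)
  show "x \<in> closure {x. f x \<noteq> 0}" if "c * f x \<noteq> 0" for x
    by (rule subsetD[OF closure_subset]) (use that in simp)
qed

lemma test_functions_add:
  assumes f: "f \<in> test_functions U" and g: "g \<in> test_functions U"
  shows "(\<lambda>x. f x + g x) \<in> test_functions U"
proof -
  have "(\<lambda>x. f x + g x) \<in> schwartz" using f g test_functions_schwartz by (intro add_schwartz) auto
  then have "smooth (\<lambda>x. f x + g x)" by (simp add: schwartz_def)
  moreover have sub: "closure {x. f x + g x \<noteq> 0} \<subseteq> closure {x. f x \<noteq> 0} \<union> closure {x. g x \<noteq> 0}"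
  proof (intro closure_minimal closed_Un closed_closure subsetI)
    fix x assume "x \<in> {x. f x + g x \<noteq> 0}"
    then have "x \<in> {x. f x \<noteq> 0} \<or> x \<in> {x. g x \<noteq> 0}" by auto
    then show "x \<in> closure {x. f x \<noteq> 0} \<union> closure {x. g x \<noteq> 0}"
      using closure_subset[of "{x. f x \<noteq> 0}"] closure_subset[of "{x. g x \<noteq> 0}"] by blast
  qed
  moreover have "compact (closure {x. f x + g x \<noteq> 0})"
  proof -
    have "compact (closure {x. f x \<noteq> 0} \<union> closure {x. g x \<noteq> 0})"
      using f g by (intro compact_Un) (auto simp: test_functions_def)
    from compact_Int_closed[OF this closed_closure, of "{x. f x + g x \<noteq> 0}"] show ?thesis
      using sub by (simp add: Int_absorb1)
  qed
  ultimately show ?thesis using f g by (auto simp: test_functions_def)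
qed

lemma test_functions_nonzero:
  assumes "f \<in> test_functions U" "f x \<noteq> 0" shows "x \<in> U"
proof -
  have "x \<in> closure {x. f x \<noteq> 0}" by (rule subsetD[OF closure_subset]) (use assms in simp)
  then show ?thesis using assms(1) by (auto simp: test_functions_def)
qed

lemma test_functions_mono: "U \<subseteq> V \<Longrightarrow> test_functions U \<subseteq> test_functions V"
  by (auto simp: test_functions_def)

lemma test_functions_zero: "(\<lambda>_. 0) \<in> test_functions U"
  using schwartz_zero by (auto simp: test_functions_def schwartz_def)

lemma distr_of_fun_add:
  assumes f: "f \<in> test_functions U" and g: "g \<in> test_functions U"
  shows "distr_of_fun (\<lambda>x. f x + g x) = distr_of_fun f + distr_of_fun g"
proof (rule tempered_eqI)
  fix \<phi> :: "'a \<Rightarrow> real" assume \<phi>: "\<phi> \<in> schwartz"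
  note i = integrable_test_mult[OF _ schwartz_continuous[OF \<phi>]]
  show "pairing (distr_of_fun (\<lambda>x. f x + g x)) \<phi> = pairing (distr_of_fun f + distr_of_fun g) \<phi>"
    using i[OF f] i[OF g]
    by (simp add: pairing_distr_of_fun[OF _ \<phi>, of _ U] test_functions_add f g plus_tempered.rep_eq distrib_right)
qed

lemma distr_of_fun_scale:
  assumes f: "f \<in> test_functions U"
  shows "distr_of_fun (\<lambda>x. c * f x) = c *\<^sub>R distr_of_fun f"
  by (rule tempered_eqI)
    (simp add: pairing_distr_of_fun[where U = U] test_functions_scale f scaleR_tempered.rep_eq mult.assoc)

text \<open>The multiplication formula identifies the transform defined by duality with the
  integral. As the latter is a Schwartz function, test functions lie in \<open>Hs s\<close> for
  every \<open>s\<close>.\<close>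

lemma has_fourier_fun_test:
  fixes f :: "'a::euclidean_space \<Rightarrow> real"
  assumes f: "f \<in> test_functions U"
  shows "has_fourier_fun (distr_of_fun f) (fourier (\<lambda>x. of_real (f x)))"
  unfolding has_fourier_fun_def
proof (intro conjI ballI)
  let ?f = "\<lambda>x. complex_of_real (f x)"
  have fs: "?f \<in> schwartz" using f test_functions_schwartz by (intro schwartz_of_real) auto
  have Ff: "fourier ?f \<in> schwartz" by (rule fourier_schwartz[OF fs])
  show "fourier ?f \<in> borel_measurable lborel" using schwartz_measurable[OF Ff] by simp
  fix \<phi> :: "'a \<Rightarrow> complex" assume \<phi>: "\<phi> \<in> schwartz"
  show "integrable lborel (\<lambda>\<xi>. fourier ?f \<xi> * \<phi> \<xi>)"
    by (rule wL2_pairing(1)[OF schwartz_wL2[OF Ff, of 0]]) (simp add: schwartz_wL2[OF \<phi>])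
  have F: "fourier \<phi> \<in> schwartz" by (rule fourier_schwartz[OF \<phi>])
  have RI: "(\<lambda>x. Re (fourier \<phi> x)) \<in> schwartz" "(\<lambda>x. Im (fourier \<phi> x)) \<in> schwartz"
    by (rule schwartz_bounded_linear[OF bounded_linear_Re F], rule schwartz_bounded_linear[OF bounded_linear_Im F])
  have i: "integrable lborel (\<lambda>x. ?f x * fourier \<phi> x)"
    by (rule wL2_pairing(1)[OF schwartz_wL2[OF fs, of 0]]) (simp add: schwartz_wL2[OF F])
  have "(LINT \<xi>|lborel. fourier ?f \<xi> * \<phi> \<xi>) = (LINT x|lborel. ?f x * fourier \<phi> x)"
    by (rule fourier_multiplication_formula[OF schwartz_imp_integrable[OF fs] schwartz_imp_integrable[OF \<phi>]])
  also have "\<dots> = Complex (LINT x|lborel. f x * Re (fourier \<phi> x)) (LINT x|lborel. f x * Im (fourier \<phi> x))"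
    using integral_Re[OF i] integral_Im[OF i] by (simp add: complex_eq_iff)
  finally show "fourier_distr (distr_of_fun f) \<phi> = (LINT \<xi>|lborel. fourier ?f \<xi> * \<phi> \<xi>)"
    by (simp add: fourier_distr_def pairing_distr_of_fun[OF f] RI)
qed

lemma Hs_test:
  assumes "f \<in> test_functions U" shows "distr_of_fun f \<in> Hs s"
proof -
  have "(\<lambda>x. complex_of_real (f x)) \<in> schwartz"
    using assms test_functions_schwartz by (intro schwartz_of_real) auto
  from schwartz_wL2[OF fourier_schwartz[OF this]] has_fourier_fun_test[OF assms]
  show ?thesis by (auto simp: Hs_iff)
qed

lemma Hs_norm_0: "Hs_norm s 0 = 0"
  using Hs_scale(2)[OF Hs_test[OF test_functions_zero[of UNIV]], of s 0] by simp

lemma Hs_0: "0 \<in> Hs s"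
  using Hs_scale(1)[OF Hs_test[OF test_functions_zero[of UNIV]], of 0 s] by simp

lemma Hs_tilde_Hs: "u \<in> Hs_tilde s U \<Longrightarrow> u \<in> Hs s"
  by (simp add: Hs_tilde_def)

lemma Hs_tilde_test: "f \<in> test_functions U \<Longrightarrow> distr_of_fun f \<in> Hs_tilde s U"
  by (auto simp: Hs_tilde_def Hs_test Hs_norm_0 intro!: bexI[of _ f])

lemma Hs_tilde_approx:
  assumes "u \<in> Hs_tilde s U"
  obtains \<phi> where "\<And>n. \<phi> n \<in> test_functions U" "(\<lambda>n. Hs_norm s (u - distr_of_fun (\<phi> n))) \<longlonglongrightarrow> 0"
proof -
  have "\<exists>\<phi>\<in>test_functions U. Hs_norm s (u - distr_of_fun \<phi>) < inverse (real (Suc n))" for n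
    using assms by (auto simp: Hs_tilde_def)
  then obtain \<phi> where \<phi>: "\<And>n. \<phi> n \<in> test_functions U"
    "\<And>n. Hs_norm s (u - distr_of_fun (\<phi> n)) < inverse (real (Suc n))" by metis
  have "(\<lambda>n. Hs_norm s (u - distr_of_fun (\<phi> n))) \<longlonglongrightarrow> 0"
    by (rule Lim_null_comparison[OF _ LIMSEQ_inverse_real_of_nat])
      (use \<phi>(2) in \<open>auto simp: Hs_norm_nonneg less_imp_le simp del: of_nat_Suc\<close>)
  with \<phi>(1) show thesis by (rule that)
qed

lemma Hs_tilde_add:
  assumes "u \<in> Hs_tilde s U" "v \<in> Hs_tilde s U"
  shows "u + v \<in> Hs_tilde s U"
proof -
  have "\<exists>\<phi>\<in>test_functions U. Hs_norm s (u + v - distr_of_fun \<phi>) < \<epsilon>" if "\<epsilon> > 0" for \<epsilon>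
  proof -
    \<comment> \<open>Two errors below a quarter, doubled by the constant in \<open>Hs_add\<close>,
      stay below \<open>\<epsilon>\<close>.\<close>
    have e: "\<epsilon> / 4 > 0" using that by simp
    obtain f g where f: "f \<in> test_functions U" "Hs_norm s (u - distr_of_fun f) < \<epsilon> / 4"
      and g: "g \<in> test_functions U" "Hs_norm s (v - distr_of_fun g) < \<epsilon> / 4"
      using assms e unfolding Hs_tilde_def by blast
    have eq: "u + v - distr_of_fun (\<lambda>x. f x + g x) = (u - distr_of_fun f) + (v - distr_of_fun g)"
      by (simp add: distr_of_fun_add[OF f(1) g(1)])
    have "Hs_norm s (u + v - distr_of_fun (\<lambda>x. f x + g x)) \<le>
        2 * (Hs_norm s (u - distr_of_fun f) + Hs_norm s (v - distr_of_fun g))"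
      unfolding eq by (intro Hs_add(2) Hs_diff(1) Hs_test[OF f(1)] Hs_test[OF g(1)] Hs_tilde_Hs[OF assms(1)] Hs_tilde_Hs[OF assms(2)])
    then have "Hs_norm s (u + v - distr_of_fun (\<lambda>x. f x + g x)) < \<epsilon>" using f(2) g(2) by simp
    then show ?thesis using test_functions_add[OF f(1) g(1)] by blast
  qed
  then show ?thesis using assms by (auto simp: Hs_tilde_def Hs_add)
qed

lemma Hs_tilde_scale:
  assumes u: "u \<in> Hs_tilde s U" shows "c *\<^sub>R u \<in> Hs_tilde s U"
proof -
  have "\<exists>\<phi>\<in>test_functions U. Hs_norm s (c *\<^sub>R u - distr_of_fun \<phi>) < \<epsilon>" if "\<epsilon> > 0" for \<epsilon>
  proof -
    have "\<epsilon> / (\<bar>c\<bar> + 1) > 0" using that by simp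
    then obtain f where f: "f \<in> test_functions U" "Hs_norm s (u - distr_of_fun f) < \<epsilon> / (\<bar>c\<bar> + 1)"
      using u unfolding Hs_tilde_def by blast
    have "Hs_norm s (c *\<^sub>R u - distr_of_fun (\<lambda>x. c * f x)) = \<bar>c\<bar> * Hs_norm s (u - distr_of_fun f)"
      unfolding distr_of_fun_scale[OF f(1)] scaleR_diff_right[symmetric]
      by (intro Hs_scale Hs_diff Hs_test[OF f(1)] Hs_tilde_Hs[OF u])
    also have "\<dots> \<le> \<bar>c\<bar> * (\<epsilon> / (\<bar>c\<bar> + 1))" using f(2) by (intro mult_left_mono) auto
    also have "\<dots> < \<epsilon>" using that by (simp add: divide_less_eq distrib_left mult.commute)
    finally show ?thesis using test_functions_scale[OF f(1)] by blast
  qed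
  then show ?thesis using Hs_scale[OF Hs_tilde_Hs[OF u]] by (simp add: Hs_tilde_def)
qed

lemma Hs_tilde_0: "0 \<in> Hs_tilde s U"
  using Hs_tilde_scale[OF Hs_tilde_test[OF test_functions_zero], of 0] by simp

lemma Hs_tilde_minus: "u \<in> Hs_tilde s U \<Longrightarrow> - u \<in> Hs_tilde s U"
  using Hs_tilde_scale[of u s U "- 1"] by simp

lemma Hs_tilde_diff: "u \<in> Hs_tilde s U \<Longrightarrow> v \<in> Hs_tilde s U \<Longrightarrow> u - v \<in> Hs_tilde s U"
  using Hs_tilde_add[of u s U "- v"] Hs_tilde_minus[of v s U] by simp

lemma Hs_tilde_closed:
  assumes X: "\<And>n. X n \<in> Hs_tilde s U" and x: "x \<in> Hs s" and lim: "(\<lambda>n. Hs_norm s (X n - x)) \<longlonglongrightarrow> 0"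
  shows "x \<in> Hs_tilde s U"
proof -
  have "\<exists>\<phi>\<in>test_functions U. Hs_norm s (x - distr_of_fun \<phi>) < \<epsilon>" if "\<epsilon> > 0" for \<epsilon>
  proof -
    have e: "\<epsilon> / 4 > 0" using that by simp
    from LIMSEQ_D[OF lim e] obtain n where n: "Hs_norm s (X n - x) < \<epsilon> / 4"
      by (auto simp: Hs_norm_nonneg)
    obtain f where f: "f \<in> test_functions U" "Hs_norm s (X n - distr_of_fun f) < \<epsilon> / 4"
      using X[of n] e unfolding Hs_tilde_def by blast
    have "x - distr_of_fun f = (X n - distr_of_fun f) - (X n - x)" by simp
    moreover have "Hs_norm s \<dots> \<le> 2 * (Hs_norm s (X n - distr_of_fun f) + Hs_norm s (X n - x))"
      using f x Hs_tilde_Hs[OF X] by (intro Hs_diff Hs_test) auto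
    ultimately have "Hs_norm s (x - distr_of_fun f) < \<epsilon>" using n f(2) by simp
    then show ?thesis using f(1) by blast
  qed
  then show ?thesis using x by (simp add: Hs_tilde_def)
qed

section \<open>Convergence of pairings and supports of distributions\<close>

lemma pairing_tendsto:
  assumes u: "u \<in> Hs s" "\<And>n. v n \<in> Hs s" and lim: "(\<lambda>n. Hs_norm s (u - v n)) \<longlonglongrightarrow> 0"
    and \<phi>: "\<phi> \<in> schwartz"
  shows "(\<lambda>n. pairing (v n) \<phi>) \<longlonglongrightarrow> pairing (u :: 'a::euclidean_space tempered) \<phi>"
proof -
  obtain C K where b: "\<And>u \<phi>. u \<in> Hs s \<Longrightarrow> \<phi> \<in> schwartz \<Longrightarrow>
      \<bar>pairing u \<phi>\<bar> \<le> C * schwartz_seminorm K \<phi> * Hs_norm s (u :: 'a tempered)"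
    using pairing_bound[where 'a='a, of s] by blast
  have "(\<lambda>n. pairing (u - v n) \<phi>) \<longlonglongrightarrow> 0"
    by (rule Lim_null_comparison[OF _ tendsto_mult_right_zero[OF lim, of "C * schwartz_seminorm K \<phi>"]])
      (use b[OF Hs_diff(1) \<phi>] u in auto)
  from tendsto_diff[OF tendsto_const[of "pairing u \<phi>"] this] show ?thesis
    by (simp add: minus_tempered.rep_eq)
qed

lemma distr_support_subset:
  assumes "closed K" "vanishes_on u (- K)" shows "distr_support u \<subseteq> K"
proof -
  have "- K \<in> {V. open V \<and> vanishes_on u V}" using assms by (simp add: open_Compl)
  then show ?thesis unfolding distr_support_def by blast
qed

lemma distr_support_test:
  assumes f: "f \<in> test_functions U"
  shows "distr_support (distr_of_fun f) \<subseteq> closure {x. f x \<noteq> 0}"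
proof -
  let ?V = "- closure {x. f x \<noteq> 0}"
  have "vanishes_on (distr_of_fun f) ?V"
    unfolding vanishes_on_def
  proof
    fix \<phi> assume \<phi>: "\<phi> \<in> test_functions ?V"
    have "f x * \<phi> x = 0" for x
      using \<phi> closure_subset[of "{x. \<phi> x \<noteq> 0}"] closure_subset[of "{x. f x \<noteq> 0}"]
      by (auto simp: test_functions_def)
    moreover have "\<phi> \<in> schwartz" using \<phi> test_functions_schwartz by blast
    ultimately show "pairing (distr_of_fun f) \<phi> = 0"
      by (simp only: pairing_distr_of_fun[OF f] integral_zero)
  qed
  then show ?thesis by (rule distr_support_subset[OF closed_closure])
qed

text \<open>Vanishing passes to the limit: the approximating test functions live in
  \<open>U\<close>, so their products with test functions on \<open>V\<close> are zero, and norm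
  convergence implies convergence of pairings.\<close>

lemma Hs_tilde_vanishes_on:
  assumes u: "u \<in> Hs_tilde s U" and "U \<inter> V = {}"
  shows "vanishes_on u V"
  unfolding vanishes_on_def
proof
  fix \<psi> assume \<psi>: "\<psi> \<in> test_functions V"
  obtain \<phi> where \<phi>: "\<And>n. \<phi> n \<in> test_functions U" "(\<lambda>n. Hs_norm s (u - distr_of_fun (\<phi> n))) \<longlonglongrightarrow> 0"
    using Hs_tilde_approx[OF u] by blast
  have s: "\<psi> \<in> schwartz" using \<psi> test_functions_schwartz by auto
  have "\<phi> n x * \<psi> x = 0" for n x
    using test_functions_nonzero[OF \<psi>, of x] test_functions_nonzero[OF \<phi>(1), of n x] \<open>U \<inter> V = {}\<close> by auto
  then have "pairing (distr_of_fun (\<phi> n)) \<psi> = 0" for n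
    by (simp only: pairing_distr_of_fun[OF \<phi>(1) s] integral_zero)
  then show "pairing u \<psi> = 0"
    using pairing_tendsto[OF Hs_tilde_Hs[OF u] Hs_test[OF \<phi>(1)] \<phi>(2) s] by (simp add: LIMSEQ_const_iff)
qed

lemma Hs_tilde_support:
  assumes "u \<in> Hs_tilde s U" shows "distr_support u \<subseteq> closure U"
  using Hs_tilde_vanishes_on[OF assms, of "- closure U"] closure_subset[of U]
  by (intro distr_support_subset[OF closed_closure]) blast

section \<open>The Lax--Milgram theorem\<close>

text \<open>A coercive form is used as its own (squared) norm, so that neither an inner product nor a norm
  on the ambient vector space is needed.\<close>

locale coercive_form =
  fixes V :: "'v::real_vector set" and B :: "'v \<Rightarrow> 'v \<Rightarrow> real" and K :: real
  assumes V_add: "u \<in> V \<Longrightarrow> v \<in> V \<Longrightarrow> u + v \<in> V"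
    and V_scale: "u \<in> V \<Longrightarrow> c *\<^sub>R u \<in> V"
    and V_zero: "0 \<in> V"
    and add_left: "u \<in> V \<Longrightarrow> v \<in> V \<Longrightarrow> w \<in> V \<Longrightarrow> B (u + v) w = B u w + B v w"
    and add_right: "u \<in> V \<Longrightarrow> v \<in> V \<Longrightarrow> w \<in> V \<Longrightarrow> B w (u + v) = B w u + B w v"
    and scale_left: "u \<in> V \<Longrightarrow> v \<in> V \<Longrightarrow> B (c *\<^sub>R u) v = c * B u v"
    and scale_right: "u \<in> V \<Longrightarrow> v \<in> V \<Longrightarrow> B u (c *\<^sub>R v) = c * B u v"
    and nonneg: "u \<in> V \<Longrightarrow> 0 \<le> B u u"
    and bounded: "u \<in> V \<Longrightarrow> v \<in> V \<Longrightarrow> \<bar>B u v\<bar> \<le> K * sqrt (B u u) * sqrt (B v v)"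
    and complete: "(\<And>n. X n \<in> V) \<Longrightarrow>
      (\<And>\<epsilon>. \<epsilon> > 0 \<Longrightarrow> \<exists>M. \<forall>m\<ge>M. \<forall>n\<ge>M. B (X m - X n) (X m - X n) < \<epsilon>) \<Longrightarrow>
      \<exists>x\<in>V. (\<lambda>n. B (X n - x) (X n - x)) \<longlonglongrightarrow> 0"
begin

text \<open>The symmetric part has the same quadratic form as \<open>B\<close>, so it serves as the
  inner product belonging to \<open>N\<close>, while \<open>B\<close> itself may be
  asymmetric.\<close>

definition S :: "'v \<Rightarrow> 'v \<Rightarrow> real" where "S u v = (B u v + B v u) / 2"

definition N :: "'v \<Rightarrow> real" where "N u = sqrt (B u u)"

lemma V_minus: "u \<in> V \<Longrightarrow> - u \<in> V"
  using V_scale[of u "- 1"] by simp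

lemma V_diff: "u \<in> V \<Longrightarrow> v \<in> V \<Longrightarrow> u - v \<in> V"
  using V_add[of u "- v"] V_minus[of v] by simp

lemma minus_left: "u \<in> V \<Longrightarrow> v \<in> V \<Longrightarrow> B (- u) v = - B u v"
  using scale_left[of u v "- 1"] by simp

lemma minus_right: "u \<in> V \<Longrightarrow> v \<in> V \<Longrightarrow> B u (- v) = - B u v"
  using scale_right[of u v "- 1"] by simp

lemma diff_left: "u \<in> V \<Longrightarrow> v \<in> V \<Longrightarrow> w \<in> V \<Longrightarrow> B (u - v) w = B u w - B v w"
  using add_left[of u "- v" w] by (simp add: minus_left V_minus)

lemma diff_right: "u \<in> V \<Longrightarrow> v \<in> V \<Longrightarrow> w \<in> V \<Longrightarrow> B w (u - v) = B w u - B w v"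
  using add_right[of u "- v" w] by (simp add: minus_right V_minus)

lemmas V_closed = V_add V_scale V_diff V_minus V_zero
lemmas B_simps = add_left add_right scale_left scale_right diff_left diff_right V_closed

lemma S_self: "S u u = B u u" by (simp add: S_def)

lemma N_square: "u \<in> V \<Longrightarrow> (N u)\<^sup>2 = B u u"
  using nonneg by (simp add: N_def)

lemma N_nonneg: "u \<in> V \<Longrightarrow> 0 \<le> N u"
  using nonneg by (simp add: N_def)

lemma S_Cauchy_Schwarz:
  assumes "u \<in> V" "v \<in> V" shows "\<bar>S u v\<bar> \<le> N u * N v"
proof -
  have "(S u v)\<^sup>2 \<le> B u u * B v v"
  proof (rule quadratic_nonneg_imp)
    fix t
    have "0 \<le> B (u - t *\<^sub>R v) (u - t *\<^sub>R v)" using assms by (intro nonneg V_closed)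
    also have "\<dots> = B u u - 2 * t * S u v + t\<^sup>2 * B v v"
      using assms by (simp add: B_simps S_def power2_eq_square algebra_simps)
    finally show "0 \<le> B u u - 2 * t * S u v + t\<^sup>2 * B v v" .
  qed (use assms nonneg in auto)
  then have "\<bar>S u v\<bar> \<le> sqrt (B u u * B v v)" by (intro real_le_rsqrt) simp
  then show ?thesis by (simp add: N_def real_sqrt_mult)
qed

lemma N_triangle:
  assumes "u \<in> V" "v \<in> V" shows "N (u + v) \<le> N u + N v"
proof (rule power2_le_imp_le)
  have "(N (u + v))\<^sup>2 = (N u)\<^sup>2 + 2 * S u v + (N v)\<^sup>2"
    using assms by (simp add: N_square B_simps S_def)
  also have "\<dots> \<le> (N u + N v)\<^sup>2"
    using S_Cauchy_Schwarz[OF assms] by (simp add: power2_sum abs_le_iff)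
  finally show "(N (u + v))\<^sup>2 \<le> (N u + N v)\<^sup>2" .
qed (use assms N_nonneg in auto)

lemma N_scale: "u \<in> V \<Longrightarrow> N (c *\<^sub>R u) = \<bar>c\<bar> * N u"
  by (simp add: N_def B_simps real_sqrt_mult mult.assoc[symmetric])

lemma N_minus: "u \<in> V \<Longrightarrow> N (- u) = N u"
  using N_scale[of u "- 1"] by simp

lemma N_triangle_diff: "u \<in> V \<Longrightarrow> v \<in> V \<Longrightarrow> N (u - v) \<le> N u + N v"
  using N_triangle[of u "- v"] by (simp add: N_minus V_minus)

lemma N_complete:
  assumes X: "\<And>n. X n \<in> V" and c: "\<And>\<epsilon>. \<epsilon> > 0 \<Longrightarrow> \<exists>M. \<forall>m\<ge>M. \<forall>n\<ge>M. N (X m - X n) < \<epsilon>"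
  shows "\<exists>x\<in>V. (\<lambda>n. N (X n - x)) \<longlonglongrightarrow> 0"
proof -
  have "\<exists>M. \<forall>m\<ge>M. \<forall>n\<ge>M. B (X m - X n) (X m - X n) < \<epsilon>" if "\<epsilon> > 0" for \<epsilon>
    using c[of "sqrt \<epsilon>"] that by (simp add: N_def)
  from complete[OF X this] obtain x where "x \<in> V" "(\<lambda>n. B (X n - x) (X n - x)) \<longlonglongrightarrow> 0" by blast
  then show ?thesis using tendsto_real_sqrt[of "\<lambda>n. B (X n - x) (X n - x)" 0] by (auto simp: N_def)
qed

text \<open>Riesz representation for the symmetric part, by minimising \<open>S u u - 2 F u\<close>.\<close>

lemma Riesz:
  fixes F :: "'v \<Rightarrow> real" and C :: real
  assumes F_add: "\<And>u v. u \<in> V \<Longrightarrow> v \<in> V \<Longrightarrow> F (u + v) = F u + F v"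
    and F_scale: "\<And>c u. u \<in> V \<Longrightarrow> F (c *\<^sub>R u) = c * F u"
    and F_bounded: "\<And>u. u \<in> V \<Longrightarrow> \<bar>F u\<bar> \<le> C * N u"
  obtains r where "r \<in> V" "\<And>\<phi>. \<phi> \<in> V \<Longrightarrow> S \<phi> r = F \<phi>"
proof -
  define J where "J u = B u u - 2 * F u" for u
  have F_diff: "F (u - v) = F u - F v" if "u \<in> V" "v \<in> V" for u v
    using F_add[of u "- v"] F_scale[of v "- 1"] that by (simp add: V_minus)
  have lower: "- C\<^sup>2 \<le> J u" if "u \<in> V" for u
  proof -
    have "2 * F u \<le> 2 * C * N u" using F_bounded[OF that] by simp
    also have "\<dots> \<le> (N u)\<^sup>2 + C\<^sup>2" using sum_squares_bound[of "N u" C] by (simp add: mult.commute mult.left_commute)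
    finally show ?thesis using that by (simp add: J_def N_square)
  qed
  define m where "m = Inf (J ` V)"
  have bdd: "bdd_below (J ` V)" using lower by (intro bdd_belowI[of _ "- C\<^sup>2"]) auto
  have m_le: "m \<le> J u" if "u \<in> V" for u unfolding m_def using bdd that by (intro cInf_lower) auto
  have "\<exists>u\<in>V. J u < m + inverse (real (Suc n))" for n
  proof -
    have "Inf (J ` V) < m + inverse (real (Suc n))" by (simp add: m_def)
    then show ?thesis using cInf_less_iff[OF _ bdd] V_zero by auto
  qed
  then obtain X where X: "\<And>n. X n \<in> V" "\<And>n. J (X n) < m + inverse (real (Suc n))" by metis
  \<comment> \<open>The parallelogram identity for \<open>J\<close>, in which the linear parts
    cancel. The midpoint of two near-minimisers has value at least \<open>m\<close>, so the two are
    close to each other.\<close>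
  have par: "B (u - v) (u - v) = 2 * J u + 2 * J v - 4 * J ((1/2) *\<^sub>R (u + v))" if "u \<in> V" "v \<in> V" for u v
    using that by (simp add: J_def B_simps F_add F_scale algebra_simps)
  have "\<exists>M. \<forall>i\<ge>M. \<forall>j\<ge>M. B (X i - X j) (X i - X j) < \<epsilon>" if "\<epsilon> > 0" for \<epsilon>
  proof -
    obtain M where M: "inverse (real (Suc M)) < \<epsilon> / 4" using reals_Archimedean[of "\<epsilon> / 4"] \<open>\<epsilon> > 0\<close> by auto
    have X': "J (X i) < m + \<epsilon> / 4" if "i \<ge> M" for i
    proof -
      have "inverse (real (Suc i)) \<le> inverse (real (Suc M))" using that by (intro le_imp_inverse_le) auto
      then show ?thesis using X(2)[of i] M by linarith
    qed
    have "B (X i - X j) (X i - X j) < \<epsilon>" if "i \<ge> M" "j \<ge> M" for i j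
    proof -
      have "m \<le> J ((1/2) *\<^sub>R (X i + X j))" by (intro m_le V_closed X)
      then show ?thesis using par[OF X(1) X(1), of i j] X'[OF that(1)] X'[OF that(2)] by linarith
    qed
    then show ?thesis by blast
  qed
  from complete[OF X(1) this] obtain r where r: "r \<in> V" "(\<lambda>n. B (X n - r) (X n - r)) \<longlonglongrightarrow> 0" by blast
  have Nr: "(\<lambda>n. N (X n - r)) \<longlonglongrightarrow> 0"
    using tendsto_real_sqrt[OF r(2)] by (simp add: N_def)
  have J_lim: "(\<lambda>n. J (X n)) \<longlonglongrightarrow> J r"
  proof -
    have "J (X n) = J r + B (X n - r) (X n - r) + 2 * S (X n - r) r - 2 * F (X n - r)" for n
      using X(1)[of n] r(1) by (simp add: J_def B_simps S_def F_diff field_simps)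
    moreover have "(\<lambda>n. S (X n - r) r) \<longlonglongrightarrow> 0"
      by (rule Lim_null_comparison[OF _ tendsto_mult_left_zero[OF Nr, of "N r"]])
        (use S_Cauchy_Schwarz[OF V_diff[OF X(1) r(1)] r(1)] in auto)
    moreover have "(\<lambda>n. F (X n - r)) \<longlonglongrightarrow> 0"
      by (rule Lim_null_comparison[OF _ tendsto_mult_right_zero[OF Nr, of C]])
        (use F_bounded[OF V_diff[OF X(1) r(1)]] in auto)
    ultimately show ?thesis
      using tendsto_diff[OF tendsto_add[OF tendsto_add[OF tendsto_const[of "J r"] r(2)] tendsto_mult_right_zero[of "\<lambda>n. S (X n - r) r" _ 2]]
          tendsto_mult_right_zero[of "\<lambda>n. F (X n - r)" _ 2]] by simp
  qed
  have "J r \<le> m"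
  proof (rule LIMSEQ_le[OF J_lim])
    show "(\<lambda>n. m + inverse (real (Suc n))) \<longlonglongrightarrow> m"
      using tendsto_add[OF tendsto_const[of m] LIMSEQ_inverse_real_of_nat] by simp
    show "\<exists>N. \<forall>n\<ge>N. J (X n) \<le> m + inverse (real (Suc n))" using X(2) less_imp_le by blast
  qed
  then have min: "J r \<le> J u" if "u \<in> V" for u using m_le[OF that] by simp
  have "S \<phi> r = F \<phi>" if \<phi>: "\<phi> \<in> V" for \<phi>
  proof -
    \<comment> \<open>The variation of \<open>J\<close> at \<open>r\<close> in direction
      \<open>\<phi>\<close>, as a quadratic in \<open>t\<close> with constant term zero, so that the
      discriminant criterion makes the linear coefficient vanish.\<close>
    have "0 \<le> 0 - 2 * t * (F \<phi> - S \<phi> r) + t\<^sup>2 * B \<phi> \<phi>" for t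
    proof -
      have "J (r + t *\<^sub>R \<phi>) - J r = 0 - 2 * t * (F \<phi> - S \<phi> r) + t\<^sup>2 * B \<phi> \<phi>"
        using r(1) \<phi> by (simp add: J_def B_simps S_def F_add F_scale power2_eq_square algebra_simps)
      then show ?thesis using min[of "r + t *\<^sub>R \<phi>"] r(1) \<phi> by (simp add: V_closed)
    qed
    from quadratic_nonneg_imp[OF this nonneg[OF \<phi>]] show ?thesis by simp
  qed
  with r(1) show thesis by (rule that)
qed

lemma Lax_Milgram:
  fixes F :: "'v \<Rightarrow> real" and C :: real
  assumes F_add: "\<And>u v. u \<in> V \<Longrightarrow> v \<in> V \<Longrightarrow> F (u + v) = F u + F v"
    and F_scale: "\<And>c u. u \<in> V \<Longrightarrow> F (c *\<^sub>R u) = c * F u"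
    and F_bounded: "\<And>u. u \<in> V \<Longrightarrow> \<bar>F u\<bar> \<le> C * N u"
  obtains w where "w \<in> V" "\<And>\<phi>. \<phi> \<in> V \<Longrightarrow> B \<phi> w = F \<phi>"
proof -
  \<comment> \<open>The maximum with 1 ensures that \<open>1 / L\<^sup>2\<close> is at most one, so
    that the radicand of \<open>q\<close> below is nonnegative.\<close>
  define L where "L = max K 1"
  have L: "L \<ge> 1" "\<bar>B u v\<bar> \<le> L * N u * N v" if "u \<in> V" "v \<in> V" for u v
  proof -
    show "L \<ge> 1" by (simp add: L_def)
    have "\<bar>B u v\<bar> \<le> K * (N u * N v)" using bounded[OF that] by (simp add: N_def mult.assoc)
    also have "\<dots> \<le> L * (N u * N v)"
      using N_nonneg that by (intro mult_right_mono) (auto simp: L_def)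
    finally show "\<bar>B u v\<bar> \<le> L * N u * N v" by (simp add: mult.assoc)
  qed
  have L1: "L \<ge> 1" by (simp add: L_def)
  \<comment> \<open>\<open>T u\<close> represents the residual \<open>F - B(\<cdot>, u)\<close>; the map \<open>u \<mapsto> u + \<rho> T u\<close> is a contraction.\<close>
  have "\<exists>r\<in>V. \<forall>\<phi>\<in>V. S \<phi> r = F \<phi> - B \<phi> u" if u: "u \<in> V" for u
  proof -
    have b: "\<bar>F v - B v u\<bar> \<le> (C + L * N u) * N v" if "v \<in> V" for v
      using F_bounded[OF that] L(2)[OF that u] by (simp add: algebra_simps)
    obtain r where "r \<in> V" "\<And>\<phi>. \<phi> \<in> V \<Longrightarrow> S \<phi> r = F \<phi> - B \<phi> u"
      by (rule Riesz[of "\<lambda>\<phi>. F \<phi> - B \<phi> u" "C + L * N u"])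
        (use u b in \<open>auto simp: F_add F_scale B_simps algebra_simps\<close>)
    then show ?thesis by blast
  qed
  then obtain T where T: "\<And>u. u \<in> V \<Longrightarrow> T u \<in> V" "\<And>u \<phi>. u \<in> V \<Longrightarrow> \<phi> \<in> V \<Longrightarrow> S \<phi> (T u) = F \<phi> - B \<phi> u"
    by metis
  \<comment> \<open>This value minimises the factor
    \<open>1 - 2 * \<rho> + \<rho>\<^sup>2 * L\<^sup>2\<close> by which the squared norm contracts;
    the minimum is \<open>1 - \<rho>\<close>, the square of \<open>q\<close>.\<close>
  define \<rho> where "\<rho> = 1 / L\<^sup>2"
  define G where "G u = u + \<rho> *\<^sub>R T u" for u
  define q where "q = sqrt (1 - \<rho>)"
  have \<rho>: "0 < \<rho>" "\<rho> \<le> 1" using L1 by (auto simp: \<rho>_def one_le_power)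
  have q: "0 \<le> q" "q < 1" using \<rho> by (auto simp: q_def)
  have GV: "G u \<in> V" if "u \<in> V" for u using that T(1) by (simp add: G_def V_closed)
  have contr: "N (G u - G v) \<le> q * N (u - v)" if u: "u \<in> V" and v: "v \<in> V" for u v
  proof -
    define d where "d = u - v"
    define e where "e = T u - T v"
    have d: "d \<in> V" and e: "e \<in> V" using u v T(1) by (auto simp: d_def e_def V_closed)
    have Se: "S \<phi> e = - B \<phi> d" if "\<phi> \<in> V" for \<phi>
    proof -
      have "S \<phi> e = S \<phi> (T u) - S \<phi> (T v)"
        using that T(1)[OF u] T(1)[OF v] by (simp add: S_def e_def B_simps field_simps)
      then show ?thesis using T(2)[OF u that] T(2)[OF v that] that u v by (simp add: d_def B_simps)
    qed
    \<comment> \<open>The relation \<open>Se\<close> is tested with \<open>e\<close> itself, and one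
      factor \<open>N e\<close> is cancelled.\<close>
    have Ne: "N e \<le> L * N d"
    proof -
      have "(N e)\<^sup>2 = - B e d" using Se[OF e] by (simp add: N_square e S_self)
      also have "\<dots> \<le> L * N e * N d" using L(2)[OF e d] by simp
      finally have "N e * N e \<le> N e * (L * N d)" by (simp add: power2_eq_square mult_ac)
      then show ?thesis
        using N_nonneg[OF e] N_nonneg[OF d] L1 by (cases "N e = 0") (auto simp: mult_le_cancel_left)
    qed
    have "(N (G u - G v))\<^sup>2 = (N (d + \<rho> *\<^sub>R e))\<^sup>2"
      by (simp add: G_def d_def e_def algebra_simps)
    also have "\<dots> = (N d)\<^sup>2 + 2 * \<rho> * S d e + \<rho>\<^sup>2 * (N e)\<^sup>2"
      using d e by (simp add: N_square B_simps S_def power2_eq_square[of \<rho>] field_simps)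
    also have "\<dots> = (N d)\<^sup>2 - 2 * \<rho> * (N d)\<^sup>2 + \<rho>\<^sup>2 * (N e)\<^sup>2" using Se[OF d] d by (simp add: N_square)
    also have "\<rho>\<^sup>2 * (N e)\<^sup>2 \<le> \<rho>\<^sup>2 * (L * N d)\<^sup>2"
      using Ne N_nonneg[OF e] by (intro mult_left_mono power_mono) auto
    also have "\<rho>\<^sup>2 * (L * N d)\<^sup>2 = \<rho> * (N d)\<^sup>2" using L1 by (simp add: \<rho>_def power2_eq_square field_simps)
    finally have "(N (G u - G v))\<^sup>2 \<le> (1 - \<rho>) * (N d)\<^sup>2" by (simp add: algebra_simps)
    also have "\<dots> = (q * N d)\<^sup>2" using \<rho> by (simp add: q_def power_mult_distrib)
    finally have "N (G u - G v) \<le> q * N d"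
      by (rule power2_le_imp_le) (intro mult_nonneg_nonneg q(1) N_nonneg[OF d])
    then show ?thesis by (simp only: d_def)
  qed
  define X where "X n = (G ^^ n) 0" for n
  have X: "X n \<in> V" for n by (induction n) (auto simp: X_def V_zero GV)
  have step: "N (X (Suc n) - X n) \<le> q ^ n * N (X 1 - X 0)" for n
  proof (induction n)
    case (Suc n)
    have "N (X (Suc (Suc n)) - X (Suc n)) \<le> q * N (X (Suc n) - X n)"
      using contr[OF X X, of "Suc n" n] by (simp add: X_def)
    also have "\<dots> \<le> q * (q ^ n * N (X 1 - X 0))" using Suc q by (intro mult_left_mono) auto
    finally show ?case by (simp add: mult.assoc)
  qed simp
  define D where "D = N (X 1 - X 0)"
  have D: "D \<ge> 0" unfolding D_def by (intro N_nonneg V_closed X)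
  have tail: "N (X (n + k) - X n) \<le> q ^ n * D / (1 - q)" for n k
  proof -
    \<comment> \<open>The partial geometric sum is carried exactly through the induction on
      \<open>k\<close>; the factor \<open>1 - q ^ k\<close> is estimated by one afterwards.\<close>
    have "N (X (n + k) - X n) \<le> q ^ n * D * (1 - q ^ k) / (1 - q)"
    proof (induction k)
      case 0
      have "B 0 0 = 0" using scale_left[OF V_zero V_zero, of 0] by simp
      then show ?case by (simp add: N_def)
    next
      case (Suc k)
      have "N (X (n + Suc k) - X n) = N ((X (Suc (n + k)) - X (n + k)) + (X (n + k) - X n))" by simp
      also have "\<dots> \<le> N (X (Suc (n + k)) - X (n + k)) + N (X (n + k) - X n)"
        by (intro N_triangle V_closed X)
      also have "\<dots> \<le> q ^ (n + k) * D + q ^ n * D * (1 - q ^ k) / (1 - q)"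
        using step[of "n + k"] Suc by (simp add: D_def)
      also have "\<dots> = q ^ n * D * (1 - q ^ Suc k) / (1 - q)"
        using q by (simp add: power_add field_simps)
      finally show ?case .
    qed
    also have "\<dots> \<le> q ^ n * D * 1 / (1 - q)" using q D by (intro divide_right_mono mult_left_mono) auto
    finally show ?thesis by simp
  qed
  have tail0: "(\<lambda>n. q ^ n * D / (1 - q)) \<longlonglongrightarrow> 0"
    using tendsto_divide_zero[OF tendsto_mult_left_zero[OF LIMSEQ_realpow_zero[OF q]]] .
  have "\<exists>M. \<forall>m\<ge>M. \<forall>n\<ge>M. N (X m - X n) < \<epsilon>" if "\<epsilon> > 0" for \<epsilon>
  proof -
    obtain M where M: "q ^ M * D / (1 - q) < \<epsilon> / 2"
    proof -
      obtain M where "norm (q ^ M * D / (1 - q) - 0) < \<epsilon> / 2"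
        using LIMSEQ_D[OF tail0, of "\<epsilon> / 2"] \<open>\<epsilon> > 0\<close> half_gt_zero[of \<epsilon>] by blast
      then have "\<bar>q ^ M * D / (1 - q)\<bar> < \<epsilon> / 2" by simp
      from le_less_trans[OF abs_ge_self this] show thesis by (rule that)
    qed
    have "N (X m - X n) < \<epsilon>" if "m \<ge> M" "n \<ge> M" for m n
    proof -
      have "N (X m - X n) = N ((X m - X M) - (X n - X M))" by simp
      also have "\<dots> \<le> N (X m - X M) + N (X n - X M)" by (intro N_triangle_diff V_closed X)
      also have "\<dots> < \<epsilon> / 2 + \<epsilon> / 2"
      proof (rule add_strict_mono)
        show "N (X m - X M) < \<epsilon> / 2" "N (X n - X M) < \<epsilon> / 2"
          using le_less_trans[OF tail[of M "m - M"] M] le_less_trans[OF tail[of M "n - M"] M] that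
          by simp_all
      qed
      finally show ?thesis by simp
    qed
    then show ?thesis by blast
  qed
  from N_complete[OF X this] obtain w where w: "w \<in> V" "(\<lambda>n. N (X n - w)) \<longlonglongrightarrow> 0" by blast
  \<comment> \<open>The limit of the iteration is a fixed point of \<open>G\<close>, so
    \<open>T w\<close> has norm zero, and Cauchy--Schwarz then makes the residual that it represents
    vanish.\<close>
  have "N (G w - w) \<le> 0"
  proof (rule LIMSEQ_le_const)
    show "(\<lambda>n. N (X n - w) + N (X (Suc n) - w)) \<longlonglongrightarrow> 0"
      using tendsto_add[OF w(2) LIMSEQ_Suc[OF w(2)]] by simp
    have "N (G w - w) \<le> N (X n - w) + N (X (Suc n) - w)" for n
    proof -
      have "N (G w - w) = N ((X (Suc n) - w) - (G (X n) - G w))" by (simp add: X_def)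
      also have "\<dots> \<le> N (X (Suc n) - w) + N (G (X n) - G w)" by (intro N_triangle_diff V_closed X GV w(1))
      also have "N (G (X n) - G w) \<le> q * N (X n - w)" by (rule contr[OF X w(1)])
      also have "\<dots> \<le> 1 * N (X n - w)" using q by (intro mult_right_mono N_nonneg V_closed X w(1)) auto
      finally show ?thesis by simp
    qed
    then show "\<exists>M. \<forall>n\<ge>M. N (G w - w) \<le> N (X n - w) + N (X (Suc n) - w)" by blast
  qed
  then have "N (T w) \<le> 0" using N_scale[OF T(1)[OF w(1)], of \<rho>] \<rho> by (simp add: G_def mult_le_0_iff)
  have "B \<phi> w = F \<phi>" if \<phi>: "\<phi> \<in> V" for \<phi>
  proof -
    have "\<bar>S \<phi> (T w)\<bar> \<le> N \<phi> * N (T w)" by (rule S_Cauchy_Schwarz[OF \<phi> T(1)[OF w(1)]])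
    also have "\<dots> \<le> 0" using \<open>N (T w) \<le> 0\<close> N_nonneg[OF \<phi>] by (simp add: mult_nonneg_nonpos)
    finally show ?thesis using T(2)[OF w(1) \<phi>] by simp
  qed
  with w(1) show thesis by (rule that)
qed

end

section \<open>Bounded forms and the exterior problem\<close>

lemma bounded_form_bound:
  assumes "bounded_form s B"
  shows "\<exists>C\<ge>0. \<forall>u\<in>Hs s. \<forall>v\<in>Hs s. \<bar>B u v\<bar> \<le> C * Hs_norm s u * Hs_norm s v"
proof -
  obtain C where C: "\<And>u v. u \<in> Hs s \<Longrightarrow> v \<in> Hs s \<Longrightarrow> \<bar>B u v\<bar> \<le> C * Hs_norm s u * Hs_norm s v"
    using assms unfolding bounded_form_def by blast
  have "\<bar>B u v\<bar> \<le> \<bar>C\<bar> * Hs_norm s u * Hs_norm s v" if "u \<in> Hs s" "v \<in> Hs s" for u v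
    using C[OF that]
    by (rule order_trans) (intro mult_right_mono Hs_norm_nonneg abs_ge_self)
  then show ?thesis by (intro exI[of _ "\<bar>C\<bar>"]) auto
qed

lemma
  assumes "bounded_form s B" "u \<in> Hs s" "v \<in> Hs s" "w \<in> Hs s"
  shows form_add_left: "B (u + v) w = B u w + B v w"
    and form_add_right: "B w (u + v) = B w u + B w v"
  using assms by (auto simp: bounded_form_def)

lemma
  assumes "bounded_form s B" "u \<in> Hs s" "v \<in> Hs s"
  shows form_scale_left: "B (c *\<^sub>R u) v = c * B u v"
    and form_scale_right: "B u (c *\<^sub>R v) = c * B u v"
  using assms by (auto simp: bounded_form_def)

lemma form_diff_left:
  assumes "bounded_form s B" "u \<in> Hs s" "v \<in> Hs s" "w \<in> Hs s"
  shows "B (u - v) w = B u w - B v w"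
  using form_add_left[OF assms(1), of "u - v" v w] assms by (simp add: Hs_diff)

lemma form_diff_right:
  assumes "bounded_form s B" "u \<in> Hs s" "v \<in> Hs s" "w \<in> Hs s"
  shows "B w (u - v) = B w u - B w v"
  using form_add_right[OF assms(1), of "u - v" v w] assms by (simp add: Hs_diff)

lemma bounded_form_swap:
  assumes B: "bounded_form s B" shows "bounded_form s (\<lambda>u v. B v u)"
proof -
  obtain C where C_nonneg: "C \<ge> 0" and C: "\<And>u v. u \<in> Hs s \<Longrightarrow> v \<in> Hs s \<Longrightarrow> \<bar>B u v\<bar> \<le> C * Hs_norm s u * Hs_norm s v"
    using bounded_form_bound[OF B] by blast
  have "\<bar>B v u\<bar> \<le> C * Hs_norm s u * Hs_norm s v" if "u \<in> Hs s" "v \<in> Hs s" for u v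
    using C[OF that(2,1)] by (simp add: mult.commute mult.left_commute)
  then have "\<exists>C. \<forall>u\<in>Hs s. \<forall>v\<in>Hs s. \<bar>B v u\<bar> \<le> C * Hs_norm s u * Hs_norm s v" by blast
  with B show ?thesis unfolding bounded_form_def by blast
qed

lemma bounded_form_lincomb:
  assumes A: "bounded_form s A" and B: "bounded_form s B"
  shows "bounded_form s (\<lambda>u v. A u v + c * B u v)"
proof -
  obtain a where a_nonneg: "a \<ge> 0" and a: "\<And>u v. u \<in> Hs s \<Longrightarrow> v \<in> Hs s \<Longrightarrow> \<bar>A u v\<bar> \<le> a * Hs_norm s u * Hs_norm s v"
    using bounded_form_bound[OF A] by blast
  obtain b where b_nonneg: "b \<ge> 0" and b: "\<And>u v. u \<in> Hs s \<Longrightarrow> v \<in> Hs s \<Longrightarrow> \<bar>B u v\<bar> \<le> b * Hs_norm s u * Hs_norm s v"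
    using bounded_form_bound[OF B] by blast
  have "\<bar>A u v + c * B u v\<bar> \<le> (a + \<bar>c\<bar> * b) * Hs_norm s u * Hs_norm s v" if "u \<in> Hs s" "v \<in> Hs s" for u v
  proof -
    have "\<bar>A u v + c * B u v\<bar> \<le> \<bar>A u v\<bar> + \<bar>c\<bar> * \<bar>B u v\<bar>"
      using abs_triangle_ineq[of "A u v" "c * B u v"] by (simp add: abs_mult)
    also have "\<dots> \<le> a * Hs_norm s u * Hs_norm s v + \<bar>c\<bar> * (b * Hs_norm s u * Hs_norm s v)"
      by (intro add_mono mult_left_mono a b that) auto
    finally show ?thesis by (simp only: distrib_right mult.assoc)
  qed
  then have bound: "\<exists>C. \<forall>u\<in>Hs s. \<forall>v\<in>Hs s. \<bar>A u v + c * B u v\<bar> \<le> C * Hs_norm s u * Hs_norm s v"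
    by (intro exI[of _ "a + \<bar>c\<bar> * b"] ballI)
  show ?thesis
    unfolding bounded_form_def
    by (intro conjI ballI allI bound)
      (simp_all add: form_add_left[OF A] form_add_left[OF B] form_add_right[OF A] form_add_right[OF B]
        form_scale_left[OF A] form_scale_left[OF B] form_scale_right[OF A] form_scale_right[OF B] distrib_left)
qed

lemma bounded_form_add: "bounded_form s A \<Longrightarrow> bounded_form s B \<Longrightarrow> bounded_form s (\<lambda>u v. A u v + B u v)"
  using bounded_form_lincomb[of s A B 1] by simp

lemma bounded_form_diff: "bounded_form s A \<Longrightarrow> bounded_form s B \<Longrightarrow> bounded_form s (\<lambda>u v. A u v - B u v)"
  using bounded_form_lincomb[of s A B "- 1"] by simp

lemma coercive_on_swap: "coercive_on s \<Omega> B \<Longrightarrow> coercive_on s \<Omega> (\<lambda>u v. B v u)"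
  by (simp add: coercive_on_def)

lemma coercive_zero:
  assumes "coercive_on s \<Omega> B" "w \<in> Hs_tilde s \<Omega>" "B w w = 0"
  shows "w = 0"
proof -
  obtain c where "c > 0" "c * (Hs_norm s w)\<^sup>2 \<le> B w w" using assms by (auto simp: coercive_on_def)
  then have "Hs_norm s w = 0" using assms(3) by (simp add: mult_le_0_iff)
  then show ?thesis using Hs_norm_zero_imp Hs_tilde_Hs[OF assms(2)] by blast
qed

text \<open>On \<open>Hs_tilde s \<Omega>\<close>, coercivity and boundedness make
  \<open>sqrt (B u u)\<close> equivalent to \<open>Hs_norm s\<close>, so completeness transfers to
  the energy norm. The constant \<open>K / c\<close> arises from replacing each of two norms by
  \<open>sqrt (B u u) / sqrt c\<close>.\<close>

lemma Hs_tilde_Lax_Milgram: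
  fixes F :: "'a::euclidean_space tempered \<Rightarrow> real"
  assumes B: "bounded_form s B" and coer: "coercive_on s \<Omega> B"
    and F_add: "\<And>u v. u \<in> Hs_tilde s \<Omega> \<Longrightarrow> v \<in> Hs_tilde s \<Omega> \<Longrightarrow> F (u + v) = F u + F v"
    and F_scale: "\<And>c u. u \<in> Hs_tilde s \<Omega> \<Longrightarrow> F (c *\<^sub>R u) = c * F u"
    and F_bounded: "\<And>u. u \<in> Hs_tilde s \<Omega> \<Longrightarrow> \<bar>F u\<bar> \<le> C * Hs_norm s u" and "0 \<le> C"
  obtains w where "w \<in> Hs_tilde s \<Omega>" "\<And>\<phi>. \<phi> \<in> Hs_tilde s \<Omega> \<Longrightarrow> B \<phi> w = F \<phi>"
proof -
  let ?V = "Hs_tilde s \<Omega>"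
  obtain c where c: "c > 0" "\<And>u. u \<in> ?V \<Longrightarrow> c * (Hs_norm s u)\<^sup>2 \<le> B u u"
    using coer by (auto simp: coercive_on_def)
  obtain K where K: "K \<ge> 0" "\<And>u v. u \<in> Hs s \<Longrightarrow> v \<in> Hs s \<Longrightarrow> \<bar>B u v\<bar> \<le> K * Hs_norm s u * Hs_norm s v"
    using bounded_form_bound[OF B] by blast
  have le: "Hs_norm s u \<le> sqrt (B u u) / sqrt c" if "u \<in> ?V" for u
  proof -
    have "(Hs_norm s u)\<^sup>2 \<le> B u u / c" using c(1) c(2)[OF that] by (simp add: field_simps)
    then have "Hs_norm s u \<le> sqrt (B u u / c)" by (rule real_le_rsqrt)
    then show ?thesis by (simp add: real_sqrt_divide)
  qed
  have nn: "0 \<le> B u u" if "u \<in> ?V" for u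
  proof -
    have "0 \<le> c * (Hs_norm s u)\<^sup>2" using c(1) by simp
    then show ?thesis using c(2)[OF that] by linarith
  qed
  interpret coercive_form ?V B "K / c"
  proof
    show "\<bar>B u v\<bar> \<le> K / c * sqrt (B u u) * sqrt (B v v)" if "u \<in> ?V" "v \<in> ?V" for u v
    proof -
      have "\<bar>B u v\<bar> \<le> K * Hs_norm s u * Hs_norm s v" using that by (intro K(2) Hs_tilde_Hs)
      also have "\<dots> \<le> K * (sqrt (B u u) / sqrt c) * (sqrt (B v v) / sqrt c)"
        using K(1) nn that c(1) by (intro mult_mono mult_left_mono le) (auto simp: Hs_norm_nonneg)
      also have "\<dots> = K / c * sqrt (B u u) * sqrt (B v v)" using c(1) by (simp add: field_simps)
      finally show ?thesis .
    qed
    show "\<exists>x\<in>?V. (\<lambda>n. B (X n - x) (X n - x)) \<longlonglongrightarrow> 0"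
      if X: "\<And>n. X n \<in> ?V"
        and cauchy: "\<And>\<epsilon>. \<epsilon> > 0 \<Longrightarrow> \<exists>M. \<forall>m\<ge>M. \<forall>n\<ge>M. B (X m - X n) (X m - X n) < \<epsilon>" for X
    proof -
      have "\<exists>M. \<forall>m\<ge>M. \<forall>n\<ge>M. Hs_norm s (X m - X n) < \<epsilon>" if "\<epsilon> > 0" for \<epsilon>
      proof -
        have "c * \<epsilon>\<^sup>2 > 0" using c(1) that by simp
        from cauchy[OF this] obtain M where M: "\<And>m n. m \<ge> M \<Longrightarrow> n \<ge> M \<Longrightarrow> B (X m - X n) (X m - X n) < c * \<epsilon>\<^sup>2"
          by blast
        have "Hs_norm s (X m - X n) < \<epsilon>" if "m \<ge> M" "n \<ge> M" for m n
        proof -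
          have "c * (Hs_norm s (X m - X n))\<^sup>2 < c * \<epsilon>\<^sup>2"
            using c(2)[OF Hs_tilde_diff[OF X X], of m n] M[OF that] by (rule le_less_trans)
          then have "(Hs_norm s (X m - X n))\<^sup>2 < \<epsilon>\<^sup>2" using c(1) by simp
          then show ?thesis by (rule power2_less_imp_less) (use \<open>\<epsilon> > 0\<close> in simp)
        qed
        then show ?thesis by blast
      qed
      from Hs_complete[OF Hs_tilde_Hs[OF X] this] obtain x
        where x: "x \<in> Hs s" "(\<lambda>n. Hs_norm s (X n - x)) \<longlonglongrightarrow> 0" by blast
      have xV: "x \<in> ?V" by (rule Hs_tilde_closed[OF X x])
      have "(\<lambda>n. B (X n - x) (X n - x)) \<longlonglongrightarrow> 0"
      proof (rule Lim_null_comparison)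
        show "\<forall>\<^sub>F n in sequentially. norm (B (X n - x) (X n - x)) \<le> K * (Hs_norm s (X n - x) * Hs_norm s (X n - x))"
          using K(2) Hs_diff(1)[OF Hs_tilde_Hs[OF X] x(1)] by (simp add: mult.assoc)
        show "(\<lambda>n. K * (Hs_norm s (X n - x) * Hs_norm s (X n - x))) \<longlonglongrightarrow> 0"
          by (intro tendsto_mult_right_zero tendsto_mult_zero x(2))
      qed
      then show ?thesis using xV by blast
    qed
  qed (use nn in \<open>auto intro: Hs_tilde_add Hs_tilde_scale Hs_tilde_0 form_add_left[OF B] form_add_right[OF B]
      form_scale_left[OF B] form_scale_right[OF B] Hs_tilde_Hs\<close>)
  have "\<bar>F u\<bar> \<le> C / sqrt c * N u" if "u \<in> ?V" for u
  proof -
    have "\<bar>F u\<bar> \<le> C * (sqrt (B u u) / sqrt c)"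
      using order_trans[OF F_bounded[OF that] mult_left_mono[OF le[OF that] \<open>0 \<le> C\<close>]] .
    then show ?thesis by (simp add: N_def)
  qed
  from Lax_Milgram[OF F_add F_scale this] that show thesis by blast
qed

text \<open>Writing \<open>u = f + w\<close> leaves the equation
  \<open>B w \<phi> = - B f \<phi>\<close> for a correction \<open>w\<close> in
  \<open>Hs_tilde s \<Omega>\<close>. Here the unknown sits in the first argument, whereas
  \<open>Hs_tilde_Lax_Milgram\<close> puts it in the second; hence the swapped form. Uniqueness is
  coercivity applied to the difference of two solutions.\<close>

lemma exterior_solution_ex1:
  fixes B :: "'a::euclidean_space form"
  assumes B: "bounded_form s B" and coer: "coercive_on s \<Omega> B" and f: "f \<in> Hs s"
  shows "\<exists>!u. u \<in> Hs s \<and> u - f \<in> Hs_tilde s \<Omega> \<and> (\<forall>\<phi>\<in>Hs_tilde s \<Omega>. B u \<phi> = 0)"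
proof (rule ex_ex1I)
  obtain K where K: "K \<ge> 0" "\<And>u v. u \<in> Hs s \<Longrightarrow> v \<in> Hs s \<Longrightarrow> \<bar>B u v\<bar> \<le> K * Hs_norm s u * Hs_norm s v"
    using bounded_form_bound[OF B] by blast
  obtain w where w: "w \<in> Hs_tilde s \<Omega>" "\<And>\<phi>. \<phi> \<in> Hs_tilde s \<Omega> \<Longrightarrow> B w \<phi> = - B f \<phi>"
  proof (rule Hs_tilde_Lax_Milgram[OF bounded_form_swap[OF B] coercive_on_swap[OF coer],
        of "\<lambda>\<phi>. - B f \<phi>" "K * Hs_norm s f"])
    show "\<bar>- B f u\<bar> \<le> K * Hs_norm s f * Hs_norm s u" if "u \<in> Hs_tilde s \<Omega>" for u
      using K(2)[OF f Hs_tilde_Hs[OF that]] by simp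
  qed (use K f in \<open>auto simp: Hs_norm_nonneg form_add_right[OF B] form_scale_right[OF B] Hs_tilde_Hs\<close>)
  show "\<exists>u. u \<in> Hs s \<and> u - f \<in> Hs_tilde s \<Omega> \<and> (\<forall>\<phi>\<in>Hs_tilde s \<Omega>. B u \<phi> = 0)"
    using w f by (intro exI[of _ "f + w"]) (simp add: Hs_add Hs_tilde_Hs form_add_left[OF B])
  fix u v
  assume u: "u \<in> Hs s \<and> u - f \<in> Hs_tilde s \<Omega> \<and> (\<forall>\<phi>\<in>Hs_tilde s \<Omega>. B u \<phi> = 0)"
    and v: "v \<in> Hs s \<and> v - f \<in> Hs_tilde s \<Omega> \<and> (\<forall>\<phi>\<in>Hs_tilde s \<Omega>. B v \<phi> = 0)"
  have d: "u - v \<in> Hs_tilde s \<Omega>" using Hs_tilde_diff[of "u - f" s \<Omega> "v - f"] u v by simp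
  have "B (u - v) (u - v) = 0"
    using form_diff_left[OF B, of u v "u - v"] u v d by (simp add: Hs_diff)
  from coercive_zero[OF coer d this] show "u = v" by simp
qed

lemma
  assumes "bounded_form s B" "coercive_on s \<Omega> B" "f \<in> Hs s"
  shows exterior_solution_Hs: "exterior_solution s \<Omega> B f \<in> Hs s"
    and exterior_solution_diff: "exterior_solution s \<Omega> B f - f \<in> Hs_tilde s \<Omega>"
    and exterior_solution_eq: "\<phi> \<in> Hs_tilde s \<Omega> \<Longrightarrow> B (exterior_solution s \<Omega> B f) \<phi> = 0"
  using theI'[OF exterior_solution_ex1[OF assms]] unfolding exterior_solution_def by auto

text \<open>Changing \<open>f\<close> within its class does not alter the problem that defines the
  solution. Changing \<open>g\<close> alters the value by \<open>B\<close> of the solution against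
  an element of \<open>Hs_tilde s \<Omega>\<close>, which is zero. The union in
  \<open>DN_map\<close> thus collapses to a singleton.\<close>

lemma DN_map_eq:
  assumes B: "bounded_form s B" and coer: "coercive_on s \<Omega> B" and f: "f \<in> Hs s" and g: "g \<in> Hs s"
  shows "DN_map s \<Omega> B (ext_class s \<Omega> f) (ext_class s \<Omega> g) = B (exterior_solution s \<Omega> B f) g"
proof -
  let ?u = "exterior_solution s \<Omega> B f"
  have 1: "exterior_solution s \<Omega> B f' = ?u" if "f' \<in> ext_class s \<Omega> f" for f'
  proof -
    have d: "f' - f \<in> Hs_tilde s \<Omega>" using that by (simp add: ext_class_def)
    have "u - f' \<in> Hs_tilde s \<Omega> \<longleftrightarrow> u - f \<in> Hs_tilde s \<Omega>" for u
      using Hs_tilde_add[OF _ d, of "u - f'"] Hs_tilde_diff[OF _ d, of "u - f"] by auto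
    then show ?thesis by (simp add: exterior_solution_def)
  qed
  have 2: "B ?u g' = B ?u g" if "g' \<in> ext_class s \<Omega> g" for g'
    using that exterior_solution_eq[OF B coer f, of "g' - g"] form_diff_right[OF B, of g' g ?u]
      exterior_solution_Hs[OF B coer f] g by (simp add: ext_class_def)
  have "f \<in> ext_class s \<Omega> f" "g \<in> ext_class s \<Omega> g"
    using f g by (auto simp: ext_class_def Hs_tilde_0)
  then have ne: "ext_class s \<Omega> f \<noteq> {}" "ext_class s \<Omega> g \<noteq> {}" by auto
  have "(\<Union>f'\<in>ext_class s \<Omega> f. \<Union>g'\<in>ext_class s \<Omega> g. {B (exterior_solution s \<Omega> B f') g'}) =
      (\<Union>f'\<in>ext_class s \<Omega> f. \<Union>g'\<in>ext_class s \<Omega> g. {B ?u g})"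
    by (intro SUP_cong refl) (simp only: 1 2)
  also have "\<dots> = {B ?u g}" using ne by simp
  finally show ?thesis by (simp add: DN_map_def)
qed

section \<open>The integral identity and the Runge argument\<close>

text \<open>The datum \<open>g\<close> may be replaced by the adjoint solution \<open>w\<close> in
  both DN values, because \<open>w - g\<close> is an admissible test element. The solutions
  \<open>u\<close> and \<open>v\<close> share the datum \<open>f\<close>, so the adjoint equation
  gives \<open>B2 u w = B2 v w\<close>; the difference is then taken at the single pair
  \<open>u\<close>, \<open>w\<close>, where \<open>L\<close> cancels.\<close>

lemma Alessandrini_identity:
  fixes L q1 q2 :: "'a::euclidean_space form"
  defines "B1 \<equiv> \<lambda>u v. L u v + q1 u v" and "B2 \<equiv> \<lambda>u v. L u v + q2 u v"
  assumes L: "bounded_form s L" and q1: "bounded_form s q1" and q2: "bounded_form s q2"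
    and c1: "coercive_on s \<Omega> B1" and c2: "coercive_on s \<Omega> B2"
    and f: "f \<in> Hs s" and g: "g \<in> Hs s"
  shows "DN_map s \<Omega> B1 (ext_class s \<Omega> f) (ext_class s \<Omega> g) - DN_map s \<Omega> B2 (ext_class s \<Omega> f) (ext_class s \<Omega> g) =
    q1 (exterior_solution s \<Omega> B1 f) (exterior_solution s \<Omega> (\<lambda>u v. B2 v u) g) -
    q2 (exterior_solution s \<Omega> B1 f) (exterior_solution s \<Omega> (\<lambda>u v. B2 v u) g)"
proof -
  have B1: "bounded_form s B1" and B2: "bounded_form s B2"
    unfolding B1_def B2_def by (rule bounded_form_add[OF L q1], rule bounded_form_add[OF L q2])
  note B2t = bounded_form_swap[OF B2] and c2t = coercive_on_swap[OF c2]
  define u where "u = exterior_solution s \<Omega> B1 f"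
  define v where "v = exterior_solution s \<Omega> B2 f"
  define w where "w = exterior_solution s \<Omega> (\<lambda>u v. B2 v u) g"
  have u: "u \<in> Hs s" "u - f \<in> Hs_tilde s \<Omega>" "\<And>\<phi>. \<phi> \<in> Hs_tilde s \<Omega> \<Longrightarrow> B1 u \<phi> = 0"
    unfolding u_def using exterior_solution_Hs[OF B1 c1 f] exterior_solution_diff[OF B1 c1 f]
      exterior_solution_eq[OF B1 c1 f] by blast+
  have v: "v \<in> Hs s" "v - f \<in> Hs_tilde s \<Omega>" "\<And>\<phi>. \<phi> \<in> Hs_tilde s \<Omega> \<Longrightarrow> B2 v \<phi> = 0"
    unfolding v_def using exterior_solution_Hs[OF B2 c2 f] exterior_solution_diff[OF B2 c2 f]
      exterior_solution_eq[OF B2 c2 f] by blast+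
  have w: "w \<in> Hs s" "w - g \<in> Hs_tilde s \<Omega>" "\<And>\<phi>. \<phi> \<in> Hs_tilde s \<Omega> \<Longrightarrow> B2 \<phi> w = 0"
    unfolding w_def using exterior_solution_Hs[OF B2t c2t g] exterior_solution_diff[OF B2t c2t g]
      exterior_solution_eq[OF B2t c2t g] by blast+
  have "B1 u w = B1 u g" using form_diff_right[OF B1 w(1) g u(1)] u(3)[OF w(2)] by simp
  moreover have "B2 v w = B2 v g" using form_diff_right[OF B2 w(1) g v(1)] v(3)[OF w(2)] by simp
  moreover have "B2 v w = B2 f w" using form_diff_left[OF B2 v(1) f w(1)] w(3)[OF v(2)] by simp
  moreover have "B2 u w = B2 f w" using form_diff_left[OF B2 u(1) f w(1)] w(3)[OF u(2)] by simp
  ultimately have "B1 u g - B2 v g = q1 u w - q2 u w" by (simp add: B1_def B2_def)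
  then show ?thesis
    unfolding DN_map_eq[OF B1 c1 f g] DN_map_eq[OF B2 c2 f g] by (simp add: u_def v_def w_def)
qed

lemma distr_support_test_subset:
  assumes f: "f \<in> test_functions U" shows "distr_support (distr_of_fun f) \<subseteq> U"
proof -
  have "closure {x. f x \<noteq> 0} \<subseteq> U" using f by (simp add: test_functions_def)
  with distr_support_test[OF f] show ?thesis by (rule subset_trans)
qed

text \<open>An element of \<open>Hs_tilde s \<Omega>\<close> is supported in the closure of
  \<open>\<Omega>\<close> and the test function in the exterior, so locality applies in either
  order.\<close>

lemma local_form_exterior:
  assumes q: "local_form s q" and w: "w \<in> Hs_tilde s \<Omega>" and f: "f \<in> test_functions V"
    and V: "V \<subseteq> - closure \<Omega>"
  shows "q w (distr_of_fun f) = 0" "q (distr_of_fun f) w = 0"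
proof -
  have "distr_support (distr_of_fun f) \<subseteq> V"
    by (rule distr_support_test_subset[OF f])
  then have "distr_support w \<inter> distr_support (distr_of_fun f) = {}"
    using Hs_tilde_support[OF w] V by blast
  then show "q w (distr_of_fun f) = 0" "q (distr_of_fun f) w = 0"
    using q Hs_tilde_Hs[OF w] Hs_test[OF f] by (auto simp: local_form_def Int_commute)
qed

text \<open>Runge approximation in dual form: a bounded functional \<open>F\<close> on \<open>Hs_tilde s \<Omega>\<close> is
  \<open>B(\<cdot>, w)\<close> for some \<open>w\<close>; if it kills all \<open>u\<^sub>f - f\<close>, then \<open>B(f, w) = L(f, w) = 0\<close>, and the UCP gives \<open>w = 0\<close>.\<close>

lemma Runge:
  fixes L q :: "'a::euclidean_space form" and F :: "'a tempered \<Rightarrow> real"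
  defines "B \<equiv> \<lambda>u v. L u v + q u v"
  assumes L: "bounded_form s L" and q: "bounded_form s q" and loc: "local_form s q"
    and coer: "coercive_on s \<Omega> B" and W: "W \<subseteq> - closure \<Omega>" and ucp: "right_UCP s L W"
    and F_add: "\<And>u v. u \<in> Hs_tilde s \<Omega> \<Longrightarrow> v \<in> Hs_tilde s \<Omega> \<Longrightarrow> F (u + v) = F u + F v"
    and F_scale: "\<And>c u. u \<in> Hs_tilde s \<Omega> \<Longrightarrow> F (c *\<^sub>R u) = c * F u"
    and F_bounded: "\<And>u. u \<in> Hs_tilde s \<Omega> \<Longrightarrow> \<bar>F u\<bar> \<le> C * Hs_norm s u" and C: "0 \<le> C"
    and F_zero: "\<And>f. f \<in> test_functions W \<Longrightarrow>
      F (exterior_solution s \<Omega> B (distr_of_fun f) - distr_of_fun f) = 0"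
    and \<phi>: "\<phi> \<in> Hs_tilde s \<Omega>"
  shows "F \<phi> = 0"
proof -
  have B: "bounded_form s B" unfolding B_def by (rule bounded_form_add[OF L q])
  obtain w where w: "w \<in> Hs_tilde s \<Omega>" "\<And>\<phi>. \<phi> \<in> Hs_tilde s \<Omega> \<Longrightarrow> B \<phi> w = F \<phi>"
    using Hs_tilde_Lax_Milgram[OF B coer F_add F_scale F_bounded C] by blast
  have wH: "w \<in> Hs s" using w(1) by (rule Hs_tilde_Hs)
  have "L (distr_of_fun f) w = 0" if f: "f \<in> test_functions W" for f
  proof -
    let ?f = "distr_of_fun f" and ?u = "exterior_solution s \<Omega> B (distr_of_fun f)"
    have fH: "?f \<in> Hs s" by (rule Hs_test[OF f])
    note e = exterior_solution_Hs[OF B coer fH] exterior_solution_diff[OF B coer fH] exterior_solution_eq[OF B coer fH w(1)]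
    have "0 = B (?u - ?f) w" using w(2)[OF e(2)] F_zero[OF f] by simp
    also have "\<dots> = - B ?f w" using form_diff_left[OF B e(1) fH wH] e(3) by simp
    finally show ?thesis using local_form_exterior(2)[OF loc w(1) f W] by (simp add: B_def)
  qed
  moreover have "vanishes_on w W"
    using Hs_tilde_vanishes_on[OF w(1), of W] W closure_subset[of \<Omega>] by blast
  ultimately have "w = 0" using ucp wH unfolding right_UCP_def by blast
  then have "F \<phi> = B \<phi> 0" using w(2)[OF \<phi>] by simp
  also have "\<dots> = 0" using form_scale_right[OF B Hs_tilde_Hs[OF \<phi>] Hs_0, of 0] by simp
  finally show ?thesis .
qed

text \<open>Density and continuity in one argument, the other being fixed in \<open>Hs s\<close>;
  applying it to the form and to its transpose gives the two-sided version.\<close>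

lemma form_vanishes_on_Hs_tilde:
  assumes q: "bounded_form s q" and v: "v \<in> Hs s" and u: "u \<in> Hs_tilde s U"
    and z: "\<And>\<phi>. \<phi> \<in> test_functions U \<Longrightarrow> q (distr_of_fun \<phi>) v = 0"
  shows "q u v = 0"
proof -
  obtain K where K_nonneg: "K \<ge> 0" and K: "\<And>u v. u \<in> Hs s \<Longrightarrow> v \<in> Hs s \<Longrightarrow> \<bar>q u v\<bar> \<le> K * Hs_norm s u * Hs_norm s v"
    using bounded_form_bound[OF q] by blast
  obtain \<phi> where \<phi>: "\<And>n. \<phi> n \<in> test_functions U" "(\<lambda>n. Hs_norm s (u - distr_of_fun (\<phi> n))) \<longlonglongrightarrow> 0"
    using Hs_tilde_approx[OF u] by blast
  have "\<bar>q u v\<bar> \<le> K * Hs_norm s (u - distr_of_fun (\<phi> n)) * Hs_norm s v" for n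
    using K[OF Hs_diff(1)[OF Hs_tilde_Hs[OF u] Hs_test[OF \<phi>(1)]] v]
      form_diff_left[OF q Hs_tilde_Hs[OF u] Hs_test[OF \<phi>(1)] v] z[OF \<phi>(1)] by simp
  moreover have "(\<lambda>n. K * Hs_norm s (u - distr_of_fun (\<phi> n)) * Hs_norm s v) \<longlonglongrightarrow> 0"
    by (intro tendsto_mult_left_zero tendsto_mult_right_zero \<phi>(2))
  ultimately have "\<bar>q u v\<bar> \<le> 0" by (intro LIMSEQ_le_const) auto
  then show ?thesis by simp
qed

lemma form_vanishes_on_Hs_tilde2:
  assumes q: "bounded_form s q" and u: "u \<in> Hs_tilde s U" and v: "v \<in> Hs_tilde s U"
    and z: "\<And>\<phi> \<psi>. \<phi> \<in> test_functions U \<Longrightarrow> \<psi> \<in> test_functions U \<Longrightarrow> q (distr_of_fun \<phi>) (distr_of_fun \<psi>) = 0"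
  shows "q u v = 0"
proof (rule form_vanishes_on_Hs_tilde[OF q Hs_tilde_Hs[OF v] u])
  fix \<phi> assume \<phi>: "\<phi> \<in> test_functions U"
  show "q (distr_of_fun \<phi>) v = 0"
    using form_vanishes_on_Hs_tilde[OF bounded_form_swap[OF q] Hs_test[OF \<phi>] v] z[OF \<phi>] by blast
qed

text \<open>The two conclusions share a proof because the exterior identity contains
  \<open>q\<close> evaluated at two elements of \<open>Hs_tilde s \<Omega>\<close>, a term that is
  removed by the inner conclusion.\<close>

lemma
  fixes L q1 q2 :: "'a::euclidean_space form"
  assumes L: "bounded_form s L" and q1: "bounded_form s q1" and q2: "bounded_form s q2"
    and loc: "local_form s q1" "local_form s q2"
    and W: "W1 \<subseteq> - closure \<Omega>" "W2 \<subseteq> - closure \<Omega>" "W1 \<inter> W2 = {}"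
    and ucp: "right_UCP s L W1" "left_UCP s L W2"
    and c1: "coercive_on s \<Omega> (\<lambda>u v. L u v + q1 u v)" and c2: "coercive_on s \<Omega> (\<lambda>u v. L u v + q2 u v)"
    and data: "same_DN_data s \<Omega> L q1 q2 W1 W2"
  shows inner_forms_eq: "u \<in> Hs_tilde s \<Omega> \<Longrightarrow> v \<in> Hs_tilde s \<Omega> \<Longrightarrow> q1 u v = q2 u v"
    and exterior_forms_eq: "W \<subseteq> - closure \<Omega> \<Longrightarrow> same_DN_data s \<Omega> L q1 q2 W W \<Longrightarrow>
      u \<in> Hs_tilde s W \<Longrightarrow> v \<in> Hs_tilde s W \<Longrightarrow> q1 u v = q2 u v"
proof -
  define q where "q u v = q1 u v - q2 u v" for u v
  have q: "bounded_form s q" unfolding q_def using bounded_form_diff[OF q1 q2] .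
  have locq: "local_form s q" using loc by (simp add: local_form_def q_def)
  \<comment> \<open>\<open>?B2\<close> is already the transpose, so its exterior solutions solve the
    adjoint problem for \<open>L + q2\<close>.\<close>
  let ?B1 = "\<lambda>u v. L u v + q1 u v" and ?B2 = "\<lambda>u v. L v u + q2 v u"
  have B1: "bounded_form s ?B1" by (rule bounded_form_add[OF L q1])
  have B2: "bounded_form s ?B2" by (rule bounded_form_swap[OF bounded_form_add[OF L q2]])
  have c2': "coercive_on s \<Omega> ?B2" by (rule coercive_on_swap[OF c2])
  let ?d1 = "\<lambda>f. exterior_solution s \<Omega> ?B1 (distr_of_fun f) - distr_of_fun f"
  let ?d2 = "\<lambda>g. exterior_solution s \<Omega> ?B2 (distr_of_fun g) - distr_of_fun g"
  have d1: "?d1 f \<in> Hs_tilde s \<Omega>" if "f \<in> test_functions V" for f V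
    by (rule exterior_solution_diff[OF B1 c1 Hs_test[OF that]])
  have d2: "?d2 g \<in> Hs_tilde s \<Omega>" if "g \<in> test_functions V" for g V
    by (rule exterior_solution_diff[OF B2 c2' Hs_test[OF that]])
  \<comment> \<open>The exterior sets \<open>V1\<close> and \<open>V2\<close> are left free, as the
    identity is used both for the pair \<open>W1\<close>, \<open>W2\<close> and for \<open>W\<close>
    with itself.\<close>
  have expand: "q (?d1 f) (?d2 g) + q (distr_of_fun f) (distr_of_fun g) = 0"
    if V: "V1 \<subseteq> - closure \<Omega>" "V2 \<subseteq> - closure \<Omega>" and D: "same_DN_data s \<Omega> L q1 q2 V1 V2"
      and f: "f \<in> test_functions V1" and g: "g \<in> test_functions V2" for V1 V2 f g
  proof -
    let ?f = "distr_of_fun f" and ?g = "distr_of_fun g"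
    note H = Hs_test[OF f, of s] Hs_test[OF g, of s] Hs_tilde_Hs[OF d1[OF f]] Hs_tilde_Hs[OF d2[OF g]]
    have "q (?d1 f + ?f) (?d2 g + ?g) = 0"
      using Alessandrini_identity[OF L q1 q2 c1 c2 H(1,2)] D f g by (simp add: same_DN_data_def q_def)
    moreover have "q (?d1 f + ?f) (?d2 g + ?g) = q (?d1 f) (?d2 g) + q (?d1 f) ?g + (q ?f (?d2 g) + q ?f ?g)"
      using H by (simp only: form_add_left[OF q] form_add_right[OF q] Hs_add)
    moreover have "q (?d1 f) ?g = 0" by (rule local_form_exterior(1)[OF locq d1[OF f] g V(2)])
    moreover have "q ?f (?d2 g) = 0" by (rule local_form_exterior(2)[OF locq d2[OF g] f V(1)])
    ultimately show ?thesis by simp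
  qed
  have 1: "q (?d1 f) (?d2 g) = 0" if f: "f \<in> test_functions W1" and g: "g \<in> test_functions W2" for f g
  proof -
    have "distr_support (distr_of_fun f) \<inter> distr_support (distr_of_fun g) = {}"
      using distr_support_test_subset[OF f] distr_support_test_subset[OF g] W(3) by blast
    then have "q (distr_of_fun f) (distr_of_fun g) = 0"
      using locq Hs_test[OF f] Hs_test[OF g] by (simp add: local_form_def)
    then show ?thesis using expand[OF W(1,2) data f g] by simp
  qed
  obtain K where K: "K \<ge> 0" "\<And>u v. u \<in> Hs s \<Longrightarrow> v \<in> Hs s \<Longrightarrow> \<bar>q u v\<bar> \<le> K * Hs_norm s u * Hs_norm s v"
    using bounded_form_bound[OF q] by blast
  \<comment> \<open>Runge in the first argument with \<open>?d2 g\<close> held fixed extends the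
    vanishing from the corrections \<open>?d1 f\<close> to all of
    \<open>Hs_tilde s \<Omega>\<close>. The second argument is freed afterwards, against an
    arbitrary \<open>\<phi>\<close>.\<close>
  have 2: "q \<phi> (?d2 g) = 0" if \<phi>: "\<phi> \<in> Hs_tilde s \<Omega>" and g: "g \<in> test_functions W2" for \<phi> g
  proof (rule Runge[OF L q1 loc(1) c1 W(1) ucp(1), of "\<lambda>\<phi>. q \<phi> (?d2 g)" "K * Hs_norm s (?d2 g)"])
    have H: "?d2 g \<in> Hs s" by (rule Hs_tilde_Hs[OF d2[OF g]])
    show "\<bar>q u (?d2 g)\<bar> \<le> K * Hs_norm s (?d2 g) * Hs_norm s u" if "u \<in> Hs_tilde s \<Omega>" for u
      using K(2)[OF Hs_tilde_Hs[OF that] H] by (simp only: mult_ac)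
    show "0 \<le> K * Hs_norm s (?d2 g)" by (rule mult_nonneg_nonneg[OF K(1) Hs_norm_nonneg])
    show "q (u + v) (?d2 g) = q u (?d2 g) + q v (?d2 g)"
      if "u \<in> Hs_tilde s \<Omega>" "v \<in> Hs_tilde s \<Omega>" for u v
      by (rule form_add_left[OF q Hs_tilde_Hs[OF that(1)] Hs_tilde_Hs[OF that(2)] H])
    show "q (c *\<^sub>R u) (?d2 g) = c * q u (?d2 g)" if "u \<in> Hs_tilde s \<Omega>" for c u
      by (rule form_scale_left[OF q Hs_tilde_Hs[OF that] H])
  qed (use 1 g \<phi> in auto)
  \<comment> \<open>Transposition turns the left UCP of \<open>L\<close> into a right UCP, so the
    same approximation lemma applies in the second argument.\<close>
  have swap: "local_form s (\<lambda>u v. q2 v u)" "right_UCP s (\<lambda>u v. L v u) W2"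
    using loc(2) ucp(2) by (auto simp: local_form_def left_UCP_def right_UCP_def Int_commute)
  have inner: "q \<phi> \<psi> = 0" if \<phi>: "\<phi> \<in> Hs_tilde s \<Omega>" and \<psi>: "\<psi> \<in> Hs_tilde s \<Omega>" for \<phi> \<psi>
  proof (rule Runge[OF bounded_form_swap[OF L] bounded_form_swap[OF q2] swap(1) c2' W(2) swap(2),
        of "\<lambda>\<psi>. q \<phi> \<psi>" "K * Hs_norm s \<phi>"])
    have H: "\<phi> \<in> Hs s" by (rule Hs_tilde_Hs[OF \<phi>])
    show "\<bar>q \<phi> u\<bar> \<le> K * Hs_norm s \<phi> * Hs_norm s u" if "u \<in> Hs_tilde s \<Omega>" for u
      by (rule K(2)[OF H Hs_tilde_Hs[OF that]])
    show "0 \<le> K * Hs_norm s \<phi>" by (rule mult_nonneg_nonneg[OF K(1) Hs_norm_nonneg])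
    show "q \<phi> (u + v) = q \<phi> u + q \<phi> v" if "u \<in> Hs_tilde s \<Omega>" "v \<in> Hs_tilde s \<Omega>" for u v
      by (rule form_add_right[OF q Hs_tilde_Hs[OF that(1)] Hs_tilde_Hs[OF that(2)] H])
    show "q \<phi> (c *\<^sub>R u) = c * q \<phi> u" if "u \<in> Hs_tilde s \<Omega>" for c u
      by (rule form_scale_right[OF q H Hs_tilde_Hs[OF that]])
  qed (use 2 \<phi> \<psi> in auto)
  show "q1 u v = q2 u v" if "u \<in> Hs_tilde s \<Omega>" "v \<in> Hs_tilde s \<Omega>"
    using inner[OF that] by (simp add: q_def)
  show "q1 u v = q2 u v"
    if V: "W \<subseteq> - closure \<Omega>" and D: "same_DN_data s \<Omega> L q1 q2 W W" and uv: "u \<in> Hs_tilde s W" "v \<in> Hs_tilde s W"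
  proof -
    have "q u v = 0"
    proof (rule form_vanishes_on_Hs_tilde2[OF q uv])
      fix f g assume f: "f \<in> test_functions W" and g: "g \<in> test_functions W"
      show "q (distr_of_fun f) (distr_of_fun g) = 0"
        using expand[OF V V D f g] inner[OF d1[OF f] d2[OF g]] by simp
    qed
    then show ?thesis by (simp add: q_def)
  qed
qed

section \<open>Forms given by functions\<close>

lemma integrable_locally_integrable_test:
  fixes Q :: "'a::euclidean_space \<Rightarrow> real"
  assumes Q: "locally_integrable Q" and \<phi>: "\<phi> \<in> test_functions U"
  shows "integrable lebesgue (\<lambda>x. Q x * \<phi> x * \<phi> x)"
proof -
  let ?K = "closure {x. \<phi> x \<noteq> 0}"
  have K: "compact ?K" using \<phi> by (simp add: test_functions_def)
  then have i: "integrable lebesgue (\<lambda>x. indicator ?K x *\<^sub>R Q x)"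
    using Q by (simp add: locally_integrable_def set_integrable_def)
  have c: "continuous_on UNIV \<phi>" by (rule test_functions_continuous[OF \<phi>])
  have z: "\<phi> x = 0" if "x \<notin> ?K" for x using that closure_subset[of "{x. \<phi> x \<noteq> 0}"] by blast
  obtain C where C: "\<And>x. norm (\<phi> x) \<le> C" using compact_support_bounded[OF c K z] by blast
  have m: "\<phi> \<in> borel_measurable lebesgue"
    using borel_measurable_continuous_onI[OF c] by (simp add: measurable_completion)
  have "integrable lebesgue (\<lambda>x. (C * C) * (indicator ?K x *\<^sub>R Q x))" using i by simp
  then have "integrable lebesgue (\<lambda>x. indicator ?K x *\<^sub>R Q x * \<phi> x * \<phi> x)"
  proof (rule Bochner_Integration.integrable_bound)
    show "(\<lambda>x. indicator ?K x *\<^sub>R Q x * \<phi> x * \<phi> x) \<in> borel_measurable lebesgue"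
      using borel_measurable_integrable[OF i] m by (intro borel_measurable_times)
    have "norm (a * \<phi> x * \<phi> x) \<le> norm (C * C * a)" for a x
    proof -
      have "norm (\<phi> x) * norm (\<phi> x) \<le> C * C"
        using C[of x] by (intro mult_mono) (auto intro: order_trans[OF norm_ge_zero])
      then have "norm a * (norm (\<phi> x) * norm (\<phi> x)) \<le> norm a * (C * C)" by (rule mult_left_mono) simp
      then show ?thesis by (simp add: abs_mult mult_ac)
    qed
    then show "AE x in lebesgue. norm (indicator ?K x *\<^sub>R Q x * \<phi> x * \<phi> x) \<le> norm (C * C * (indicator ?K x *\<^sub>R Q x))"
      by simp
  qed
  moreover have "indicator ?K x *\<^sub>R Q x * \<phi> x * \<phi> x = Q x * \<phi> x * \<phi> x" for x
    using z[of x] by (cases "x \<in> ?K") auto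
  ultimately show ?thesis by (simp only:)
qed

lemma locally_integrable_diff:
  "locally_integrable P \<Longrightarrow> locally_integrable Q \<Longrightarrow> locally_integrable (\<lambda>x. P x - Q x)"
  unfolding locally_integrable_def by (auto intro: set_integral_diff(1))

lemma continuous_imp_locally_integrable:
  fixes Q :: "'a::euclidean_space \<Rightarrow> real"
  assumes Q: "continuous_on UNIV Q" shows "locally_integrable Q"
  unfolding locally_integrable_def
proof (intro allI impI)
  fix K :: "'a set" assume K: "compact K"
  then obtain a where a: "K \<subseteq> cbox (- a) a"
    using bounded_subset_cbox_symmetric[OF compact_imp_bounded] by blast
  have "Q absolutely_integrable_on cbox (- a) a"
    by (intro absolutely_integrable_continuous continuous_on_subset[OF Q]) simp
  moreover have "K \<in> sets lebesgue" using lmeasurable_compact[OF K] by blast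
  ultimately show "Q absolutely_integrable_on K" using a by (rule set_integrable_subset)
qed

text \<open>Test functions on \<open>U\<close> belong to \<open>Hs_tilde s U\<close>, and comparing
  the two forms at equal arguments is exactly the hypothesis of the fundamental lemma for
  \<open>Q1 - Q2\<close>.\<close>

lemma form_of_fun_eq_AE:
  fixes U :: "'a::euclidean_space set"
  assumes U: "open U" and Q: "locally_integrable Q1" "locally_integrable Q2"
    and F: "form_of_fun Q1 q1" "form_of_fun Q2 q2"
    and eq: "\<And>u v. u \<in> Hs_tilde s U \<Longrightarrow> v \<in> Hs_tilde s U \<Longrightarrow> q1 u v = q2 u v"
  shows "AE x in lebesgue. x \<in> U \<longrightarrow> Q1 x = Q2 x"
proof -
  have "AE x in lebesgue. x \<in> U \<longrightarrow> Q1 x - Q2 x = 0"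
  proof (rule fundamental_lemma_calculus_of_variations[OF U locally_integrable_diff[OF Q]])
    fix \<phi> assume \<phi>: "\<phi> \<in> test_functions U"
    have \<phi>': "\<phi> \<in> test_functions UNIV" using \<phi> test_functions_mono[of U UNIV] by blast
    have "(LINT x|lebesgue. Q1 x * \<phi> x * \<phi> x) = (LINT x|lebesgue. Q2 x * \<phi> x * \<phi> x)"
      using F \<phi>' eq[OF Hs_tilde_test[OF \<phi>] Hs_tilde_test[OF \<phi>]] by (simp add: form_of_fun_def)
    then show "(LINT x|lebesgue. (Q1 x - Q2 x) * \<phi> x * \<phi> x) = 0"
      using integrable_locally_integrable_test[OF Q(1) \<phi>] integrable_locally_integrable_test[OF Q(2) \<phi>]
      by (simp add: left_diff_distrib)
  qed
  then show ?thesis by simp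
qed

text \<open>By continuity the set of disagreement inside \<open>U\<close> is open; if nonempty, it
  would have positive measure.\<close>

lemma continuous_AE_eq_imp_eq:
  fixes P Q :: "'a::euclidean_space \<Rightarrow> real"
  assumes P: "continuous_on UNIV P" and Q: "continuous_on UNIV Q" and U: "open U"
    and ae: "AE x in lebesgue. x \<in> U \<longrightarrow> P x = Q x" and x: "x \<in> U"
  shows "P x = Q x"
proof (rule ccontr)
  assume ne: "P x \<noteq> Q x"
  let ?S = "{x. P x \<noteq> Q x} \<inter> U"
  have "open ?S" using open_Collect_neq[OF P Q] U by (rule open_Int)
  have "{x. \<not> (x \<in> U \<longrightarrow> P x = Q x)} \<in> null_sets lebesgue"
    using ae by (simp add: completion.AE_iff_null_sets Collect_conj_eq[symmetric])
  then have "negligible ?S" unfolding negligible_iff_null_sets by (simp add: Collect_conj_eq Int_commute)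
  then show False using open_not_negligible[OF \<open>open ?S\<close>] ne x by blast
qed

theorem corollary2p7:
  fixes s :: real and \<Omega> W1 W2 :: "(real^'n) set"
    and L q1 q2 :: "(real^'n) form"
  assumes "open \<Omega>" and "- closure \<Omega> \<noteq> {}"
    and "bounded_form s L"
    and "open W1" and "W1 \<noteq> {}" and "W1 \<subseteq> - closure \<Omega>"
    and "open W2" and "W2 \<noteq> {}" and "W2 \<subseteq> - closure \<Omega>"
    and "W1 \<inter> W2 = {}"
    and "right_UCP s L W1" and "left_UCP s L W2"
    and "local_form s q1" and "bounded_form s q1"
    and "local_form s q2" and "bounded_form s q2"
    and "coercive_on s \<Omega> (\<lambda>u v. L u v + q1 u v)"
    and "coercive_on s \<Omega> (\<lambda>u v. L u v + q2 u v)"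
    and "same_DN_data s \<Omega> L q1 q2 W1 W2"
  shows "(\<forall>W. open W \<and> W \<subseteq> - closure \<Omega> \<and> same_DN_data s \<Omega> L q1 q2 W W \<longrightarrow>
            (\<forall>u\<in>Hs_tilde s W. \<forall>v\<in>Hs_tilde s W. q1 u v = q2 u v)) \<and>
         (same_DN_data s \<Omega> L q1 q2 (- closure \<Omega>) (- closure \<Omega>) \<longrightarrow>
            (\<forall>Q1 Q2. form_of_fun Q1 q1 \<and> form_of_fun Q2 q2 \<longrightarrow>
               (continuous_on UNIV Q1 \<and> continuous_on UNIV Q2 \<longrightarrow> (\<forall>x. Q1 x = Q2 x)) \<and>
               (locally_integrable Q1 \<and> locally_integrable Q2 \<and> negligible (frontier \<Omega>) \<longrightarrow>
                  (AE x in lebesgue. Q1 x = Q2 x))))"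
proof -
  note inner = inner_forms_eq[OF assms(3,14,16,13,15,6,9,10,11,12,17,18,19)]
  note outer = exterior_forms_eq[OF assms(3,14,16,13,15,6,9,10,11,12,17,18,19)]
  let ?E = "- closure \<Omega>"
  have E: "open ?E" by (simp add: open_Compl)
  have Q: "(continuous_on UNIV Q1 \<and> continuous_on UNIV Q2 \<longrightarrow> (\<forall>x. Q1 x = Q2 x)) \<and>
      (locally_integrable Q1 \<and> locally_integrable Q2 \<and> negligible (frontier \<Omega>) \<longrightarrow>
        (AE x in lebesgue. Q1 x = Q2 x))"
    if D: "same_DN_data s \<Omega> L q1 q2 ?E ?E" and F: "form_of_fun Q1 q1" "form_of_fun Q2 q2" for Q1 Q2
  proof (intro conjI impI allI)
    have ae: "AE x in lebesgue. x \<in> \<Omega> \<longrightarrow> Q1 x = Q2 x" "AE x in lebesgue. x \<in> ?E \<longrightarrow> Q1 x = Q2 x"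
      if "locally_integrable Q1" "locally_integrable Q2"
      using form_of_fun_eq_AE[OF assms(1) that F inner] form_of_fun_eq_AE[OF E that F outer[OF order_refl D]]
      by blast+
    {
      fix x assume c: "continuous_on UNIV Q1 \<and> continuous_on UNIV Q2"
      then have c1: "continuous_on UNIV Q1" and c2: "continuous_on UNIV Q2" by auto
      note ae' = ae[OF continuous_imp_locally_integrable[OF c1] continuous_imp_locally_integrable[OF c2]]
      \<comment> \<open>Boundary points are reached through closedness of the agreement set, which
        carries equality from \<open>\<Omega>\<close> to its closure.\<close>
      have "closed {x. Q1 x = Q2 x}" using closed_Collect_eq[OF c1 c2] .
      moreover have "\<Omega> \<subseteq> {x. Q1 x = Q2 x}"
        using continuous_AE_eq_imp_eq[OF c1 c2 assms(1) ae'(1)] by blast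
      ultimately have "closure \<Omega> \<subseteq> {x. Q1 x = Q2 x}" by (intro closure_minimal)
      moreover have "?E \<subseteq> {x. Q1 x = Q2 x}"
        using continuous_AE_eq_imp_eq[OF c1 c2 E ae'(2)] by blast
      ultimately show "Q1 x = Q2 x" by blast
    }
    assume l: "locally_integrable Q1 \<and> locally_integrable Q2 \<and> negligible (frontier \<Omega>)"
    \<comment> \<open>\<open>\<Omega>\<close>, its frontier and the exterior cover the space; with
      the frontier null, the two almost-everywhere statements combine.\<close>
    then have "AE x in lebesgue. x \<notin> frontier \<Omega>"
      by (intro AE_not_in) (simp add: negligible_iff_null_sets)
    moreover have "AE x in lebesgue. x \<in> \<Omega> \<longrightarrow> Q1 x = Q2 x" "AE x in lebesgue. x \<in> ?E \<longrightarrow> Q1 x = Q2 x"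
      using ae l by auto
    ultimately show "AE x in lebesgue. Q1 x = Q2 x"
      by eventually_elim (auto simp: frontier_def interior_open[OF assms(1)])
  qed
  then show ?thesis using outer by blast
qed

end
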